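(* Let $M\subset\mathbb{R}^2$ be a star-shaped set whose convex hull is a $2$-dimensional convex polytope, and assume that $M$ has simple $\mathrm{PD}_0$. Then $\mathrm{PHT}_0(M)$ (viewed as a persistence diagram bundle over $\mathbb{S}^1$) has trivial geometric monodromy.
   Context: A set $M\subset\mathbb{R}^2$ is star-shaped if there is a point $c\in M$ such that for every $x\in M$ the segment from $c$ to $x$ is contained in $M$. Fix a field $\mathbb{F}$. $H_0(A)$ is the $\mathbb{F}$-vector space of formal linear combinations of connected components of $A$. For $\mathbf{v}\in\mathbb{S}^1$, let $M_{\mathbf{v},t}=\{x\in M\mid \langle x,\mathbf{v}\rangle\le t\}$ and let $\mathrm{PH}_0(M,\mathbf{v})$ be the persistence module $(\{H_0(M_{\mathbf{v},t})\}_{t\in\mathbb{R}})$ with maps induced by inclusion; it is assumed throughout to be pointwise finite-dimensional, so it decomposes uniquely as a direct sum of interval modules $\mathcal{I}_A$. Let $\overline{\mathbb{R}}=\mathbb{R}\cup\{+\infty\}$. The persistence diagram $\mathrm{PD}_0(M,\mathbf{v})$ is the multiset of points $(\inf A,\sup A)\in\overline{\mathbb{R}}^2$ over the intervals $A$ in the decomposition, together with one copy of an abstract diagonal element $\Delta$. $M$ has simple $\mathrm{PD}_0$ if, for all $\mathbf{v}\in\mathbb{S}^{1}$, $\mathrm{PD}_0(M,\mathbf{v})$ has no (off-diagonal) points of multiplicity $>1$ and has only finitely many (off-diagonal) points. Distances: $\ell_\infty$ between points of $\mathbb{R}^2$, and $\|(a,b)-\Delta\|_\infty=(b-a)/2$,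 $\|\Delta-\Delta\|_\infty=0$, $\|(a,\infty)-(b,\infty)\|_\infty=|a-b|$, $\|(a,\infty)-x\|_\infty=\infty$ for $a,b\in\mathbb{R}$, $x\in\mathbb{R}^2\cup\Delta$. The bottleneck distance between diagrams is $\inf_{\mathcal{M}}\sup_{(x,y)\in\mathcal{M}}\|x-y\|_\infty$, over matchings $\mathcal M$ (sets of pairs in which each off-diagonal element of either diagram occurs exactly once; $\Delta$ may occur many times). A persistence diagram bundle is a topological space $B$ with a function $f$ from $B$ to persistence diagrams that is continuous for the bottleneck distance. $\mathrm{PHT}_0(M)$ is the bundle with $B=\mathbb{S}^1$, $f(\mathbf{v})=\mathrm{PD}_0(M,\mathbf{v})$. A section of $(B,f)$ is a function $\gamma\colon B\to\overline{\mathbb{R}}^2\cup\Delta$, continuous with respect to the distances above, with $\gamma(p)\in f(p)$ for all $p\in B$ and such that $\{p\in B\mid\gamma(p)\ne\Delta\}$ is connected. $(B,f)$ has trivial geometric monodromy if there exist sections $\{\gamma_i\}$ such that, for all $p\in B$, the off-diagonal part of $f(p)$ equals $\bigcup_{i\,\mid\,\gamma_i(p)\ne\Delta}\gamma_i(p)$. *)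

theory Defs
  imports "HOL-Analysis.Analysis" "HOL-Library.Poly_Mapping"
begin

section \<open>Persistence modules over the real line\<close>

text \<open>
  The vector space at parameter \<open>t\<close> is the subset \<open>pm_space V t\<close> of one ambient vector space
  with scalar multiplication \<open>pm_scale V\<close>. The structure map \<open>pm_map V s t\<close> is only meaningful
  for \<open>s \<le> t\<close> and on \<open>pm_space V s\<close>.
\<close>

record ('f, 'v) pers_module =
  pm_scale :: "'f \<Rightarrow> 'v \<Rightarrow> 'v"
  pm_space :: "real \<Rightarrow> 'v set"
  pm_map :: "real \<Rightarrow> real \<Rightarrow> 'v \<Rightarrow> 'v"

definition linear_betw ::
  "('f \<Rightarrow> 'v \<Rightarrow> 'v) \<Rightarrow> 'v set \<Rightarrow> ('f \<Rightarrow> 'w \<Rightarrow> 'w) \<Rightarrow> 'w set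
    \<Rightarrow> ('v::ab_group_add \<Rightarrow> 'w::ab_group_add) \<Rightarrow> bool" where
  "linear_betw sv V sw W h \<longleftrightarrow>
     h ` V \<subseteq> W \<and>
     (\<forall>x\<in>V. \<forall>y\<in>V. h (x + y) = h x + h y) \<and>
     (\<forall>c. \<forall>x\<in>V. h (sv c x) = sw c (h x))"

definition persistence_module :: "('f::field, 'v::ab_group_add) pers_module \<Rightarrow> bool" where
  "persistence_module V \<longleftrightarrow>
     vector_space (pm_scale V) \<and>
     (\<forall>t. module.subspace (pm_scale V) (pm_space V t)) \<and>
     (\<forall>s t. s \<le> t \<longrightarrow>
        linear_betw (pm_scale V) (pm_space V s) (pm_scale V) (pm_space V t) (pm_map V s t)) \<and>
     (\<forall>t. \<forall>x\<in>pm_space V t. pm_map V t t x = x) \<and>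
     (\<forall>r s t. r \<le> s \<longrightarrow> s \<le> t \<longrightarrow>
        (\<forall>x\<in>pm_space V r. pm_map V s t (pm_map V r s x) = pm_map V r t x))"

definition pointwise_finite_dim :: "('f::field, 'v::ab_group_add) pers_module \<Rightarrow> bool" where
  "pointwise_finite_dim V \<longleftrightarrow>
     (\<forall>t. \<exists>S. finite S \<and> S \<subseteq> pm_space V t \<and> module.span (pm_scale V) S = pm_space V t)"

definition pm_isomorphic ::
  "('f::field, 'v::ab_group_add) pers_module \<Rightarrow> ('f, 'w::ab_group_add) pers_module \<Rightarrow> bool" where
  "pm_isomorphic V W \<longleftrightarrow>
     (\<exists>h :: real \<Rightarrow> 'v \<Rightarrow> 'w.
        (\<forall>t. bij_betw (h t) (pm_space V t) (pm_space W t) \<and>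
             linear_betw (pm_scale V) (pm_space V t) (pm_scale W) (pm_space W t) (h t)) \<and>
        (\<forall>s t. s \<le> t \<longrightarrow>
           (\<forall>x\<in>pm_space V s. h t (pm_map V s t x) = pm_map W s t (h s x))))"

definition interval_module :: "real set \<Rightarrow> ('f::field, 'f) pers_module" where
  "interval_module A =
     \<lparr> pm_scale = (*),
       pm_space = (\<lambda>t. if t \<in> A then UNIV else {0}),
       pm_map = (\<lambda>s t x. if s \<in> A \<and> t \<in> A then x else 0) \<rparr>"

definition direct_sum ::
  "'i set \<Rightarrow> ('i \<Rightarrow> ('f::field, 'v::ab_group_add) pers_module) \<Rightarrow> ('f, 'i \<Rightarrow>\<^sub>0 'v) pers_module" where
  "direct_sum I V =
     \<lparr> pm_scale = (\<lambda>c. Poly_Mapping.mapp (\<lambda>i. pm_scale (V i) c)),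
       pm_space = (\<lambda>t. {p. Poly_Mapping.keys p \<subseteq> I \<and>
                           (\<forall>i\<in>I. Poly_Mapping.lookup p i \<in> pm_space (V i) t)}),
       pm_map = (\<lambda>s t. Poly_Mapping.mapp (\<lambda>i. pm_map (V i) s t)) \<rparr>"

text \<open>
  A multiset of intervals that may be infinite is given by its multiplicity function
  \<open>\<mu>\<close>; the copies of \<open>A\<close> are the pairs \<open>(A, k)\<close> with \<open>k < \<mu> A\<close>. All multiplicities are finite for
  pointwise finite-dimensional modules, as intervals are nonempty.
\<close>

definition copies :: "('a \<Rightarrow> nat) \<Rightarrow> ('a \<times> nat) set" where
  "copies \<mu> = {(a, k). k < \<mu> a}"

definition interval_decomposition ::
  "('f::field, 'v::ab_group_add) pers_module \<Rightarrow> (real set \<Rightarrow> nat) \<Rightarrow> bool" where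
  "interval_decomposition V \<mu> \<longleftrightarrow>
     (\<forall>A. 0 < \<mu> A \<longrightarrow> is_interval A \<and> A \<noteq> {}) \<and>
     pm_isomorphic V (direct_sum (copies \<mu>) (\<lambda>(A, k). interval_module A))"

text \<open>
  A pointwise finite-dimensional module has exactly one interval decomposition
  (Crawley-Boevey; Azumaya), so the choice below is no choice for such modules.
\<close>

definition barcode :: "('f::field, 'v::ab_group_add) pers_module \<Rightarrow> real set \<Rightarrow> nat" where
  "barcode V = (SOME \<mu>. interval_decomposition V \<mu>)"


section \<open>Persistence diagrams and the bottleneck distance\<close>

datatype pd_elem = Pt ereal ereal | Diagonal

text \<open>
  A diagram is the multiplicity function of a possibly infinite multiset. ``Off-diagonal'' means
  different from the abstract element \<open>Diagonal\<close>. In particular an interval \<open>[a,a]\<close> contributes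
  the point \<open>Pt a a\<close>, which counts as off-diagonal and is at distance \<open>0\<close> from \<open>Diagonal\<close>.
\<close>

type_synonym pdiagram = "pd_elem \<Rightarrow> nat"

definition is_pdiagram :: "pdiagram \<Rightarrow> bool" where
  "is_pdiagram D \<longleftrightarrow>
     D Diagonal = 1 \<and> (\<forall>a b. 0 < D (Pt a b) \<longrightarrow> a \<noteq> -\<infinity> \<and> b \<noteq> -\<infinity>)"

definition diagram_of_module :: "('f::field, 'v::ab_group_add) pers_module \<Rightarrow> pdiagram" where
  "diagram_of_module V x =
     (case x of
        Diagonal \<Rightarrow> 1
      | Pt a b \<Rightarrow> card {(A, k) \<in> copies (barcode V). Inf (ereal ` A) = a \<and> Sup (ereal ` A) = b})"

text \<open>
  The last equation also covers pairs with a coordinate \<open>-\<infinity>\<close> or first coordinate \<open>\<infinity>\<close>; no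
  intervals of the modules considered below give such points.
\<close>

fun pd_dist :: "pd_elem \<Rightarrow> pd_elem \<Rightarrow> ennreal" where
  "pd_dist Diagonal Diagonal = 0"
| "pd_dist (Pt (ereal a) (ereal b)) (Pt (ereal c) (ereal d)) = ennreal (max \<bar>a - c\<bar> \<bar>b - d\<bar>)"
| "pd_dist (Pt (ereal a) (ereal b)) Diagonal = ennreal ((b - a) / 2)"
| "pd_dist Diagonal (Pt (ereal a) (ereal b)) = ennreal ((b - a) / 2)"
| "pd_dist (Pt (ereal a) PInfty) (Pt (ereal b) PInfty) = ennreal \<bar>a - b\<bar>"
| "pd_dist _ _ = \<infinity>"

definition pd_matching ::
  "pdiagram \<Rightarrow> pdiagram \<Rightarrow> ((pd_elem \<times> nat) \<times> (pd_elem \<times> nat)) set \<Rightarrow> bool" where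
  "pd_matching D E \<M> \<longleftrightarrow>
     \<M> \<subseteq> copies D \<times> copies E \<and>
     (\<forall>u\<in>copies D. fst u \<noteq> Diagonal \<longrightarrow> (\<exists>!w. (u, w) \<in> \<M>)) \<and>
     (\<forall>w\<in>copies E. fst w \<noteq> Diagonal \<longrightarrow> (\<exists>!u. (u, w) \<in> \<M>))"

definition bottleneck_dist :: "pdiagram \<Rightarrow> pdiagram \<Rightarrow> ennreal" where
  "bottleneck_dist D E =
     (INF \<M> \<in> {\<M>. pd_matching D E \<M>}. SUP (u, w) \<in> \<M>. pd_dist (fst u) (fst w))"


section \<open>Persistence diagram bundles\<close>

definition continuous_wrt :: "'b topology \<Rightarrow> ('y \<Rightarrow> 'y \<Rightarrow> ennreal) \<Rightarrow> ('b \<Rightarrow> 'y) \<Rightarrow> bool" where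
  "continuous_wrt B d f \<longleftrightarrow>
     (\<forall>p\<in>topspace B. \<forall>\<epsilon>::real. 0 < \<epsilon> \<longrightarrow>
        (\<exists>U. openin B U \<and> p \<in> U \<and> (\<forall>q\<in>U. d (f p) (f q) < ennreal \<epsilon>)))"

definition pd_bundle :: "'b topology \<Rightarrow> ('b \<Rightarrow> pdiagram) \<Rightarrow> bool" where
  "pd_bundle B f \<longleftrightarrow>
     (\<forall>p\<in>topspace B. is_pdiagram (f p)) \<and> continuous_wrt B bottleneck_dist f"

definition pd_section :: "'b topology \<Rightarrow> ('b \<Rightarrow> pdiagram) \<Rightarrow> ('b \<Rightarrow> pd_elem) \<Rightarrow> bool" where
  "pd_section B f \<gamma> \<longleftrightarrow>
     continuous_wrt B pd_dist \<gamma> \<and>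
     (\<forall>p\<in>topspace B. 0 < f p (\<gamma> p)) \<and>
     connectedin B {p \<in> topspace B. \<gamma> p \<noteq> Diagonal}"

text \<open>
  The union of the values of the sections is a union of multisets: the multiplicity of an
  off-diagonal point in \<open>f p\<close> is the number of sections through it. The index type is large
  enough for every relevant family, since a section that is not constantly \<open>Diagonal\<close> can only be
  repeated finitely often.
\<close>

definition trivial_geometric_monodromy :: "'b topology \<Rightarrow> ('b \<Rightarrow> pdiagram) \<Rightarrow> bool" where
  "trivial_geometric_monodromy B f \<longleftrightarrow>
     (\<exists>(I :: (('b \<Rightarrow> pd_elem) \<times> nat) set) \<gamma>.
        (\<forall>i\<in>I. pd_section B f (\<gamma> i)) \<and>
        (\<forall>p\<in>topspace B. \<forall>x. x \<noteq> Diagonal \<longrightarrow>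
           finite {i \<in> I. \<gamma> i p = x} \<and> f p x = card {i \<in> I. \<gamma> i p = x}))"


section \<open>The degree-0 persistent homology transform of a plane set\<close>

definition H0_scale :: "'f::field \<Rightarrow> ('a set \<Rightarrow>\<^sub>0 'f) \<Rightarrow> ('a set \<Rightarrow>\<^sub>0 'f)" where
  "H0_scale c = Poly_Mapping.map ((*) c)"

definition H0_space :: "'a::topological_space set \<Rightarrow> ('a set \<Rightarrow>\<^sub>0 'f::field) set" where
  "H0_space A = {p. Poly_Mapping.keys p \<subseteq> components A}"

text \<open>
  The map \<open>H\<^sub>0(A) \<rightarrow> H\<^sub>0(B)\<close> induced by an inclusion of \<open>A\<close> into \<open>B\<close>: linear extension of the map
  sending a component of \<open>A\<close> to the component of \<open>B\<close> containing it.
\<close>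

definition H0_incl :: "'a::topological_space set \<Rightarrow> ('a set \<Rightarrow>\<^sub>0 'f::field) \<Rightarrow> ('a set \<Rightarrow>\<^sub>0 'f)" where
  "H0_incl B p =
     (\<Sum>C\<in>Poly_Mapping.keys p.
        Poly_Mapping.single (THE C'. C' \<in> components B \<and> C \<subseteq> C') (Poly_Mapping.lookup p C))"

definition sublevel :: "(real^2) set \<Rightarrow> real^2 \<Rightarrow> real \<Rightarrow> (real^2) set" where
  "sublevel M v t = {x \<in> M. x \<bullet> v \<le> t}"

definition PH0 :: "(real^2) set \<Rightarrow> real^2 \<Rightarrow> ('f::field, (real^2) set \<Rightarrow>\<^sub>0 'f) pers_module" where
  "PH0 M v =
     \<lparr> pm_scale = H0_scale,
       pm_space = (\<lambda>t. H0_space (sublevel M v t)),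
       pm_map = (\<lambda>s t. H0_incl (sublevel M v t)) \<rparr>"

text \<open>The field is passed as a type argument because it is not visible in the diagram.\<close>

definition PD0 :: "'f::field itself \<Rightarrow> (real^2) set \<Rightarrow> real^2 \<Rightarrow> pdiagram" where
  "PD0 F M v = diagram_of_module (PH0 M v :: ('f, (real^2) set \<Rightarrow>\<^sub>0 'f) pers_module)"

definition simple_PD0 :: "'f::field itself \<Rightarrow> (real^2) set \<Rightarrow> bool" where
  "simple_PD0 F M \<longleftrightarrow>
     (\<forall>v\<in>sphere 0 1.
        (\<forall>x. x \<noteq> Diagonal \<longrightarrow> PD0 F M v x \<le> 1) \<and>
        finite {x. x \<noteq> Diagonal \<and> 0 < PD0 F M v x})"

abbreviation circle :: "(real^2) topology" where
  "circle \<equiv> top_of_set (sphere 0 1)"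


section \<open>The modules above are persistence modules\<close>

lemma lookup_H0_scale: "Poly_Mapping.lookup (H0_scale c p) C = c * Poly_Mapping.lookup p C"
  by (simp add: H0_scale_def Poly_Mapping.map.rep_eq when_def)

lemma vector_space_H0_scale: "vector_space (H0_scale :: 'f::field \<Rightarrow> ('a set \<Rightarrow>\<^sub>0 'f) \<Rightarrow> _)"
  by unfold_locales (auto intro!: poly_mapping_eqI simp: lookup_H0_scale lookup_add algebra_simps)

lemma subspace_H0_space: fixes A :: "'a::topological_space set" shows "module.subspace H0_scale (H0_space A :: (_ \<Rightarrow>\<^sub>0 'f::field) set)"
proof -
  interpret vector_space "H0_scale :: 'f::field \<Rightarrow> ('a::topological_space set \<Rightarrow>\<^sub>0 'f) \<Rightarrow> _"
    by (rule vector_space_H0_scale)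
  show "subspace (H0_space A :: (_ \<Rightarrow>\<^sub>0 'f) set)"
    unfolding subspace_def H0_space_def
    by (auto simp: in_keys_iff lookup_add lookup_H0_scale subset_iff) (metis add_cancel_right_left)
qed

lemma H0_incl_superset:
  assumes "finite K" "Poly_Mapping.keys p \<subseteq> K"
  shows "H0_incl B p = (\<Sum>C\<in>K.
     Poly_Mapping.single (THE C'. C' \<in> components B \<and> C \<subseteq> C') (Poly_Mapping.lookup p C))"
  unfolding H0_incl_def
  by (rule sum.mono_neutral_left) (use assms in \<open>auto simp: in_keys_iff\<close>)

lemma H0_incl_single: "H0_incl B (Poly_Mapping.single C a) =
    Poly_Mapping.single (THE C'. C' \<in> components B \<and> C \<subseteq> C') a"
  by (simp add: H0_incl_superset[of "{C}"])

lemma H0_incl_add: "H0_incl B (p + q) = H0_incl B p + H0_incl B q"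
proof -
  let ?K = "Poly_Mapping.keys p \<union> Poly_Mapping.keys q"
  have "Poly_Mapping.keys (p + q) \<subseteq> ?K" by (rule Poly_Mapping.keys_add)
  then show ?thesis
    by (simp add: H0_incl_superset[of ?K] lookup_add single_add sum.distrib)
qed

lemma H0_incl_sum: "H0_incl B (sum g K) = (\<Sum>k\<in>K. H0_incl B (g k))"
  by (induction K rule: infinite_finite_induct) (auto simp: H0_incl_add, auto simp: H0_incl_def)

lemma H0_incl_scale: fixes B :: "'a::topological_space set" and c :: "'f::field" shows "H0_incl B (H0_scale c p) = H0_scale c (H0_incl B p)"
proof -
  interpret vector_space "H0_scale :: 'f::field \<Rightarrow> ('a::topological_space set \<Rightarrow>\<^sub>0 'f) \<Rightarrow> _"
    by (rule vector_space_H0_scale)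
  have 1: "H0_scale c (Poly_Mapping.single C a) = Poly_Mapping.single C (c * a)" for C a
    by (rule poly_mapping_eqI) (simp add: lookup_H0_scale lookup_single when_def)
  have "Poly_Mapping.keys (H0_scale c p) \<subseteq> Poly_Mapping.keys p"
    by (auto simp: in_keys_iff lookup_H0_scale)
  then show ?thesis
    by (simp add: H0_incl_superset[of "Poly_Mapping.keys p"] scale_sum_right 1 lookup_H0_scale)
qed

lemma component_of_superset:
  assumes "A \<subseteq> B" "C \<in> components A"
  shows "\<exists>!C'. C' \<in> components B \<and> C \<subseteq> C'"
proof -
  have "C \<noteq> {}" "connected C" "C \<subseteq> B"
    using assms in_components_nonempty in_components_connected in_components_subset by blast+
  then obtain C' where "C' \<in> components B" "C \<subseteq> C'"
    using exists_component_superset[of C B] by blast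
  moreover have "D = D'" if "D \<in> components B" "C \<subseteq> D" "D' \<in> components B" "C \<subseteq> D'" for D D'
    using that \<open>C \<noteq> {}\<close> components_eq[of D B D'] by blast
  ultimately show ?thesis by blast
qed

lemma H0_incl_in:
  fixes B :: "'a::topological_space set" and p :: "_ \<Rightarrow>\<^sub>0 'f::field" 
  assumes "A \<subseteq> B" "p \<in> H0_space A"
  shows "H0_incl B p \<in> H0_space B"
proof -
  interpret vector_space "H0_scale :: 'f::field \<Rightarrow> ('a::topological_space set \<Rightarrow>\<^sub>0 'f) \<Rightarrow> _"
    by (rule vector_space_H0_scale)
  show ?thesis
    unfolding H0_incl_def
  proof (rule subspace_sum[OF subspace_H0_space])
    fix C assume "C \<in> Poly_Mapping.keys p"
    then have "C \<in> components A" using assms by (auto simp: H0_space_def)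
    from theI'[OF component_of_superset[OF assms(1) this]]
    show "Poly_Mapping.single (THE C'. C' \<in> components B \<and> C \<subseteq> C') (Poly_Mapping.lookup p C)
        \<in> H0_space B"
      by (auto simp: H0_space_def)
  qed
qed

lemma sum_singles: "(\<Sum>C\<in>Poly_Mapping.keys p. Poly_Mapping.single C (Poly_Mapping.lookup p C)) = p"
  by (rule poly_mapping_eqI)
     (auto simp: lookup_sum lookup_single when_def in_keys_iff sum.delta cong: if_cong)

lemma keys_sub_single: "Poly_Mapping.keys p \<subseteq> {a} \<Longrightarrow> p \<in> range (Poly_Mapping.single a)"
proof -
  assume "Poly_Mapping.keys p \<subseteq> {a}"
  then have "p = Poly_Mapping.single a (Poly_Mapping.lookup p a)"
    by (intro poly_mapping_eqI) (auto simp: lookup_single when_def in_keys_iff)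
  then show ?thesis by blast
qed

lemma H0_incl_id:
  assumes "p \<in> H0_space A" shows "H0_incl A p = p"
proof -
  have "(THE C'. C' \<in> components A \<and> C \<subseteq> C') = C" if "C \<in> Poly_Mapping.keys p" for C
    using component_of_superset[of A A C] that assms
    by (intro the1_equality) (auto simp: H0_space_def)
  then show ?thesis
    unfolding H0_incl_def by (simp add: sum_singles)
qed

lemma H0_incl_comp:
  assumes "A \<subseteq> B" "B \<subseteq> E" "p \<in> H0_space A"
  shows "H0_incl E (H0_incl B p) = H0_incl E p"
proof -
  have "(THE C'. C' \<in> components E \<and> (THE C'. C' \<in> components B \<and> C \<subseteq> C') \<subseteq> C') =
        (THE C'. C' \<in> components E \<and> C \<subseteq> C')" if "C \<in> Poly_Mapping.keys p" for C
  proof -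
    have C: "C \<in> components A" using that assms by (auto simp: H0_space_def)
    let ?D = "THE C'. C' \<in> components B \<and> C \<subseteq> C'"
    have D: "?D \<in> components B \<and> C \<subseteq> ?D"
      by (rule theI'[OF component_of_superset[OF assms(1) C]])
    let ?G = "THE C'. C' \<in> components E \<and> ?D \<subseteq> C'"
    have "?G \<in> components E \<and> ?D \<subseteq> ?G"
      using theI'[OF component_of_superset[OF assms(2), of ?D]] D by blast
    with D show ?thesis
      using component_of_superset[of A E C] assms C
      by (intro the1_equality[symmetric]) auto
  qed
  then show ?thesis
    by (subst (2) H0_incl_def, simp add: H0_incl_sum H0_incl_single, simp add: H0_incl_def)
qed

lemma persistence_module_PH0: "persistence_module (PH0 M v)"
proof -
  have *: "sublevel M v s \<subseteq> sublevel M v t" if "s \<le> t" for s t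
    using that by (auto simp: sublevel_def)
  show ?thesis
    unfolding persistence_module_def PH0_def linear_betw_def pers_module.simps image_subset_iff
    by (intro conjI allI impI ballI vector_space_H0_scale subspace_H0_space H0_incl_add
        H0_incl_scale H0_incl_id H0_incl_in[OF *] H0_incl_comp[OF * *])
qed

lemma persistence_module_interval:
  assumes "is_interval A"
  shows "persistence_module (interval_module A :: ('f::field,'f) pers_module)"
proof -
  have vs: "vector_space ((*) :: 'f \<Rightarrow> 'f \<Rightarrow> 'f)"
    by unfold_locales (auto simp: algebra_simps)
  then interpret vector_space "(*) :: 'f \<Rightarrow> 'f \<Rightarrow> 'f" .
  show ?thesis
    unfolding persistence_module_def
  proof (intro conjI allI impI ballI)
    fix r s t :: real and x :: 'f
    assume "r \<le> s" "s \<le> t" "x \<in> pm_space (interval_module A) r"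
    then show "pm_map (interval_module A) s t (pm_map (interval_module A) r s x) =
        pm_map (interval_module A) r t x"
      using mem_is_interval_1_I[OF assms, of r t s] by (auto simp: interval_module_def)
  qed (use vs in
      \<open>auto simp: interval_module_def linear_betw_def subspace_def split: if_splits\<close>)
qed

lemma persistence_module_direct_sum:
  fixes V :: "'i \<Rightarrow> ('f::field,'v::ab_group_add) pers_module"
  assumes "\<And>i. persistence_module (V i)"
  shows "persistence_module (direct_sum I V)"
proof -
  have vs: "vector_space (pm_scale (V i))" for i
    using assms by (auto simp: persistence_module_def)
  have sub: "module.subspace (pm_scale (V i)) (pm_space (V i) t)" for i t
    using assms by (auto simp: persistence_module_def)
  have m: "module (pm_scale (V i))" for i using vs by (simp add: module_iff_vector_space)
  let ?s = "pm_scale (direct_sum I V)"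
  have ls: "Poly_Mapping.lookup (?s c p) i = pm_scale (V i) c (Poly_Mapping.lookup p i)" for c p i
    using module.scale_zero_right[OF m]
    by (auto simp: direct_sum_def lookup_mapp when_def in_keys_iff)
  have V: "vector_space ?s"
    by unfold_locales (auto intro!: poly_mapping_eqI simp: ls lookup_add
        vector_space.vector_space_assms[OF vs])
  interpret vector_space ?s by (rule V)
  have z: "0 \<in> pm_space (V i) t" for i t using module.subspace_0[OF m sub] .
  have lin: "linear_betw (pm_scale (V i)) (pm_space (V i) s) (pm_scale (V i)) (pm_space (V i) t) (pm_map (V i) s t)" if "s \<le> t" for i s t
    using assms that by (auto simp: persistence_module_def)
  have m0: "pm_map (V i) s t 0 = 0" if "s \<le> t" for i s t
    using lin[OF that, of i] z[of i s] unfolding linear_betw_def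
    by (metis add_cancel_right_left add_0)
  have lm: "Poly_Mapping.lookup (pm_map (direct_sum I V) s t p) i = pm_map (V i) s t (Poly_Mapping.lookup p i)" if "s \<le> t" for s t p i
    using m0[OF that] by (auto simp: direct_sum_def lookup_mapp when_def in_keys_iff)
  have sp: "p \<in> pm_space (direct_sum I V) t \<longleftrightarrow> Poly_Mapping.keys p \<subseteq> I \<and> (\<forall>i. Poly_Mapping.lookup p i \<in> pm_space (V i) t)" for p t
    using z by (auto simp: direct_sum_def) (metis in_keys_iff subsetD)
  have k: "Poly_Mapping.keys p \<subseteq> I \<longleftrightarrow> (\<forall>i. i \<notin> I \<longrightarrow> Poly_Mapping.lookup p i = 0)" for p :: "'i \<Rightarrow>\<^sub>0 'v"
    by (auto simp: in_keys_iff)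
  have S: "subspace (pm_space (direct_sum I V) t)" for t
    unfolding subspace_def
    using z module.subspace_add[OF m sub] module.subspace_scale[OF m sub] module.scale_zero_right[OF m]
    by (auto simp: sp k ls lookup_add)
  have L: "linear_betw ?s (pm_space (direct_sum I V) s) ?s (pm_space (direct_sum I V) t)
     (pm_map (direct_sum I V) s t)" if "s \<le> t" for s t
    using lin[OF that] unfolding linear_betw_def image_subset_iff
    by (auto simp: sp k lm[OF that] ls m0[OF that] lookup_add intro!: poly_mapping_eqI)
  show ?thesis unfolding persistence_module_def
    using V S L assms
    by (auto intro!: poly_mapping_eqI simp: lm sp persistence_module_def)
qed

end

theory Submission
  imports Defs
begin

text \<open>
  Let \<open>c\<close> be the center of \<open>M\<close>. The sublevel sets in direction \<open>v\<close> are connected as soon as they contain \<open>c\<close>,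
  so a diagram consists of one infinite point \<open>(lowest v, \<infinity>)\<close> and finitely many finite points, each of
  multiplicity one by simplicity. The infinite point depends continuously on \<open>v\<close> and is a section over the whole circle.
  A bar of length \<open>0\<close> gives a section that is \<open>Diagonal\<close> in all other directions. What remains is to join
  the points of positive length to sections, and the only obstruction is that a point which is followed around
  the circle could come back as a different point.

  Diagrams. The number of finite points in a box of the plane is, up to the boundary of the box, a signed
  count of components of four sublevel sets (\<open>box_bounds\<close>). This is the rank formula for bars, and its use
  needs an interval decomposition of the persistence module to exist. It is built by the elder rule
  (\<open>H0_interval_decomposition\<close>); since births need not be attained, the elder rule is applied to coherent
  choices of components over all levels instead of to points. The box count is monotone under interleaving of
  sublevel sets, so nearby directions have nearby diagrams, and a point of positive length has exactly one
  neighbour in each nearby diagram (\<open>unique_near\<close>). This yields the bundle (\<open>pd_bundle_PD0\<close>), and lets a point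
  of positive length be followed continuously until its length tends to \<open>0\<close> (\<open>long_point_path\<close>, \<open>maximal_path_end\<close>).

  Monodromy. Let the direction be \<open>v = -u\<close> and measure points by their depth \<open>(x - c) \<bullet> u\<close>. Two points of
  depth at least \<open>e > 0\<close> on the same ray from \<open>c\<close> are joined by a segment, so the components of
  \<open>{x \<in> M. e \<le> depth x}\<close> lie in disjoint sectors at \<open>c\<close>, and two points are in one component iff every
  ray between them reaches depth \<open>e\<close>. Hence a component that dies by merging merges with a neighbour on one
  side \<open>\<sigma>\<close>, and there is a ray \<open>r\<close> such that up to its death the component stays on the other side of \<open>r\<close>.
  If \<open>u\<close> turns to \<open>u'\<close> towards the side \<open>\<sigma>\<close>, then the identity
  \<open>depth\<^sub>u a * depth\<^sub>u' p - depth\<^sub>u p * depth\<^sub>u' a = area (a - c) (p - c) * area u u'\<close>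
  says that points further on the side \<open>\<sigma>\<close> gain depth relative to the others. The merge on the side \<open>\<sigma>\<close>
  therefore cannot be overtaken by a merge on the other side, and the ray \<open>r\<close> keeps separating
  (\<open>sided_forward\<close>, \<open>sided_closed\<close>). But when \<open>u\<close> has become orthogonal to \<open>r\<close>, which happens before a half turn
  is completed, no point of positive depth is left on the far side of \<open>r\<close> (\<open>sided_end\<close>). So a point cannot be
  followed from any direction through a half turn towards its merging side (\<open>no_half_turn\<close>). A path longer
  than a full turn would contain half turns to both sides of its midpoint, so every path is at most one full
  turn long (\<open>path_length_le\<close>), its values at different angles belong to different directions, and it descends to
  a section of the circle. Maximal paths through the same point agree up to full turns, so every point of positive
  length lies on exactly one of these sections (\<open>canonical_section_through\<close>).
\<close>

section \<open>Components born in one range of levels and merged in another\<close>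

definition comps_meeting :: "'a::topological_space set \<Rightarrow> 'a set \<Rightarrow> 'a set set" where
  "comps_meeting B C = {K \<in> components C. K \<inter> B \<noteq> {}}"

definition fresh_comps :: "'a::topological_space set \<Rightarrow> 'a set \<Rightarrow> 'a set \<Rightarrow> 'a set set" where
  "fresh_comps A B C = {K \<in> components C. K \<inter> B \<noteq> {} \<and> K \<inter> A = {}}"

text \<open>
  For sublevel sets \<open>A \<subseteq> B \<subseteq> C \<subseteq> D\<close> of a filtration, \<open>card (comps_meeting B C)\<close> is the rank of the map from the
  homology of \<open>B\<close> to that of \<open>C\<close>, and the alternating sum counts the bars that start between \<open>A\<close> and \<open>B\<close> and end
  between \<open>C\<close> and \<open>D\<close>.
\<close>

definition box_count :: "'a::topological_space set \<Rightarrow> 'a set \<Rightarrow> 'a set \<Rightarrow> 'a set \<Rightarrow> int" where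
  "box_count A B C D =
     int (card (comps_meeting B C)) - card (comps_meeting A C)
     - card (comps_meeting B D) + card (comps_meeting A D)"

lemma fresh_comps_card:
  assumes "A \<subseteq> B" "finite (components C)"
  shows "int (card (fresh_comps A B C)) = int (card (comps_meeting B C)) - card (comps_meeting A C)"
proof -
  have "fresh_comps A B C = comps_meeting B C - comps_meeting A C"
    by (auto simp: fresh_comps_def comps_meeting_def)
  moreover have "comps_meeting A C \<subseteq> comps_meeting B C"
    using assms by (auto simp: comps_meeting_def)
  moreover have "finite (comps_meeting B C)"
    using assms by (auto simp: comps_meeting_def)
  ultimately show ?thesis
    by (simp add: card_Diff_subset card_mono finite_subset of_nat_diff)
qed

lemma box_count_fresh:
  assumes "A \<subseteq> B" "finite (components C)" "finite (components D)"
  shows "box_count A B C D = int (card (fresh_comps A B C)) - card (fresh_comps A B D)"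
  using fresh_comps_card[OF assms(1,2)] fresh_comps_card[OF assms(1,3)]
  by (simp add: box_count_def)

abbreviation conn :: "'a::topological_space set \<Rightarrow> 'a \<Rightarrow> 'a \<Rightarrow> bool" where
  "conn \<equiv> connected_component"

lemma comp_set_in_components: "x \<in> C \<Longrightarrow> connected_component_set C x \<in> components C"
  by (auto simp: components_def)

lemma fresh_comps_iff:
  "K \<in> fresh_comps A B C \<longleftrightarrow>
     (\<exists>y\<in>B \<inter> C. K = connected_component_set C y \<and> (\<forall>x. conn C y x \<longrightarrow> x \<notin> A))"
proof
  assume "K \<in> fresh_comps A B C"
  then obtain y where "y \<in> K" "y \<in> B" "K \<in> components C" "K \<inter> A = {}"
    by (auto simp: fresh_comps_def)
  moreover from this have "K = connected_component_set C y" "y \<in> C"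
    using components_iff connected_component_eq in_components_subset by (metis, blast)
  ultimately show "\<exists>y\<in>B \<inter> C. K = connected_component_set C y \<and> (\<forall>x. conn C y x \<longrightarrow> x \<notin> A)"
    by auto
next
  assume "\<exists>y\<in>B \<inter> C. K = connected_component_set C y \<and> (\<forall>x. conn C y x \<longrightarrow> x \<notin> A)"
  then show "K \<in> fresh_comps A B C"
    by (fastforce simp: fresh_comps_def components_def)
qed

text \<open>
  A component of the larger space that avoids \<open>A\<close> contains a component of the smaller one that does: fresh
  components can only disappear when the space grows.
\<close>

lemma fresh_comps_subset_image:
  assumes "B \<subseteq> C" "C \<subseteq> D"
  shows "fresh_comps A B D \<subseteq>
    (\<lambda>K. connected_component_set D (SOME y. y \<in> K)) ` fresh_comps A B C"
proof
  fix L assume "L \<in> fresh_comps A B D"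
  then obtain y where y: "y \<in> B" "y \<in> D" "L = connected_component_set D y"
      "\<forall>x. conn D y x \<longrightarrow> x \<notin> A"
    by (auto simp: fresh_comps_iff)
  let ?K = "connected_component_set C y"
  have yC: "y \<in> C" using y assms by auto
  have "(SOME y. y \<in> ?K) \<in> ?K"
    by (rule someI[of _ y]) (simp add: yC)
  then have "conn D y (SOME y. y \<in> ?K)"
    using assms connected_component_of_subset by fastforce
  then have "L = connected_component_set D (SOME y. y \<in> ?K)"
    using y(3) connected_component_eq by fastforce
  moreover have "?K \<in> fresh_comps A B C"
    unfolding fresh_comps_iff using y yC assms connected_component_of_subset by blast
  ultimately show "L \<in> (\<lambda>K. connected_component_set D (SOME y. y \<in> K)) ` fresh_comps A B C"
    by blast
qed

lemma box_count_nonneg: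
  assumes "A \<subseteq> B" "B \<subseteq> C" "C \<subseteq> D" "finite (components C)" "finite (components D)"
  shows "0 \<le> box_count A B C D"
proof -
  have "finite (fresh_comps A B C)" using assms by (auto simp: fresh_comps_def)
  then show ?thesis
    using surj_card_le[OF _ fresh_comps_subset_image[OF assms(2,3), of A]] assms
    by (simp add: box_count_fresh)
qed

text \<open>
  The difference of the two counts is the sum of the counts of four boxes that surround the smaller box.
\<close>

lemma box_count_mono:
  assumes "A' \<subseteq> A" "A \<subseteq> B" "B \<subseteq> B'" "B' \<subseteq> C'" "C' \<subseteq> C" "C \<subseteq> D" "D \<subseteq> D'"
    and "finite (components C)" "finite (components D)"
    and "finite (components C')" "finite (components D')"
  shows "box_count A B C D \<le> box_count A' B' C' D'"
proof -
  have "0 \<le> box_count A' A C D" "0 \<le> box_count B B' C D" "0 \<le> box_count A' B' C' C"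
       "0 \<le> box_count A' B' D D'"
    using assms by (blast intro: box_count_nonneg)+
  then show ?thesis by (simp add: box_count_def)
qed

text \<open>
  A geometric witness for a positive box count: the component of \<open>y\<close> is new since \<open>A\<close>, and at \<open>D\<close> it is joined
  with that of another point \<open>z\<close> of \<open>B\<close>.
\<close>

definition merging_pair :: "'a::topological_space set \<Rightarrow> 'a set \<Rightarrow> 'a set \<Rightarrow> 'a set \<Rightarrow> 'a \<Rightarrow> 'a \<Rightarrow> bool" where
  "merging_pair A B C D y z \<longleftrightarrow>
     y \<in> B \<and> z \<in> B \<and> conn D y z \<and> \<not> conn C y z \<and> (\<forall>x. conn C y x \<longrightarrow> x \<notin> A)"

text \<open>
  Every component of \<open>D\<close> avoiding \<open>A\<close> still comes from a fresh component of \<open>C\<close> if that of \<open>y\<close> is omitted, because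
  the component of \<open>z\<close> can take its place.
\<close>

lemma merging_pair_imp_box_count:
  assumes m: "merging_pair A B C D y z"
    and sub: "A \<subseteq> B" "B \<subseteq> C" "C \<subseteq> D" and fin: "finite (components C)" "finite (components D)"
  shows "1 \<le> box_count A B C D"
proof -
  let ?g = "\<lambda>K. connected_component_set D (SOME y. y \<in> K)"
  let ?Y = "connected_component_set C y"
  have m': "y \<in> B" "z \<in> B" "conn D y z" "\<not> conn C y z" "\<And>x. conn C y x \<Longrightarrow> x \<notin> A"
    using m by (auto simp: merging_pair_def)
  have Y: "?Y \<in> fresh_comps A B C"
    unfolding fresh_comps_iff using m' sub by blast
  have gw: "?g (connected_component_set C w) = connected_component_set D w" if "w \<in> C" for w
  proof -
    have "(SOME y. y \<in> connected_component_set C w) \<in> connected_component_set C w"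
      by (rule someI[of _ w]) (simp add: that)
    then have "conn D w (SOME y. y \<in> connected_component_set C w)"
      using sub connected_component_of_subset by fastforce
    then show ?thesis by (metis connected_component_eq mem_Collect_eq)
  qed
  have "fresh_comps A B D \<subseteq> ?g ` (fresh_comps A B C - {?Y})"
  proof
    fix L assume L: "L \<in> fresh_comps A B D"
    then obtain K where K: "K \<in> fresh_comps A B C" "L = ?g K"
      using fresh_comps_subset_image[OF sub(2,3), of A] by auto
    show "L \<in> ?g ` (fresh_comps A B C - {?Y})"
    proof (cases "K = ?Y")
      case False with K show ?thesis by blast
    next
      case True
      have "L = connected_component_set D y" using K True gw[of y] m' sub by auto
      then have Lz: "L = connected_component_set D z"
        using m'(3) connected_component_eq by fastforce
      have LA: "L \<inter> A = {}" using L by (auto simp: fresh_comps_def)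
      let ?Z = "connected_component_set C z"
      have "?Z \<in> fresh_comps A B C"
        unfolding fresh_comps_iff
        using LA Lz m' sub connected_component_of_subset[of C z _ D] by blast
      moreover have "?Z \<noteq> ?Y"
        using m' sub by (metis connected_component_refl mem_Collect_eq subsetD)
      moreover have "L = ?g ?Z" using gw[of z] Lz m' sub by auto
      ultimately show ?thesis by blast
    qed
  qed
  moreover have "finite (fresh_comps A B C)" using fin by (auto simp: fresh_comps_def)
  ultimately have "card (fresh_comps A B D) \<le> card (fresh_comps A B C - {?Y})"
    by (metis surj_card_le finite_Diff)
  also have "\<dots> < card (fresh_comps A B C)"
    using Y \<open>finite (fresh_comps A B C)\<close> by (metis card_Diff1_less)
  finally show ?thesis using sub fin by (simp add: box_count_fresh)
qed

text \<open>
  Without such a pair, fresh components of \<open>C\<close> would stay fresh and distinct in \<open>D\<close>, and the count would be \<open>0\<close>.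
\<close>

lemma box_count_imp_merging_pair:
  assumes b: "1 \<le> box_count A B C D"
    and sub: "A \<subseteq> B" "B \<subseteq> C" "C \<subseteq> D" and fin: "finite (components C)" "finite (components D)"
  shows "\<exists>y z. merging_pair A B C D y z"
proof (rule ccontr)
  assume no: "\<nexists>y z. merging_pair A B C D y z"
  define f where "f = (\<lambda>K. connected_component_set D (SOME y. y \<in> K \<inter> B))"
  have rep: "\<exists>y\<in>B \<inter> C. y = (SOME y. y \<in> K \<inter> B) \<and> K = connected_component_set C y \<and>
      f K = connected_component_set D y \<and> (\<forall>x. conn C y x \<longrightarrow> x \<notin> A)"
    if K: "K \<in> fresh_comps A B C" for K
  proof -
    have "K \<inter> B \<noteq> {}" using K by (auto simp: fresh_comps_def)
    then have s: "(SOME y. y \<in> K \<inter> B) \<in> K \<inter> B" by (metis some_in_eq)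
    have "K \<in> components C" using K by (auto simp: fresh_comps_def)
    then have "K = connected_component_set C (SOME y. y \<in> K \<inter> B)"
      using s by (metis Int_iff components_iff connected_component_eq)
    then show ?thesis using K s sub unfolding f_def fresh_comps_def by auto
  qed
  have "f ` fresh_comps A B C \<subseteq> fresh_comps A B D"
  proof
    fix L assume "L \<in> f ` fresh_comps A B C"
    then obtain K y where *: "y \<in> B \<inter> C" "K = connected_component_set C y"
      "L = connected_component_set D y" "\<forall>x. conn C y x \<longrightarrow> x \<notin> A"
      using rep by blast
    have "z \<notin> A" if "conn D y z" for z
    proof
      assume "z \<in> A"
      then have "merging_pair A B C D y z"
        using * that sub unfolding merging_pair_def by auto
      then show False using no by blast
    qed
    then show "L \<in> fresh_comps A B D" unfolding fresh_comps_iff using * sub by blast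
  qed
  moreover have "inj_on f (fresh_comps A B C)"
  proof
    fix K K' assume KK: "K \<in> fresh_comps A B C" "K' \<in> fresh_comps A B C" "f K = f K'"
    obtain y where y: "y \<in> B \<inter> C" "K = connected_component_set C y"
      "f K = connected_component_set D y" "\<forall>x. conn C y x \<longrightarrow> x \<notin> A" using rep[OF KK(1)] by blast
    obtain z where z: "z \<in> B \<inter> C" "K' = connected_component_set C z"
      "f K' = connected_component_set D z" using rep[OF KK(2)] by blast
    have "conn D y z" using y z KK(3) sub
      by (metis Int_iff connected_component_refl mem_Collect_eq subsetD)
    then have "conn C y z" using no y z unfolding merging_pair_def by blast
    then show "K = K'" using y z connected_component_eq by fastforce
  qed
  moreover have "finite (fresh_comps A B D)" using fin by (auto simp: fresh_comps_def)
  ultimately have "card (fresh_comps A B C) \<le> card (fresh_comps A B D)"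
    by (metis card_inj_on_le)
  then show False using b sub fin by (simp add: box_count_fresh)
qed

section \<open>The elder rule without minimal levels\<close>

lemma components_eqI:
  "C \<in> components S \<Longrightarrow> D \<in> components S \<Longrightarrow> x \<in> C \<Longrightarrow> x \<in> D \<Longrightarrow> C = D"
  using components_eq by blast

lemma coinitial_sequence:
  fixes G :: "real set"
  assumes "G \<noteq> {}" "bdd_below G"
  shows "\<exists>a :: nat \<Rightarrow> real. (\<forall>n. a n \<in> G) \<and> (\<forall>n. a (Suc n) \<le> a n) \<and> (\<forall>g\<in>G. \<exists>n. a n \<le> g)"
proof (cases "Inf G \<in> G")
  case True
  then show ?thesis using assms by (intro exI[of _ "\<lambda>n. Inf G"]) (auto intro: cInf_lower)
next
  case False
  have "\<exists>g\<in>G. g < Inf G + 1 / real (Suc n)" for n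
    using assms by (intro cInf_lessD) auto
  then obtain g where g: "\<And>n. g n \<in> G" "\<And>n. g n < Inf G + 1 / real (Suc n)" by metis
  define a where "a n = Min (g ` {..n})" for n
  have "a n \<in> g ` {..n}" for n unfolding a_def by (rule Min_in) auto
  then have "a n \<in> G" for n using g(1) by (metis imageE)
  moreover have "a (Suc n) \<le> a n" for n unfolding a_def by (rule Min_antimono) auto
  moreover have "\<exists>n. a n \<le> h" if h: "h \<in> G" for h
  proof -
    have "Inf G < h" using h False assms by (metis cInf_lower order_le_less)
    then obtain n where "1 / real (Suc n) < h - Inf G"
      using nat_approx_posE[of "h - Inf G"] by auto
    moreover have "a n \<le> g n" unfolding a_def by (rule Min_le) auto
    ultimately show ?thesis using g(2)[of n] by (intro exI[of _ n]) linarith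
  qed
  ultimately show ?thesis by blast
qed

text \<open>
  A component need not have a first level: the intersection of a decreasing family of components can be empty.
  The lower bound \<open>m0\<close> keeps the births finite.
\<close>

locale finite_filtration =
  fixes X :: "real \<Rightarrow> 'a::topological_space set" and m0 :: real
  assumes mono: "s \<le> t \<Longrightarrow> X s \<subseteq> X t"
    and finite_comps: "finite (components (X t))"
    and empty_below: "t < m0 \<Longrightarrow> X t = {}"
begin

text \<open>
  A coherent choice of one component at every level above some threshold. Tracks replace the points at which
  components are born in the usual form of the elder rule.
\<close>

definition track :: "(real \<Rightarrow> 'a set) \<Rightarrow> bool" where
  "track \<omega> \<longleftrightarrow> (\<forall>s t. s \<le> t \<longrightarrow> \<omega> s \<subseteq> \<omega> t) \<and> (\<forall>t. \<omega> t = {} \<or> \<omega> t \<in> components (X t))"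

lemma trackD:
  assumes "track \<omega>"
  shows "s \<le> t \<Longrightarrow> \<omega> s \<subseteq> \<omega> t" "\<omega> t \<noteq> {} \<Longrightarrow> \<omega> t \<in> components (X t)"
  using assms by (auto simp: track_def)

lemma inside_component:
  assumes "C \<in> components (X s)" "D \<in> components (X t)" "s \<le> t" "x \<in> C" "x \<in> D"
  shows "C \<subseteq> D"
proof -
  obtain E where E: "E \<in> components (X t)" "C \<subseteq> E"
    using component_of_superset[OF mono[OF assms(3)] assms(1)] by blast
  then have "E = D" using components_eqI[OF E(1) assms(2), of x] assms by blast
  with E show ?thesis by simp
qed

lemma track_eqI: "track \<omega> \<Longrightarrow> track \<kappa> \<Longrightarrow> C \<noteq> {} \<Longrightarrow> C \<subseteq> \<omega> t \<Longrightarrow> C \<subseteq> \<kappa> t \<Longrightarrow> \<omega> t = \<kappa> t"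
  using trackD(2)[of \<omega> t] trackD(2)[of \<kappa> t] components_eqI[of "\<omega> t" "X t" "\<kappa> t"] by blast

text \<open>
  Otherwise each of the finitely many components \<open>D\<close> inside \<open>C\<close> at level \<open>s\<close> misses \<open>X r\<close> for some level \<open>r\<close> at
  which \<open>C\<close> is already present, and the smallest of these levels contradicts the presence of \<open>C\<close> there.
\<close>

lemma full_age_subcomponent:
  assumes C: "C \<in> components (X t)" and s: "s \<le> t" "C \<inter> X s \<noteq> {}"
  shows "\<exists>D\<in>components (X s). D \<subseteq> C \<and> (\<forall>r\<le>s. C \<inter> X r \<noteq> {} \<longrightarrow> D \<inter> X r \<noteq> {})"
proof (rule ccontr)
  assume neg: "\<not> ?thesis"
  define \<D> where "\<D> = {D \<in> components (X s). D \<subseteq> C}"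
  have fin: "finite \<D>" using finite_comps by (auto simp: \<D>_def)
  have in_D: "\<exists>D\<in>\<D>. x \<in> D" if x: "x \<in> C" "x \<in> X s" for x
  proof -
    have "connected_component_set (X s) x \<in> components (X s)"
      using x by (intro comp_set_in_components)
    moreover have "connected_component_set (X s) x \<subseteq> C"
      by (rule inside_component[OF calculation C s(1), of x]) (use x in auto)
    ultimately show ?thesis using x by (auto simp: \<D>_def intro!: bexI)
  qed
  have "\<forall>D\<in>\<D>. \<exists>r\<le>s. C \<inter> X r \<noteq> {} \<and> D \<inter> X r = {}"
    using neg by (auto simp: \<D>_def)
  then obtain r where r: "\<And>D. D \<in> \<D> \<Longrightarrow> r D \<le> s \<and> C \<inter> X (r D) \<noteq> {} \<and> D \<inter> X (r D) = {}"
    by metis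
  have ne: "\<D> \<noteq> {}" using s in_D by blast
  define q where "q = Min (r ` \<D>)"
  have "q \<in> r ` \<D>" using fin ne unfolding q_def by (intro Min_in) auto
  then obtain x where x: "x \<in> C" "x \<in> X q" "q \<le> s" using r by blast
  then obtain D where D: "D \<in> \<D>" "x \<in> D" using in_D[of x] mono[of q s] by blast
  have "q \<le> r D" using fin D unfolding q_def by (intro Min_le) auto
  then have "x \<in> X (r D)" using x mono by blast
  with D r show False by blast
qed

text \<open>
  The tracks through \<open>C\<close> that reach as far down as \<open>C\<close> itself does.
\<close>

definition full_tracks :: "real \<Rightarrow> 'a set \<Rightarrow> (real \<Rightarrow> 'a set) set" where
  "full_tracks t C = {\<omega>. track \<omega> \<and> \<omega> t = C \<and> (\<forall>s\<le>t. C \<inter> X s \<noteq> {} \<longrightarrow> \<omega> s \<noteq> {})}"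

text \<open>
  Along a sequence of levels that decreases to the birth of \<open>C\<close>, components of full age are chosen inside one
  another; the track consists of the components that contain them.
\<close>

lemma full_tracks_nonempty:
  assumes C: "C \<in> components (X t)"
  shows "full_tracks t C \<noteq> {}"
proof -
  define G where "G = {s. s \<le> t \<and> C \<inter> X s \<noteq> {}}"
  have "t \<in> G" using C in_components_nonempty in_components_subset by (fastforce simp: G_def)
  moreover have "bdd_below G"
    by (rule bdd_belowI[of _ m0]) (use empty_below in \<open>force simp: G_def not_le\<close>)
  ultimately obtain a :: "nat \<Rightarrow> real" where
    a: "\<And>n. a n \<in> G" "\<And>n. a (Suc n) \<le> a n" "\<And>g. g \<in> G \<Longrightarrow> \<exists>n. a n \<le> g"
    using coinitial_sequence[of G] by blast
  have at: "a n \<le> t" for n using a(1)[of n] by (simp add: G_def)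
  define P where "P n D \<longleftrightarrow> D \<in> components (X (a n)) \<and> D \<subseteq> C \<and>
      (\<forall>r\<le>a n. C \<inter> X r \<noteq> {} \<longrightarrow> D \<inter> X r \<noteq> {})" for n D
  have "\<exists>D. \<forall>n. P n (D n) \<and> D (Suc n) \<subseteq> D n"
  proof (rule dependent_nat_choice)
    show "\<exists>D. P 0 D" unfolding P_def
      using full_age_subcomponent[OF C, of "a 0"] a(1)[of 0] by (auto simp: G_def)
  next
    fix D n assume D: "P n D"
    have "D \<inter> X (a (Suc n)) \<noteq> {}" using D a(1)[of "Suc n"] a(2)[of n] by (auto simp: P_def G_def)
    with D a(2) obtain E where "E \<in> components (X (a (Suc n)))" "E \<subseteq> D"
        "\<forall>r\<le>a (Suc n). D \<inter> X r \<noteq> {} \<longrightarrow> E \<inter> X r \<noteq> {}"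
      using full_age_subcomponent[of D "a n" "a (Suc n)"] by (auto simp: P_def)
    moreover have "\<forall>r\<le>a (Suc n). C \<inter> X r \<noteq> {} \<longrightarrow> E \<inter> X r \<noteq> {}"
      using calculation(3) D a(2)[of n] unfolding P_def by (meson order_trans)
    ultimately show "\<exists>E. P (Suc n) E \<and> E \<subseteq> D" using D unfolding P_def by blast
  qed
  then obtain D where D: "\<And>n. P n (D n)" "\<And>n. D (Suc n) \<subseteq> D n" by blast
  have D_anti: "D n \<subseteq> D k" if "k \<le> n" for k n
    using that by (induction rule: dec_induct) (use D(2) in auto)
  have Dn: "D n \<in> components (X (a n))" "D n \<subseteq> C" for n using D(1) by (auto simp: P_def)
  define \<omega> where "\<omega> s = {x. \<exists>n. a n \<le> s \<and> (\<exists>y\<in>D n. conn (X s) y x)}" for s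
  have conn_D: "conn (X s) y z" if "a n \<le> s" "y \<in> D n" "z \<in> D n" for n s y z
    using that Dn(1)[of n] mono[of "a n" s]
    by (meson connected_component_def in_components_connected in_components_subset order_trans)
  have \<omega>_eq: "\<omega> s = connected_component_set (X s) y" if n: "a n \<le> s" "y \<in> D n" for s n y
  proof -
    have "conn (X s) y x" if k: "a k \<le> s" "z \<in> D k" "conn (X s) z x" for k z x
    proof -
      have "conn (X s) y z"
      proof (cases "k \<le> n")
        case True then show ?thesis using conn_D[of k s y z] D_anti[of k n] n k by blast
      next
        case False then show ?thesis using conn_D[of n s y z] D_anti[of n k] n k by auto
      qed
      then show ?thesis using k connected_component_trans by metis
    qed
    then show ?thesis using n by (auto simp: \<omega>_def)
  qed
  have yD: "\<exists>y. y \<in> D n" for n using Dn(1) in_components_nonempty by blast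
  have D_X: "y \<in> X s" if "a n \<le> s" "y \<in> D n" for n s y
    using that Dn(1)[of n] in_components_subset mono by blast
  have "track \<omega>" unfolding track_def
  proof (intro conjI allI impI)
    fix s t :: real assume "s \<le> t"
    then show "\<omega> s \<subseteq> \<omega> t"
      unfolding \<omega>_def
      by (auto intro: connected_component_of_subset[OF _ mono[of s t]] order_trans)
  next
    fix s
    show "\<omega> s = {} \<or> \<omega> s \<in> components (X s)"
    proof (cases "\<exists>n. a n \<le> s")
      case True
      then obtain n y where "a n \<le> s" "y \<in> D n" using yD by blast
      then show ?thesis using \<omega>_eq comp_set_in_components[of y "X s"] D_X by auto
    next
      case False then show ?thesis by (auto simp: \<omega>_def)
    qed
  qed
  moreover have "\<omega> t = C"
  proof -
    obtain y where y: "y \<in> D 0" using yD by blast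
    then have "\<omega> t = connected_component_set (X t) y" using \<omega>_eq[OF at y] by simp
    also have "\<dots> = C" using C y Dn(2) by (metis components_iff connected_component_eq subsetD)
    finally show ?thesis .
  qed
  moreover have "\<omega> s \<noteq> {}" if sC: "s \<le> t" "C \<inter> X s \<noteq> {}" for s
  proof -
    obtain n where "a n \<le> s" using a(3)[of s] sC unfolding G_def by blast
    moreover obtain y where "y \<in> D n" using yD by blast
    ultimately show ?thesis using \<omega>_eq[of n s y] D_X[of n s y]
      by (metis connected_component_refl empty_iff mem_Collect_eq)
  qed
  ultimately show ?thesis unfolding full_tracks_def by blast
qed

text \<open>
  A well-order of all tracks breaks the ties between components of the same age.
\<close>

definition seniority :: "((real \<Rightarrow> 'a set) \<times> (real \<Rightarrow> 'a set)) set" where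
  "seniority = (SOME r. well_order_on UNIV r)"

lemma seniority: "well_order_on UNIV seniority"
  unfolding seniority_def by (rule someI_ex) (rule well_order_on)

lemma seniority_antisym: "(\<omega>, \<kappa>) \<in> seniority \<Longrightarrow> (\<kappa>, \<omega>) \<in> seniority \<Longrightarrow> \<omega> = \<kappa>"
  and seniority_trans: "(\<omega>, \<kappa>) \<in> seniority \<Longrightarrow> (\<kappa>, \<pi>) \<in> seniority \<Longrightarrow> (\<omega>, \<pi>) \<in> seniority"
proof -
  have "antisym seniority" "trans seniority"
    using seniority
    by (auto simp: well_order_on_def linear_order_on_def partial_order_on_def preorder_on_def)
  then show "(\<omega>, \<kappa>) \<in> seniority \<Longrightarrow> (\<kappa>, \<omega>) \<in> seniority \<Longrightarrow> \<omega> = \<kappa>"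
    "(\<omega>, \<kappa>) \<in> seniority \<Longrightarrow> (\<kappa>, \<pi>) \<in> seniority \<Longrightarrow> (\<omega>, \<pi>) \<in> seniority"
    by (auto dest: antisymD transD)
qed

lemma seniority_least:
  assumes "S \<noteq> {}" shows "\<exists>\<omega>\<in>S. \<forall>\<kappa>\<in>S. (\<omega>, \<kappa>) \<in> seniority"
proof -
  have "wf (seniority - Id)" using seniority by (simp add: well_order_on_def)
  then obtain \<omega> where \<omega>: "\<omega> \<in> S" "\<And>\<kappa>. (\<kappa>, \<omega>) \<in> seniority - Id \<Longrightarrow> \<kappa> \<notin> S"
    using assms wfE_min by (metis ex_in_conv)
  moreover have "total_on UNIV seniority" "refl_on UNIV seniority"
    using seniority
    by (auto simp: well_order_on_def linear_order_on_def partial_order_on_def preorder_on_def)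
  ultimately show ?thesis by (metis DiffI UNIV_I pair_in_Id_conv refl_onD total_on_def)
qed

text \<open>
  The most senior among the oldest tracks through \<open>C\<close>; it survives when components merge into \<open>C\<close>.
\<close>

definition leader :: "real \<Rightarrow> 'a set \<Rightarrow> real \<Rightarrow> 'a set" where
  "leader t C = (SOME \<omega>. \<omega> \<in> full_tracks t C \<and> (\<forall>\<kappa>\<in>full_tracks t C. (\<omega>, \<kappa>) \<in> seniority))"

lemma leader:
  assumes "C \<in> components (X t)"
  shows "leader t C \<in> full_tracks t C" "\<kappa> \<in> full_tracks t C \<Longrightarrow> (leader t C, \<kappa>) \<in> seniority"
proof -
  have "\<exists>\<omega>. \<omega> \<in> full_tracks t C \<and> (\<forall>\<kappa>\<in>full_tracks t C. (\<omega>, \<kappa>) \<in> seniority)"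
    using seniority_least[OF full_tracks_nonempty[OF assms]] by blast
  from someI_ex[OF this]
  show "leader t C \<in> full_tracks t C" "\<kappa> \<in> full_tracks t C \<Longrightarrow> (leader t C, \<kappa>) \<in> seniority"
    unfolding leader_def by auto
qed

lemma leader_at: "C \<in> components (X t) \<Longrightarrow> leader t C t = C"
  and leader_track: "C \<in> components (X t) \<Longrightarrow> track (leader t C)"
  using leader(1) by (auto simp: full_tracks_def)

text \<open>
  A leader that passes through \<open>C\<close> on its way to \<open>D\<close> leads \<open>C\<close> as well: since it is as old as \<open>D\<close>, every full
  track through \<open>C\<close> is a full track through \<open>D\<close>.
\<close>

lemma leader_inherited:
  assumes C: "C \<in> components (X s)" and D: "D \<in> components (X t)" and st: "s \<le> t"
    and sub: "C \<subseteq> D" and lead: "leader t D s = C"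
  shows "leader s C = leader t D"
proof -
  let ?\<omega> = "leader t D"
  have \<omega>: "track ?\<omega>" "?\<omega> t = D" "\<And>r. r \<le> t \<Longrightarrow> D \<inter> X r \<noteq> {} \<Longrightarrow> ?\<omega> r \<noteq> {}"
    using leader(1)[OF D] by (auto simp: full_tracks_def)
  have "?\<omega> r \<noteq> {}" if "r \<le> s" "C \<inter> X r \<noteq> {}" for r
    using \<omega>(3)[of r] that sub st by (meson disjoint_iff order_trans subsetD)
  then have mem: "?\<omega> \<in> full_tracks s C"
    using \<omega>(1) lead by (simp add: full_tracks_def)
  have up: "full_tracks s C \<subseteq> full_tracks t D"
  proof
    fix \<kappa> assume "\<kappa> \<in> full_tracks s C"
    then have \<kappa>: "track \<kappa>" "\<kappa> s = C" "\<And>r. r \<le> s \<Longrightarrow> C \<inter> X r \<noteq> {} \<Longrightarrow> \<kappa> r \<noteq> {}"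
      by (auto simp: full_tracks_def)
    have Cne: "C \<noteq> {}" using C in_components_nonempty by blast
    have "\<kappa> t \<in> components (X t)" "C \<subseteq> \<kappa> t" using trackD[OF \<kappa>(1)] \<kappa>(2) st Cne by blast+
    then have "\<kappa> t = D" using D sub Cne components_eqI[of "\<kappa> t" "X t" D] by blast
    moreover have "\<kappa> r \<noteq> {}" if r: "r \<le> t" "D \<inter> X r \<noteq> {}" for r
    proof (cases "s \<le> r")
      case True then show ?thesis using trackD(1)[OF \<kappa>(1) True] \<kappa>(2) Cne by blast
    next
      case False
      then have "?\<omega> r \<noteq> {}" "?\<omega> r \<subseteq> C" "?\<omega> r \<subseteq> X r"
        using \<omega>(3)[OF r] trackD(1)[OF \<omega>(1), of r s] lead trackD(2)[OF \<omega>(1), of r]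
          in_components_subset by auto
      then show ?thesis using \<kappa>(3)[of r] False by auto
    qed
    ultimately show "\<kappa> \<in> full_tracks t D" using \<kappa> by (auto simp: full_tracks_def)
  qed
  show ?thesis
    using seniority_antisym leader(2)[OF C mem] leader(2)[OF D] up leader(1)[OF C] by blast
qed

text \<open>
  The levels at which a track leads its component. These sets are the bars of the filtration.
\<close>

definition alive :: "(real \<Rightarrow> 'a set) \<Rightarrow> real set" where
  "alive \<omega> = {t. track \<omega> \<and> \<omega> t \<noteq> {} \<and> leader t (\<omega> t) = \<omega>}"

text \<open>
  The levels at which a track runs through a component that is led by another track.
\<close>

definition buried :: "(real \<Rightarrow> 'a set) \<Rightarrow> real set" where
  "buried \<omega> = {t. \<omega> t \<noteq> {} \<and> leader t (\<omega> t) \<noteq> \<omega>}"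

definition born :: "(real \<Rightarrow> 'a set) \<Rightarrow> real set" where
  "born \<omega> = {t. \<omega> t \<noteq> {}}"

lemma aliveD:
  assumes "t \<in> alive \<omega>" shows "track \<omega>" "\<omega> t \<in> components (X t)" "leader t (\<omega> t) = \<omega>"
  using assms trackD by (auto simp: alive_def)

lemma alive_down:
  assumes "track \<omega>" "s \<le> t" "\<omega> s \<noteq> {}" "t \<in> alive \<omega>"
  shows "s \<in> alive \<omega>"
  using leader_inherited[of "\<omega> s" s "\<omega> t" t] aliveD[OF assms(4)] assms trackD[OF assms(1)]
  by (auto simp: alive_def)

lemma is_interval_alive: "is_interval (alive \<omega>)"
  unfolding is_interval_1
proof (intro ballI allI impI)
  fix a b x assume ab: "a \<in> alive \<omega>" "b \<in> alive \<omega>" "a \<le> x \<and> x \<le> b"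
  then have "\<omega> a \<subseteq> \<omega> x" "\<omega> a \<noteq> {}" using aliveD(1)[OF ab(1)] trackD by (auto simp: alive_def)
  then show "x \<in> alive \<omega>" using alive_down[of \<omega> x b] ab aliveD by blast
qed

lemma alive_before_buried:
  assumes "s \<in> alive \<omega>" "t \<in> buried \<omega>" shows "s < t"
proof (rule ccontr)
  assume "\<not> s < t"
  then have "t \<in> alive \<omega>"
    using alive_down[of \<omega> t s] assms aliveD(1)[OF assms(1)] by (auto simp: buried_def)
  then show False using assms(2) by (auto simp: alive_def buried_def)
qed

lemma leader_alive: "C \<in> components (X t) \<Longrightarrow> t \<in> alive (leader t C)"
  using leader_at[of C t] leader_track[of C t] in_components_nonempty[of C "X t"]
  by (simp add: alive_def)

lemma alive_inj: "t \<in> alive \<omega> \<Longrightarrow> t \<in> alive \<kappa> \<Longrightarrow> \<omega> t = \<kappa> t \<Longrightarrow> \<omega> = \<kappa>"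
  using aliveD(3) by metis

lemma finite_alive: "finite {\<omega>. t \<in> alive \<omega>}"
proof (rule inj_on_finite)
  show "inj_on (\<lambda>\<omega>. \<omega> t) {\<omega>. t \<in> alive \<omega>}" using alive_inj by (auto intro!: inj_onI)
  show "(\<lambda>\<omega>. \<omega> t) ` {\<omega>. t \<in> alive \<omega>} \<subseteq> components (X t)" using aliveD by auto
qed (rule finite_comps)

text \<open>
  Presence at more levels means an earlier birth, and inclusion distinguishes births at the same real number
  that are or are not attained.
\<close>

definition older :: "(real \<Rightarrow> 'a set) \<Rightarrow> (real \<Rightarrow> 'a set) \<Rightarrow> bool" where
  "older \<pi> \<omega> \<longleftrightarrow> born \<omega> \<subset> born \<pi> \<or> born \<omega> = born \<pi> \<and> (\<pi>, \<omega>) \<in> seniority \<and> \<pi> \<noteq> \<omega>"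

lemma older_trans: "older \<pi> \<omega> \<Longrightarrow> older \<omega> \<kappa> \<Longrightarrow> older \<pi> \<kappa>"
  unfolding older_def using seniority_trans[of \<pi> \<omega> \<kappa>] seniority_antisym[of \<pi> \<omega>] by blast

lemma not_older_refl: "\<not> older \<omega> \<omega>"
  by (auto simp: older_def)

text \<open>
  The leader is present at all levels at which the track \<open>\<omega>\<close> is; if not at more of them, then \<open>\<omega>\<close> is itself a full
  track and loses by seniority.
\<close>

lemma leader_older:
  assumes \<omega>: "track \<omega>" "\<omega> t \<noteq> {}" and ne: "leader t (\<omega> t) \<noteq> \<omega>"
  shows "older (leader t (\<omega> t)) \<omega>"
proof -
  let ?\<pi> = "leader t (\<omega> t)"
  have C: "\<omega> t \<in> components (X t)" using trackD \<omega> by blast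
  have \<pi>: "track ?\<pi>" "?\<pi> t = \<omega> t" "\<And>s. s \<le> t \<Longrightarrow> \<omega> t \<inter> X s \<noteq> {} \<Longrightarrow> ?\<pi> s \<noteq> {}"
    using leader(1)[OF C] by (auto simp: full_tracks_def)
  have le: "?\<pi> s \<noteq> {}" if "s \<le> t" "\<omega> s \<noteq> {}" for s
  proof (rule \<pi>(3)[OF that(1)])
    have "\<omega> s \<subseteq> X s" "\<omega> s \<subseteq> \<omega> t" using trackD[OF \<omega>(1)] that in_components_subset by blast+
    then show "\<omega> t \<inter> X s \<noteq> {}" using that by blast
  qed
  have ge: "?\<pi> s \<noteq> {}" "\<omega> s \<noteq> {}" if "t \<le> s" for s
    using trackD(1)[OF \<pi>(1) that] trackD(1)[OF \<omega>(1) that] \<pi>(2) \<omega>(2) by auto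
  have "?\<pi> s \<noteq> {}" if "\<omega> s \<noteq> {}" for s
    using le[of s] ge(1)[of s] that by (cases "s \<le> t") auto
  then have "born \<omega> \<subseteq> born ?\<pi>" by (auto simp: born_def)
  moreover have "(?\<pi>, \<omega>) \<in> seniority" if eq: "born \<omega> = born ?\<pi>"
  proof (rule leader(2)[OF C])
    show "\<omega> \<in> full_tracks t (\<omega> t)"
      using \<omega>(1) \<pi>(3) eq unfolding full_tracks_def born_def by blast
  qed
  ultimately show ?thesis using ne by (auto simp: older_def)
qed

text \<open>
  The leader at one buried level absorbs \<open>\<omega>\<close> at all later levels. If the death of \<open>\<omega>\<close> is not attained, the level has
  to be chosen so close to the infimum \<open>d\<close> that the leader is absorbed at all levels after \<open>d\<close>; this is
  possible as there are only finitely many components at level \<open>d\<close>.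
\<close>

lemma parent_exists:
  assumes al: "alive \<omega> \<noteq> {}" and bu: "buried \<omega> \<noteq> {}"
  shows "\<exists>\<pi>. track \<pi> \<and> older \<pi> \<omega> \<and> (\<forall>t\<in>buried \<omega>. \<pi> t = \<omega> t)"
proof -
  have \<omega>: "track \<omega>" using al aliveD by blast
  have absorb: "?thesis" if t0: "t0 \<in> buried \<omega>" and
    *: "\<And>t. t \<in> buried \<omega> \<Longrightarrow> t \<le> t0 \<Longrightarrow> leader t0 (\<omega> t0) t = \<omega> t" for t0
  proof (intro exI conjI ballI)
    have C: "\<omega> t0 \<in> components (X t0)" using t0 trackD[OF \<omega>] by (auto simp: buried_def)
    show tr: "track (leader t0 (\<omega> t0))" by (rule leader_track[OF C])
    show "older (leader t0 (\<omega> t0)) \<omega>" using leader_older[OF \<omega>] t0 by (auto simp: buried_def)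
    fix t assume t: "t \<in> buried \<omega>"
    show "leader t0 (\<omega> t0) t = \<omega> t"
    proof (cases "t \<le> t0")
      case True then show ?thesis using * t by blast
    next
      case False
      then have "\<omega> t0 \<subseteq> leader t0 (\<omega> t0) t" "\<omega> t0 \<subseteq> \<omega> t"
        using trackD(1)[OF tr, of t0 t] leader_at[OF C] trackD(1)[OF \<omega>, of t0 t] by auto
      moreover have "\<omega> t0 \<noteq> {}" using t0 by (auto simp: buried_def)
      ultimately show ?thesis using track_eqI[OF tr \<omega>] by blast
    qed
  qed
  have up: "t \<in> buried \<omega>" if s: "s \<in> buried \<omega>" and st: "s \<le> t" for s t
  proof (rule ccontr)
    assume "t \<notin> buried \<omega>"
    moreover have "\<omega> t \<noteq> {}" using s trackD(1)[OF \<omega> st] by (auto simp: buried_def)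
    ultimately have "t \<in> alive \<omega>" using \<omega> by (auto simp: alive_def buried_def)
    then show False using alive_before_buried[OF _ s] st by force
  qed
  define d where "d = Inf (buried \<omega>)"
  obtain a where a: "a \<in> alive \<omega>" using al by blast
  have bdd: "bdd_below (buried \<omega>)"
    using alive_before_buried[OF a] by (intro bdd_belowI[of _ a]) (auto intro: less_imp_le)
  have d_le: "d \<le> t" if "t \<in> buried \<omega>" for t unfolding d_def by (rule cInf_lower[OF that bdd])
  show ?thesis
  proof (cases "d \<in> buried \<omega>")
    case True
    show ?thesis
    proof (rule absorb[OF True])
      fix t assume "t \<in> buried \<omega>" "t \<le> d"
      then have "t = d" using d_le by force
      then show "leader d (\<omega> d) t = \<omega> t"
        using leader_at[of "\<omega> d" d] True trackD[OF \<omega>] by (auto simp: buried_def)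
    qed
  next
    case False
    have bur: "t \<in> buried \<omega>" if "d < t" for t
      using cInf_lessD[of "buried \<omega>" t] bu that up unfolding d_def by fastforce
    have "a \<le> d" unfolding d_def
      using alive_before_buried[OF a] bu by (intro cInf_greatest) (auto intro: less_imp_le)
    then have \<omega>d: "\<omega> d \<noteq> {}" using trackD(1)[OF \<omega>] a by (auto simp: alive_def)
    \<comment> \<open>Components at time \<open>d\<close> that are absorbed at all times after \<open>d\<close> are already absorbed soon after.\<close>
    define \<N> where "\<N> = {C \<in> components (X d). \<exists>t>d. \<not> C \<subseteq> \<omega> t}"
    have fin: "finite \<N>" unfolding \<N>_def using finite_comps by simp
    have "\<forall>C\<in>\<N>. \<exists>t>d. \<not> C \<subseteq> \<omega> t" by (auto simp: \<N>_def)
    then obtain q where q: "\<And>C. C \<in> \<N> \<Longrightarrow> d < q C \<and> \<not> C \<subseteq> \<omega> (q C)" by metis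
    define t0 where "t0 = Min (insert (d + 1) (q ` \<N>))"
    have t0: "d < t0" using fin q by (auto simp: t0_def)
    have abs: "C \<subseteq> \<omega> t" if "C \<in> components (X d)" "C \<subseteq> \<omega> t0" "d < t" for C t
    proof (rule ccontr)
      assume "\<not> C \<subseteq> \<omega> t"
      then have "C \<in> \<N>" using that by (auto simp: \<N>_def)
      then have "t0 \<le> q C" unfolding t0_def using fin by (intro Min_le) auto
      then have "C \<subseteq> \<omega> (q C)" using that(2) trackD(1)[OF \<omega>] by blast
      then show False using q \<open>C \<in> \<N>\<close> by blast
    qed
    let ?\<pi> = "leader t0 (\<omega> t0)"
    have t0b: "t0 \<in> buried \<omega>" using bur t0 by blast
    have C: "\<omega> t0 \<in> components (X t0)" using t0b trackD[OF \<omega>] by (auto simp: buried_def)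
    have \<pi>: "track ?\<pi>" "?\<pi> t0 = \<omega> t0" "\<And>s. s \<le> t0 \<Longrightarrow> \<omega> t0 \<inter> X s \<noteq> {} \<Longrightarrow> ?\<pi> s \<noteq> {}"
      using leader(1)[OF C] by (auto simp: full_tracks_def)
    have "\<omega> d \<subseteq> X d" "\<omega> d \<subseteq> \<omega> t0"
      using trackD[OF \<omega>] \<omega>d in_components_subset t0 by (blast, auto)
    then have \<pi>d: "?\<pi> d \<noteq> {}" using \<pi>(3)[of d] t0 \<omega>d by auto
    have \<pi>d_comp: "?\<pi> d \<in> components (X d)" "?\<pi> d \<subseteq> \<omega> t0"
      using trackD(2)[OF \<pi>(1) \<pi>d] trackD(1)[OF \<pi>(1), of d t0] \<pi>(2) t0 by auto
    show ?thesis
    proof (rule absorb[OF t0b])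
      fix t assume t: "t \<in> buried \<omega>" "t \<le> t0"
      have "d < t" using t(1) d_le[OF t(1)] False by (cases "d = t") auto
      then have "?\<pi> d \<subseteq> \<omega> t" "?\<pi> d \<subseteq> ?\<pi> t"
        using abs \<pi>d_comp trackD(1)[OF \<pi>(1), of d t] by auto
      then show "?\<pi> t = \<omega> t" using track_eqI[OF \<pi>(1) \<omega> \<pi>d] by blast
    qed
  qed
qed

definition parent :: "(real \<Rightarrow> 'a set) \<Rightarrow> real \<Rightarrow> 'a set" where
  "parent \<omega> = (SOME \<pi>. track \<pi> \<and> older \<pi> \<omega> \<and> (\<forall>t\<in>buried \<omega>. \<pi> t = \<omega> t))"

lemma parent:
  assumes "alive \<omega> \<noteq> {}" "buried \<omega> \<noteq> {}"
  shows "track (parent \<omega>)" "older (parent \<omega>) \<omega>" "t \<in> buried \<omega> \<Longrightarrow> parent \<omega> t = \<omega> t"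
  using someI_ex[OF parent_exists[OF assms]] unfolding parent_def by auto

lemma parent_nonempty:
  assumes "t \<in> alive \<omega>" "buried \<omega> \<noteq> {}" shows "parent \<omega> t \<in> components (X t)"
proof -
  have "born \<omega> \<subseteq> born (parent \<omega>)" using parent(2)[of \<omega>] assms by (auto simp: older_def)
  then show ?thesis
    using assms trackD(2)[OF parent(1)[of \<omega>], of t] by (auto simp: born_def alive_def)
qed

lemma leader_parent_older:
  assumes "t \<in> alive \<omega>" "buried \<omega> \<noteq> {}" shows "older (leader t (parent \<omega> t)) \<omega>"
proof (cases "leader t (parent \<omega> t) = parent \<omega>")
  case True then show ?thesis using parent(2) assms by auto
next
  case False
  have "parent \<omega> t \<noteq> {}" using parent_nonempty[OF assms] in_components_nonempty by blast
  then show ?thesis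
    using leader_older[OF parent(1), of \<omega> t] False parent(2)[of \<omega>] older_trans assms by blast
qed

end

section \<open>Interval decomposition of the degree-0 homology of a filtration\<close>

text \<open>
  Vectors \<open>e i t\<close> that form a basis at each level, that are carried to each other while \<open>t\<close> is in the interval
  \<open>A i\<close> and to \<open>0\<close> afterwards, are the same thing as an isomorphism with a direct sum of interval modules.
\<close>

lemma interval_decomposition_from_basis:
  fixes V :: "('f::field, 'v::ab_group_add) pers_module"
    and A :: "'i \<Rightarrow> real set" and e :: "'i \<Rightarrow> real \<Rightarrow> 'v"
  assumes pm: "persistence_module V"
    and interval: "\<And>i. i \<in> I \<Longrightarrow> is_interval (A i)" "\<And>i. i \<in> I \<Longrightarrow> A i \<noteq> {}"
    and fin: "\<And>t. finite {i \<in> I. t \<in> A i}"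
    and mem: "\<And>i t. i \<in> I \<Longrightarrow> t \<in> A i \<Longrightarrow> e i t \<in> pm_space V t"
    and independent: "\<And>t c i. (\<Sum>i | i \<in> I \<and> t \<in> A i. pm_scale V (c i) (e i t)) = 0 \<Longrightarrow>
        i \<in> I \<Longrightarrow> t \<in> A i \<Longrightarrow> c i = 0"
    and spanning: "\<And>t x. x \<in> pm_space V t \<Longrightarrow>
        \<exists>c. x = (\<Sum>i | i \<in> I \<and> t \<in> A i. pm_scale V (c i) (e i t))"
    and survive: "\<And>i s t. i \<in> I \<Longrightarrow> s \<le> t \<Longrightarrow> s \<in> A i \<Longrightarrow> t \<in> A i \<Longrightarrow> pm_map V s t (e i s) = e i t"
    and die: "\<And>i s t. i \<in> I \<Longrightarrow> s \<le> t \<Longrightarrow> s \<in> A i \<Longrightarrow> t \<notin> A i \<Longrightarrow> pm_map V s t (e i s) = 0"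
  shows "\<exists>\<mu>. interval_decomposition V \<mu>"
proof -
  have vs: "vector_space (pm_scale V)" using pm by (simp add: persistence_module_def)
  interpret vector_space "pm_scale V" by (rule vs)
  have sub: "subspace (pm_space V t)" for t using pm by (simp add: persistence_module_def)
  have lin: "linear_betw (pm_scale V) (pm_space V s) (pm_scale V) (pm_space V t) (pm_map V s t)"
    if "s \<le> t" for s t using pm that by (simp add: persistence_module_def)
  define \<mu> where "\<mu> B = card {i \<in> I. A i = B}" for B
  have finB: "finite {i \<in> I. A i = B}" for B
  proof (cases "\<exists>i\<in>I. A i = B")
    case True
    then obtain t where "t \<in> B" using interval by blast
    then show ?thesis using fin[of t] by (auto elim!: finite_subset[rotated])
  next
    case False then have "{i \<in> I. A i = B} = {}" by auto then show ?thesis by (simp only: finite.emptyI)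
  qed
  have "\<forall>B. \<exists>g. bij_betw g {..<\<mu> B} {i \<in> I. A i = B}"
    using ex_bij_betw_nat_finite[OF finB] by (simp add: \<mu>_def atLeast0LessThan)
  then obtain g0 where g0: "\<And>B. bij_betw (g0 B) {..<\<mu> B} {i \<in> I. A i = B}" by metis
  define g where "g j = g0 (fst j) (snd j)" for j
  have g_in: "g j \<in> I" "A (g j) = fst j" if "j \<in> copies \<mu>" for j
    using that bij_betw_apply[OF g0[of "fst j"], of "snd j"] by (auto simp: g_def copies_def)
  have g_bij: "bij_betw g (copies \<mu>) I"
    unfolding bij_betw_def
  proof
    show "inj_on g (copies \<mu>)"
    proof
      fix j k assume jk: "j \<in> copies \<mu>" "k \<in> copies \<mu>" "g j = g k"
      then have 1: "fst j = fst k" using g_in by metis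
      then have "snd j = snd k"
        using jk g0[of "fst j"] by (auto simp: g_def copies_def bij_betw_def inj_on_def)
      with 1 show "j = k" by (rule prod_eqI)
    qed
    have "i \<in> g ` copies \<mu>" if "i \<in> I" for i
    proof -
      have "i \<in> g0 (A i) ` {..<\<mu> (A i)}" using g0[of "A i"] that by (auto simp: bij_betw_def)
      then obtain k where "k < \<mu> (A i)" "i = g0 (A i) k" by auto
      then show ?thesis by (intro image_eqI[of _ _ "(A i, k)"]) (auto simp: g_def copies_def)
    qed
    then show "g ` copies \<mu> = I" using g_in by auto
  qed
  define J where "J t = {j \<in> copies \<mu>. t \<in> fst j}" for t
  have gJ: "bij_betw g (J t) {i \<in> I. t \<in> A i}" for t
    unfolding J_def using g_bij g_in by (auto simp: bij_betw_def inj_on_def image_iff)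
  have finJ: "finite (J t)" for t using bij_betw_finite[OF gJ] fin by blast
  define W :: "('f, real set \<times> nat \<Rightarrow>\<^sub>0 'f) pers_module" where
    "W = direct_sum (copies \<mu>) (\<lambda>(B, k). interval_module B)"
  have W_space: "p \<in> pm_space W t \<longleftrightarrow> Poly_Mapping.keys p \<subseteq> J t" for p t
    by (auto simp: W_def direct_sum_def interval_module_def J_def in_keys_iff subset_iff
        split: if_splits prod.splits) (metis fst_conv)+
  have W_zero: "Poly_Mapping.lookup p j = 0" if "p \<in> pm_space W t" "j \<notin> J t" for p t j
    using that unfolding W_space by (meson in_keys_iff subsetD)
  have W_scale: "Poly_Mapping.lookup (pm_scale W c p) j = c * Poly_Mapping.lookup p j" for c p j
    by (auto simp: W_def direct_sum_def interval_module_def lookup_mapp when_def in_keys_iff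
        split: prod.splits)
  have W_map: "Poly_Mapping.lookup (pm_map W s t p) j =
      (if s \<in> fst j \<and> t \<in> fst j then Poly_Mapping.lookup p j else 0)" for s t p j
    by (auto simp: W_def direct_sum_def interval_module_def lookup_mapp when_def in_keys_iff
        split: prod.splits)
  define \<phi> where "\<phi> t p = (\<Sum>j\<in>J t. pm_scale V (Poly_Mapping.lookup p j) (e (g j) t))" for t p
  have \<phi>_mem: "\<phi> t p \<in> pm_space V t" for t p
    unfolding \<phi>_def
    by (intro subspace_sum[OF sub] subspace_scale[OF sub] mem) (auto simp: J_def g_in)
  have \<phi>_add: "\<phi> t (p + q) = \<phi> t p + \<phi> t q" for t p q
    by (simp add: \<phi>_def lookup_add scale_left_distrib sum.distrib)
  have \<phi>_scale: "\<phi> t (pm_scale W c p) = pm_scale V c (\<phi> t p)" for t c p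
    by (simp add: \<phi>_def W_scale scale_sum_right)
  have \<phi>_inj: "inj_on (\<phi> t) (pm_space W t)" for t
  proof
    fix p q assume pq: "p \<in> pm_space W t" "q \<in> pm_space W t" "\<phi> t p = \<phi> t q"
    define c where "c j = Poly_Mapping.lookup p j - Poly_Mapping.lookup q j" for j
    have "(\<Sum>i | i \<in> I \<and> t \<in> A i. pm_scale V (c (inv_into (J t) g i)) (e i t))
        = (\<Sum>j\<in>J t. pm_scale V (c (inv_into (J t) g (g j))) (e (g j) t))"
      by (rule sum.reindex_bij_betw[OF gJ, symmetric])
    also have "\<dots> = (\<Sum>j\<in>J t. pm_scale V (c j) (e (g j) t))"
      using gJ[of t] by (intro sum.cong) (auto simp: bij_betw_def)
    also have "\<dots> = \<phi> t p - \<phi> t q"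
      by (simp add: \<phi>_def c_def scale_left_diff_distrib sum_subtractf)
    finally have 0: "(\<Sum>i | i \<in> I \<and> t \<in> A i. pm_scale V (c (inv_into (J t) g i)) (e i t)) = 0"
      using pq by simp
    have "c j = 0" if "j \<in> J t" for j
      using independent[OF 0, of "g j"] that g_in[of j] gJ[of t]
      by (auto simp: J_def bij_betw_def)
    then have "Poly_Mapping.lookup p j = Poly_Mapping.lookup q j" for j
      using W_zero[OF pq(1)] W_zero[OF pq(2)] by (cases "j \<in> J t") (auto simp: c_def)
    then show "p = q" by (rule poly_mapping_eqI)
  qed
  have \<phi>_surj: "\<exists>p\<in>pm_space W t. \<phi> t p = x" if x: "x \<in> pm_space V t" for t x
  proof -
    obtain c where c: "x = (\<Sum>i | i \<in> I \<and> t \<in> A i. pm_scale V (c i) (e i t))"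
      using spanning[OF x] by (rule exE)
    define p where "p = (\<Sum>j\<in>J t. Poly_Mapping.single j (c (g j)))"
    have p: "Poly_Mapping.lookup p j = (if j \<in> J t then c (g j) else 0)" for j
      using finJ by (simp add: p_def lookup_sum lookup_single when_def)
    have "p \<in> pm_space W t" by (auto simp: W_space in_keys_iff p split: if_splits)
    moreover have "\<phi> t p = x"
      unfolding c by (simp add: \<phi>_def p sum.reindex_bij_betw[OF gJ, symmetric] cong: sum.cong)
    ultimately show ?thesis by blast
  qed
  have \<phi>_bij: "bij_betw (\<phi> t) (pm_space W t) (pm_space V t)" for t
    unfolding bij_betw_def using \<phi>_inj \<phi>_mem \<phi>_surj by blast
  have W_maps: "pm_map W s t p \<in> pm_space W t" if "p \<in> pm_space W s" for s t p
    using that by (auto simp: W_space in_keys_iff W_map J_def subset_iff split: if_splits)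
  have \<phi>_map: "pm_map V s t (\<phi> s p) = \<phi> t (pm_map W s t p)" if st: "s \<le> t" for s t p
  proof -
    have 0: "pm_map V s t 0 = 0"
      using lin[OF st] subspace_0[OF sub] unfolding linear_betw_def
      by (metis add_cancel_right_left add_0)
    have "pm_map V s t (\<Sum>j\<in>K. pm_scale V (c j) (e (g j) s)) =
        (\<Sum>j\<in>K. pm_scale V (c j) (pm_map V s t (e (g j) s)))" if "K \<subseteq> J s" for K c
      using finite_subset[OF that finJ] that
    proof (induction K rule: finite_induct)
      case (insert j K)
      have "e (g j) s \<in> pm_space V s" using insert by (intro mem) (auto simp: J_def g_in)
      moreover have "(\<Sum>j\<in>K. pm_scale V (c j) (e (g j) s)) \<in> pm_space V s"
        using insert by (intro subspace_sum[OF sub] subspace_scale[OF sub] mem) (auto simp: J_def g_in)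
      ultimately show ?case
        using insert lin[OF st] subspace_scale[OF sub] by (simp add: linear_betw_def)
    qed (simp add: 0)
    then have "pm_map V s t (\<phi> s p) =
        (\<Sum>j\<in>J s. pm_scale V (Poly_Mapping.lookup p j) (pm_map V s t (e (g j) s)))"
      by (simp add: \<phi>_def)
    also have "\<dots> = (\<Sum>j\<in>J s \<inter> J t. pm_scale V (Poly_Mapping.lookup p j) (e (g j) t))"
      using st g_in by (intro sum.mono_neutral_cong_right finJ)
        (auto simp: J_def survive die)
    also have "\<dots> = \<phi> t (pm_map W s t p)"
      unfolding \<phi>_def by (intro sum.mono_neutral_cong_left finJ) (auto simp: J_def W_map)
    finally show ?thesis .
  qed
  define h where "h t = inv_into (pm_space W t) (\<phi> t)" for t
  have h_bij: "bij_betw (h t) (pm_space V t) (pm_space W t)" for t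
    unfolding h_def by (rule bij_betw_inv_into[OF \<phi>_bij])
  have h_eqI: "h t x = p" if "p \<in> pm_space W t" "\<phi> t p = x" for t x p
    unfolding h_def using that inv_into_f_f[OF \<phi>_inj] by blast
  have \<phi>h: "\<phi> t (h t x) = x" "h t x \<in> pm_space W t" if "x \<in> pm_space V t" for t x
    using that h_eqI \<phi>_surj by metis+
  have W_add: "p + q \<in> pm_space W t" "pm_scale W c p \<in> pm_space W t"
    if "p \<in> pm_space W t" "q \<in> pm_space W t" for p q t c
    using that by (auto simp: W_space W_scale in_keys_iff lookup_add subset_iff) (metis add_0)
  have h_lin: "linear_betw (pm_scale V) (pm_space V t) (pm_scale W) (pm_space W t) (h t)" for t
    unfolding linear_betw_def
    using \<phi>h by (auto intro!: h_eqI W_add simp: \<phi>_add \<phi>_scale)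
  have h_map: "h t (pm_map V s t x) = pm_map W s t (h s x)"
    if "s \<le> t" "x \<in> pm_space V s" for s t x
    using that \<phi>h[of x s] by (intro h_eqI W_maps) (auto simp: \<phi>_map[symmetric])
  have "pm_isomorphic V W" unfolding pm_isomorphic_def
    using h_bij h_lin h_map by blast
  moreover have "\<forall>B. 0 < \<mu> B \<longrightarrow> is_interval B \<and> B \<noteq> {}"
    using interval finB by (auto simp: \<mu>_def card_gt_0_iff)
  ultimately show ?thesis unfolding interval_decomposition_def W_def by blast
qed

definition H0_module :: "(real \<Rightarrow> 'a::topological_space set) \<Rightarrow> ('f::field, 'a set \<Rightarrow>\<^sub>0 'f) pers_module" where
  "H0_module X =
     \<lparr> pm_scale = H0_scale, pm_space = (\<lambda>t. H0_space (X t)), pm_map = (\<lambda>s t. H0_incl (X t)) \<rparr>"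

lemma H0_module_simps [simp]:
  "pm_scale (H0_module X) = H0_scale" "pm_space (H0_module X) t = H0_space (X t)"
  "pm_map (H0_module X) s t = H0_incl (X t)"
  by (simp_all add: H0_module_def)

lemma PH0_eq_H0_module: "PH0 M v = H0_module (sublevel M v)"
  by (simp add: PH0_def H0_module_def)

lemma persistence_module_H0_module:
  assumes "\<And>s t. s \<le> t \<Longrightarrow> X s \<subseteq> X t"
  shows "persistence_module (H0_module X)"
  unfolding persistence_module_def H0_module_simps linear_betw_def image_subset_iff
  by (intro conjI allI impI ballI vector_space_H0_scale subspace_H0_space H0_incl_add
      H0_incl_scale H0_incl_id H0_incl_in[OF assms] H0_incl_comp[OF assms assms])

lemma H0_incl_single_component:
  assumes "D \<in> components B" "C \<subseteq> D" "C \<noteq> {}"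
  shows "H0_incl B (Poly_Mapping.single C a) = Poly_Mapping.single D a"
proof -
  have "(THE C'. C' \<in> components B \<and> C \<subseteq> C') = D"
    using assms components_eq[of D B] by (intro the_equality) blast+
  then show ?thesis by (simp add: H0_incl_single)
qed

lemma single_in_H0_space: "C \<in> components A \<Longrightarrow> Poly_Mapping.single C a \<in> H0_space A"
  by (auto simp: H0_space_def)

lemma H0_incl_diff: "H0_incl B (p - q) = H0_incl B p - H0_incl B (q :: _ \<Rightarrow>\<^sub>0 'f::field)"
  using H0_incl_add[of B "p - q" q] by (simp add: algebra_simps)

context finite_filtration
begin

text \<open>
  The difference between a component and the component that finally absorbs it. It vanishes as soon as the two
  coincide, which makes it a generator of the bar \<open>alive \<omega>\<close>. A track that is never buried has no parent.
\<close>

definition bar_vector :: "(real \<Rightarrow> 'a set) \<Rightarrow> real \<Rightarrow> 'a set \<Rightarrow>\<^sub>0 'f::field" where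
  "bar_vector \<omega> t = Poly_Mapping.single (\<omega> t) 1 -
     (if buried \<omega> = {} then 0 else Poly_Mapping.single (parent \<omega> t) 1)"

lemma bar_vector_mem:
  assumes "t \<in> alive \<omega>" shows "bar_vector \<omega> t \<in> (H0_space (X t) :: ('a set \<Rightarrow>\<^sub>0 'f::field) set)"
proof -
  interpret vector_space "H0_scale :: 'f::field \<Rightarrow> ('a set \<Rightarrow>\<^sub>0 'f) \<Rightarrow> _"
    by (rule vector_space_H0_scale)
  show ?thesis
    unfolding bar_vector_def
    using aliveD(2)[OF assms] parent_nonempty[OF assms]
      subspace_diff[OF subspace_H0_space] subspace_0[OF subspace_H0_space]
    by (auto simp: single_in_H0_space)
qed

lemma H0_incl_bar_vector:
  assumes st: "s \<le> t" and s: "s \<in> alive \<omega>"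
  shows "H0_incl (X t) (bar_vector \<omega> s) =
    (if t \<in> alive \<omega> then bar_vector \<omega> t else (0 :: 'a set \<Rightarrow>\<^sub>0 'f::field))"
proof -
  have \<omega>: "track \<omega>" "\<omega> s \<noteq> {}" "\<omega> s \<subseteq> \<omega> t"
    using s st aliveD(1)[OF s] trackD by (auto simp: alive_def)
  then have \<omega>t: "\<omega> t \<in> components (X t)" using trackD(2)[OF \<omega>(1)] by blast
  have al: "alive \<omega> \<noteq> {}" using s by blast
  have 1: "H0_incl (X t) (Poly_Mapping.single (\<omega> s) 1) = (Poly_Mapping.single (\<omega> t) 1 :: _ \<Rightarrow>\<^sub>0 'f)"
    using \<omega> \<omega>t by (intro H0_incl_single_component)
  have 2: "H0_incl (X t) (Poly_Mapping.single (parent \<omega> s) 1) =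
      (Poly_Mapping.single (parent \<omega> t) 1 :: _ \<Rightarrow>\<^sub>0 'f)" if b: "buried \<omega> \<noteq> {}"
  proof -
    have "parent \<omega> s \<noteq> {}" using parent_nonempty[OF s b] in_components_nonempty by blast
    moreover have "parent \<omega> s \<subseteq> parent \<omega> t" by (rule trackD(1)[OF parent(1)[OF al b] st])
    ultimately show ?thesis
      using trackD(2)[OF parent(1)[OF al b], of t] by (intro H0_incl_single_component) auto
  qed
  have 0: "H0_incl (X t) (0 :: _ \<Rightarrow>\<^sub>0 'f) = 0" by (simp add: H0_incl_def)
  have 3: "H0_incl (X t) (bar_vector \<omega> s) = (bar_vector \<omega> t :: _ \<Rightarrow>\<^sub>0 'f)"
    unfolding bar_vector_def by (simp add: H0_incl_diff 0 1 2)
  show ?thesis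
  proof (cases "t \<in> alive \<omega>")
    case False
    then have "t \<in> buried \<omega>" using \<omega> by (auto simp: alive_def buried_def)
    then have "bar_vector \<omega> t = (0 :: _ \<Rightarrow>\<^sub>0 'f)"
      using parent(3)[OF al, of t] by (auto simp: bar_vector_def)
    then show ?thesis using False 3 by simp
  qed (simp add: 3)
qed

text \<open>
  The coefficient matrix of the bar vectors is triangular with respect to age, as parents are led by older tracks.
\<close>

lemma lookup_bar_vector_later:
  assumes "t \<in> alive \<omega>" "t \<in> alive \<kappa>" "\<not> older \<omega> \<kappa>"
  shows "Poly_Mapping.lookup (bar_vector \<kappa> t) (\<omega> t) = (if \<kappa> = \<omega> then 1 else (0 :: 'f::field))"
proof -
  have "parent \<kappa> t \<noteq> \<omega> t" if "buried \<kappa> \<noteq> {}"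
    using leader_parent_older[OF assms(2) that] aliveD(3)[OF assms(1)] assms(3) by auto
  moreover have "\<kappa> t = \<omega> t \<longleftrightarrow> \<kappa> = \<omega>" using alive_inj assms by blast
  ultimately show ?thesis
    by (simp add: bar_vector_def lookup_minus lookup_single when_def)
qed

text \<open>
  In a nontrivial relation, the coefficient at the component of the youngest track involved cannot cancel.
\<close>

lemma bar_vectors_independent:
  assumes 0: "(\<Sum>\<omega> | t \<in> alive \<omega>. H0_scale (c \<omega>) (bar_vector \<omega> t)) = 0" and \<omega>: "t \<in> alive \<omega>"
  shows "c \<omega> = (0 :: 'f::field)"
proof (rule ccontr)
  assume "c \<omega> \<noteq> 0"
  define S where "S = {\<kappa>. t \<in> alive \<kappa> \<and> c \<kappa> \<noteq> 0}"
  have "finite S" using finite_alive[of t] by (auto simp: S_def elim!: finite_subset[rotated])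
  moreover have "S \<noteq> {}" using \<open>c \<omega> \<noteq> 0\<close> \<omega> by (auto simp: S_def)
  moreover have "asymp_on S older" "transp_on S older"
    using older_trans not_older_refl by (blast intro: asymp_onI, blast intro: transp_onI)
  ultimately obtain m where m: "m \<in> S" "\<And>\<kappa>. \<kappa> \<in> S \<Longrightarrow> \<not> older m \<kappa>"
    using Finite_Set.bex_max_element[of S older] not_older_refl by metis
  have "0 = (\<Sum>\<kappa> | t \<in> alive \<kappa>. c \<kappa> * Poly_Mapping.lookup (bar_vector \<kappa> t) (m t))"
    using arg_cong[OF 0, of "\<lambda>p. Poly_Mapping.lookup p (m t)"]
    by (simp add: lookup_sum lookup_H0_scale)
  also have "\<dots> = (\<Sum>\<kappa> | t \<in> alive \<kappa>. if \<kappa> = m then c m else 0)"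
  proof (rule sum.cong[OF refl])
    fix \<kappa> assume "\<kappa> \<in> {\<kappa>. t \<in> alive \<kappa>}"
    then show "c \<kappa> * Poly_Mapping.lookup (bar_vector \<kappa> t) (m t) = (if \<kappa> = m then c m else 0)"
      using lookup_bar_vector_later[of t m \<kappa>] m by (cases "c \<kappa> = 0") (auto simp: S_def)
  qed
  also have "\<dots> = c m" using m(1) finite_alive[of t] by (simp add: S_def)
  finally show False using m(1) by (simp add: S_def)
qed

text \<open>
  By induction on age, the component of each leading track is its bar vector plus the component of an older leader.
\<close>

lemma bar_vectors_span:
  assumes p: "p \<in> H0_space (X t)"
  shows "\<exists>c. p = (\<Sum>\<omega> | t \<in> alive \<omega>. H0_scale (c \<omega>) (bar_vector \<omega> t :: _ \<Rightarrow>\<^sub>0 'f::field))"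
proof -
  interpret vector_space "H0_scale :: 'f::field \<Rightarrow> ('a set \<Rightarrow>\<^sub>0 'f) \<Rightarrow> _"
    by (rule vector_space_H0_scale)
  define S where "S = {\<omega>. t \<in> alive \<omega>}"
  have fin: "finite S" unfolding S_def by (rule finite_alive)
  let ?E = "(\<lambda>\<omega>. bar_vector \<omega> t :: _ \<Rightarrow>\<^sub>0 'f) ` S"
  have "Poly_Mapping.single (\<omega> t) 1 \<in> span ?E" if "\<omega> \<in> S" for \<omega>
  proof -
    define r where "r = {(\<pi>, \<kappa>). \<pi> \<in> S \<and> \<kappa> \<in> S \<and> older \<pi> \<kappa>}"
    have "trans r" unfolding r_def using older_trans by (auto intro!: transI)
    then have "acyclic r" using not_older_refl by (auto simp: acyclic_def trancl_id r_def)
    moreover have "finite r"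
      by (rule finite_subset[of _ "S \<times> S"]) (auto simp: r_def fin)
    ultimately have "wf r" by (rule finite_acyclic_wf[rotated])
    then show ?thesis using that
    proof (induction \<omega>)
      case (less \<omega>)
      have al: "t \<in> alive \<omega>" using less.prems by (simp add: S_def)
      have b: "bar_vector \<omega> t \<in> span ?E" using less.prems by (auto intro: span_base)
      show ?case
      proof (cases "buried \<omega> = {}")
        case True
        then show ?thesis using b by (simp add: bar_vector_def)
      next
        case False
        let ?\<pi> = "leader t (parent \<omega> t)"
        have C: "parent \<omega> t \<in> components (X t)" by (rule parent_nonempty[OF al False])
        have "?\<pi> \<in> S" using leader_alive[OF C] by (simp add: S_def)
        then have "(?\<pi>, \<omega>) \<in> r" using leader_parent_older[OF al False] less.prems by (simp add: r_def)
        then have "Poly_Mapping.single (?\<pi> t) 1 \<in> span ?E" using less.IH \<open>?\<pi> \<in> S\<close> by blast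
        then have "bar_vector \<omega> t + Poly_Mapping.single (parent \<omega> t) 1 \<in> span ?E"
          using b leader_at[OF C] by (auto intro: span_add)
        then show ?thesis using False by (simp add: bar_vector_def)
      qed
    qed
  qed
  then have single: "Poly_Mapping.single C 1 \<in> span ?E" if "C \<in> components (X t)" for C
    using \<open>\<And>\<omega>. \<omega> \<in> S \<Longrightarrow> _\<close>[of "leader t C"] leader_alive[OF that] leader_at[OF that]
    by (simp add: S_def)
  have "p = (\<Sum>C\<in>Poly_Mapping.keys p. H0_scale (Poly_Mapping.lookup p C) (Poly_Mapping.single C 1))"
    by (rule poly_mapping_eqI)
      (auto simp: lookup_sum lookup_single lookup_H0_scale when_def in_keys_iff if_distrib sum.delta cong: if_cong)
  also have "\<dots> \<in> span ?E"
    using p single by (intro span_sum span_scale) (auto simp: H0_space_def)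
  finally have "p \<in> span ?E" .
  then obtain u where "p = (\<Sum>x\<in>?E. H0_scale (u x) x)"
    using span_finite[of ?E] fin by auto
  moreover have "inj_on (\<lambda>\<omega>. bar_vector \<omega> t :: _ \<Rightarrow>\<^sub>0 'f) S"
  proof
    fix \<omega> \<kappa> assume *: "\<omega> \<in> S" "\<kappa> \<in> S" "(bar_vector \<omega> t :: _ \<Rightarrow>\<^sub>0 'f) = bar_vector \<kappa> t"
    have al: "t \<in> alive \<omega>" "t \<in> alive \<kappa>" using * by (auto simp: S_def)
    have eq: "\<pi> = \<rho>" if "t \<in> alive \<pi>" "t \<in> alive \<rho>" "\<not> older \<pi> \<rho>"
      and e: "(bar_vector \<pi> t :: _ \<Rightarrow>\<^sub>0 'f) = bar_vector \<rho> t" for \<pi> \<rho>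
    proof -
      have "Poly_Mapping.lookup (bar_vector \<pi> t) (\<pi> t) = (1 :: 'f)"
        using lookup_bar_vector_later[OF that(1,1) not_older_refl, where 'f='f] by simp
      moreover have "Poly_Mapping.lookup (bar_vector \<pi> t) (\<pi> t) = (if \<rho> = \<pi> then 1 else (0 :: 'f))"
        unfolding e by (rule lookup_bar_vector_later[OF that(1-3)])
      ultimately show ?thesis by (metis zero_neq_one)
    qed
    show "\<omega> = \<kappa>"
    proof (cases "older \<omega> \<kappa>")
      case True
      then have "\<not> older \<kappa> \<omega>" using older_trans not_older_refl by blast
      then show ?thesis using eq[OF al(2,1)] *(3) by simp
    next
      case False
      then show ?thesis using eq[OF al] *(3) by simp
    qed
  qed
  ultimately have "p = (\<Sum>\<omega>\<in>S. H0_scale (u (bar_vector \<omega> t)) (bar_vector \<omega> t))"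
    by (simp add: sum.reindex)
  then show ?thesis unfolding S_def by (rule exI[of _ "\<lambda>\<omega>. u (bar_vector \<omega> t)"])
qed

theorem H0_interval_decomposition:
  "\<exists>\<mu>. interval_decomposition (H0_module X :: ('f::field, 'a set \<Rightarrow>\<^sub>0 'f) pers_module) \<mu>"
proof -
  define I where "I = {\<omega>. alive \<omega> \<noteq> {}}"
  have I: "{\<omega> \<in> I. t \<in> alive \<omega>} = {\<omega>. t \<in> alive \<omega>}" "{\<omega>. \<omega> \<in> I \<and> t \<in> alive \<omega>} = {\<omega>. t \<in> alive \<omega>}" for t
    by (auto simp: I_def)
  show ?thesis
  proof (rule interval_decomposition_from_basis[where I = I and A = alive and e = bar_vector])
    show "\<omega> \<in> I \<Longrightarrow> t \<in> alive \<omega> \<Longrightarrow>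
        (\<Sum>\<omega> | \<omega> \<in> I \<and> t \<in> alive \<omega>. pm_scale (H0_module X) (c \<omega>) (bar_vector \<omega> t)) = 0 \<Longrightarrow>
        c \<omega> = (0 :: 'f)" for t c \<omega>
      unfolding I H0_module_simps by (rule bar_vectors_independent)
    show "p \<in> pm_space (H0_module X) t \<Longrightarrow>
        \<exists>c. p = (\<Sum>\<omega> | \<omega> \<in> I \<and> t \<in> alive \<omega>. pm_scale (H0_module X) (c \<omega>) (bar_vector \<omega> t))"
      for t and p :: "'a set \<Rightarrow>\<^sub>0 'f"
      unfolding I H0_module_simps by (rule bar_vectors_span)
  qed (auto simp: I_def persistence_module_H0_module mono is_interval_alive finite_alive
        bar_vector_mem H0_incl_bar_vector)
qed

end

section \<open>Counting the bars through two levels\<close>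

lemma lookup_map_times:
  "Poly_Mapping.lookup (Poly_Mapping.map ((*) c) p) k = c * (Poly_Mapping.lookup p k :: 'f::field)"
  by (simp add: Poly_Mapping.map.rep_eq when_def)

lemma vector_space_pointwise:
  "vector_space (\<lambda>c. Poly_Mapping.map ((*) c) :: ('k \<Rightarrow>\<^sub>0 'f::field) \<Rightarrow> 'k \<Rightarrow>\<^sub>0 'f)"
  by unfold_locales
    (auto intro!: poly_mapping_eqI simp: lookup_map_times lookup_add algebra_simps)

text \<open>
  The dimension inequality for a linear surjection of coordinate spaces; the map has to be linear on the
  subspace of vectors supported in \<open>K\<close> only.
\<close>

lemma free_module_surj_card:
  fixes f :: "('k \<Rightarrow>\<^sub>0 'f::field) \<Rightarrow> ('j \<Rightarrow>\<^sub>0 'f)"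
  assumes fin: "finite K"
    and add: "\<And>p q. Poly_Mapping.keys p \<subseteq> K \<Longrightarrow> Poly_Mapping.keys q \<subseteq> K \<Longrightarrow> f (p + q) = f p + f q"
    and scale: "\<And>c p. Poly_Mapping.keys p \<subseteq> K \<Longrightarrow>
        f (Poly_Mapping.map ((*) c) p) = Poly_Mapping.map ((*) c) (f p)"
    and surj: "\<And>q. Poly_Mapping.keys q \<subseteq> J \<Longrightarrow> \<exists>p. Poly_Mapping.keys p \<subseteq> K \<and> f p = q"
  shows "finite J \<and> card J \<le> card K"
proof -
  interpret W: vector_space "\<lambda>c. Poly_Mapping.map ((*) c) :: ('j \<Rightarrow>\<^sub>0 'f) \<Rightarrow> 'j \<Rightarrow>\<^sub>0 'f"
    by (rule vector_space_pointwise)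
  let ?e = "\<lambda>j. Poly_Mapping.single j (1 :: 'f) :: 'j \<Rightarrow>\<^sub>0 'f"
  let ?B = "(\<lambda>k. f (Poly_Mapping.single k 1)) ` K"
  have inj: "inj_on ?e J"
    by (auto intro!: inj_onI dest!: arg_cong[of _ _ Poly_Mapping.keys])
  have f0: "f 0 = 0" using add[of 0 0] by simp
  have f_sum: "f (\<Sum>k\<in>L. Poly_Mapping.single k (c k)) =
      (\<Sum>k\<in>L. Poly_Mapping.map ((*) (c k)) (f (Poly_Mapping.single k 1)))" if "L \<subseteq> K" for L c
    using finite_subset[OF that fin] that
  proof (induction L rule: finite_induct)
    case (insert k L)
    have 1: "Poly_Mapping.single k (c k) = Poly_Mapping.map ((*) (c k)) (Poly_Mapping.single k 1)"
      by (rule poly_mapping_eqI) (simp add: lookup_map_times lookup_single when_def)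
    have "Poly_Mapping.keys (\<Sum>k\<in>L. Poly_Mapping.single k (c k)) \<subseteq> K"
      using insert.prems by (intro order_trans[OF keys_sum]) (auto split: if_splits)
    moreover have "Poly_Mapping.keys (Poly_Mapping.single k (c k)) \<subseteq> K"
        "Poly_Mapping.keys (Poly_Mapping.single k (1::'f)) \<subseteq> K"
      using insert.prems by auto
    ultimately have "f (Poly_Mapping.single k (c k) + (\<Sum>k\<in>L. Poly_Mapping.single k (c k))) =
        Poly_Mapping.map ((*) (c k)) (f (Poly_Mapping.single k 1)) + f (\<Sum>k\<in>L. Poly_Mapping.single k (c k))"
      using add scale 1 by metis
    then show ?case using insert by simp
  qed (simp add: f0)
  have "W.independent (?e ` J)"
    unfolding W.dependent_explicit
  proof (intro notI, elim exE conjE bexE)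
    fix S u j assume S: "finite S" "S \<subseteq> ?e ` J" and 0: "(\<Sum>v\<in>S. Poly_Mapping.map ((*) (u v)) v) = 0"
      and j: "j \<in> S" "u j \<noteq> 0"
    obtain i where i: "j = ?e i" using S j by auto
    have "0 = (\<Sum>v\<in>S. u v * Poly_Mapping.lookup v i)"
      using arg_cong[OF 0, of "\<lambda>p. Poly_Mapping.lookup p i"] by (simp add: lookup_sum lookup_map_times)
    also have "\<dots> = (\<Sum>v\<in>S. if v = j then u j else (0 :: 'f))"
    proof (intro sum.cong refl)
      fix v assume "v \<in> S"
      then obtain k where "v = ?e k" using S by blast
      moreover have "?e k = ?e i \<longleftrightarrow> k = i"
        by (auto dest!: arg_cong[of "?e k" "?e i" Poly_Mapping.keys])
      ultimately show "u v * Poly_Mapping.lookup v i = (if v = j then u j else 0)"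
        by (auto simp: i lookup_single when_def)
    qed
    also have "\<dots> = u j" using S j by simp
    finally show False using j by simp
  qed
  moreover have "?e ` J \<subseteq> W.span ?B"
  proof (rule image_subsetI)
    fix j assume "j \<in> J"
    then obtain p where p: "Poly_Mapping.keys p \<subseteq> K" "f p = ?e j" using surj[of "?e j"] by auto
    have "p = (\<Sum>k\<in>Poly_Mapping.keys p. Poly_Mapping.single k (Poly_Mapping.lookup p k))"
      by (rule sum_singles[symmetric])
    then have "?e j = (\<Sum>k\<in>Poly_Mapping.keys p.
        Poly_Mapping.map ((*) (Poly_Mapping.lookup p k)) (f (Poly_Mapping.single k 1)))"
      using f_sum[OF p(1), of "Poly_Mapping.lookup p"] p(2) by simp
    also have "\<dots> \<in> W.span ?B"
      using p(1) by (intro W.span_sum W.span_scale W.span_base) auto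
    finally show "?e j \<in> W.span ?B" .
  qed
  ultimately have "finite (?e ` J) \<and> card (?e ` J) \<le> card ?B"
    using W.independent_span_bound[of ?B "?e ` J"] fin by auto
  then show ?thesis
    using inj card_image_le[OF fin, of "\<lambda>k. f (Poly_Mapping.single k 1)"]
    by (auto simp: card_image finite_image_iff)
qed

lemma H0_image:
  assumes sub: "A \<subseteq> B"
  shows "H0_incl B ` H0_space A = {p :: _ \<Rightarrow>\<^sub>0 'f::field. Poly_Mapping.keys p \<subseteq> comps_meeting A B}"
proof (intro equalityI subsetI)
  fix q :: "'a set \<Rightarrow>\<^sub>0 'f" assume "q \<in> H0_incl B ` H0_space A"
  then obtain p where p: "Poly_Mapping.keys p \<subseteq> components A" "q = H0_incl B p" by (auto simp: H0_space_def)
  have "(THE C'. C' \<in> components B \<and> C \<subseteq> C') \<in> comps_meeting A B" if "C \<in> Poly_Mapping.keys p" for C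
  proof -
    have "C \<in> components A" using p that by auto
    moreover have "(THE C'. C' \<in> components B \<and> C \<subseteq> C') \<in> components B"
      "C \<subseteq> (THE C'. C' \<in> components B \<and> C \<subseteq> C')"
      using theI'[OF component_of_superset[OF sub calculation]] by auto
    ultimately show ?thesis using in_components_nonempty in_components_subset
      by (fastforce simp: comps_meeting_def)
  qed
  then show "q \<in> {p. Poly_Mapping.keys p \<subseteq> comps_meeting A B}"
    unfolding p(2) H0_incl_def mem_Collect_eq
    by (intro order_trans[OF keys_sum]) (auto split: if_splits)
next
  fix q :: "'a set \<Rightarrow>\<^sub>0 'f" assume q: "q \<in> {p. Poly_Mapping.keys p \<subseteq> comps_meeting A B}"
  have "\<exists>C\<in>components A. C \<subseteq> D" if D: "D \<in> comps_meeting A B" for D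
  proof -
    obtain x where x: "x \<in> D" "x \<in> A" "D \<in> components B" using D by (auto simp: comps_meeting_def)
    have "connected_component_set A x \<subseteq> connected_component_set B x"
      by (rule connected_component_mono[OF sub])
    also have "\<dots> = D" using x by (metis components_iff connected_component_eq)
    finally show ?thesis using x comp_set_in_components by blast
  qed
  then obtain c where c: "\<And>D. D \<in> comps_meeting A B \<Longrightarrow> c D \<in> components A \<and> c D \<subseteq> D" by metis
  define p where "p = (\<Sum>D\<in>Poly_Mapping.keys q. Poly_Mapping.single (c D) (Poly_Mapping.lookup q D))"
  have "p \<in> H0_space A"
    unfolding p_def H0_space_def mem_Collect_eq
    using q c by (intro order_trans[OF keys_sum]) (auto split: if_splits)
  moreover have "H0_incl B p = (\<Sum>D\<in>Poly_Mapping.keys q. Poly_Mapping.single D (Poly_Mapping.lookup q D))"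
    unfolding p_def H0_incl_sum
  proof (rule sum.cong[OF refl])
    fix D assume "D \<in> Poly_Mapping.keys q"
    then have "D \<in> components B" "c D \<subseteq> D" "c D \<noteq> {}"
      using q c[of D] in_components_nonempty[of "c D" A] by (auto simp: comps_meeting_def)
    then show "H0_incl B (Poly_Mapping.single (c D) (Poly_Mapping.lookup q D)) =
        Poly_Mapping.single D (Poly_Mapping.lookup q D)"
      by (rule H0_incl_single_component)
  qed
  ultimately show "q \<in> H0_incl B ` H0_space A" by (metis image_eqI sum_singles)
qed

text \<open>
  The number of bars through \<open>s\<close> and \<open>t\<close> is the rank of the map from level \<open>s\<close> to level \<open>t\<close>, for any interval
  decomposition; on the side of homology this rank is the number of components of \<open>X t\<close> that meet \<open>X s\<close>.
\<close>

theorem card_bars_through: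
  fixes X :: "real \<Rightarrow> 'a::topological_space set"
  assumes mono: "\<And>s t. s \<le> t \<Longrightarrow> X s \<subseteq> X t" and fin: "\<And>t. finite (components (X t))"
    and dec: "interval_decomposition (H0_module X :: ('f::field, 'a set \<Rightarrow>\<^sub>0 'f) pers_module) \<mu>"
    and st: "s \<le> t"
  shows "finite {j \<in> copies \<mu>. s \<in> fst j \<and> t \<in> fst j} \<and>
    card {j \<in> copies \<mu>. s \<in> fst j \<and> t \<in> fst j} = card (comps_meeting (X s) (X t))"
proof -
  define J where "J = {j \<in> copies \<mu>. s \<in> fst j \<and> t \<in> fst j}"
  define K where "K = comps_meeting (X s) (X t)"
  define W :: "('f, real set \<times> nat \<Rightarrow>\<^sub>0 'f) pers_module" where
    "W = direct_sum (copies \<mu>) (\<lambda>(B, k). interval_module B)"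
  have finK: "finite K" using fin[of t] by (simp add: K_def comps_meeting_def)
  have W_space: "p \<in> pm_space W t \<longleftrightarrow> Poly_Mapping.keys p \<subseteq> {j \<in> copies \<mu>. t \<in> fst j}" for p t
    by (auto simp: W_def direct_sum_def interval_module_def in_keys_iff subset_iff
        split: if_splits prod.splits) (metis fst_conv)+
  have W_scale: "pm_scale W c = Poly_Mapping.map ((*) c)" for c
    by (rule ext, rule poly_mapping_eqI)
      (auto simp: W_def direct_sum_def interval_module_def lookup_mapp lookup_map_times when_def
        in_keys_iff split: prod.splits)
  have W_map: "Poly_Mapping.lookup (pm_map W s t p) j =
      (if s \<in> fst j \<and> t \<in> fst j then Poly_Mapping.lookup p j else 0)" for s t p j
    by (auto simp: W_def direct_sum_def interval_module_def lookup_mapp when_def in_keys_iff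
        split: prod.splits)
  have "pm_isomorphic (H0_module X :: ('f, 'a set \<Rightarrow>\<^sub>0 'f) pers_module) W"
    using dec by (simp add: interval_decomposition_def W_def)
  then obtain h :: "real \<Rightarrow> ('a set \<Rightarrow>\<^sub>0 'f) \<Rightarrow> _" where
    bij: "\<And>t. bij_betw (h t) (H0_space (X t)) (pm_space W t)" and
    lin: "\<And>t. linear_betw H0_scale (H0_space (X t)) (pm_scale W) (pm_space W t) (h t)" and
    comm: "\<And>s t x. s \<le> t \<Longrightarrow> x \<in> H0_space (X s) \<Longrightarrow> h t (H0_incl (X t) x) = pm_map W s t (h s x)"
    unfolding pm_isomorphic_def H0_module_simps by blast
  have Ksub: "{p :: _ \<Rightarrow>\<^sub>0 'f. Poly_Mapping.keys p \<subseteq> K} \<subseteq> H0_space (X t)"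
    by (auto simp: K_def comps_meeting_def H0_space_def)
  have W_image: "pm_map W s t ` pm_space W s = {p. Poly_Mapping.keys p \<subseteq> J}"
  proof (intro equalityI subsetI)
    fix q assume "q \<in> pm_map W s t ` pm_space W s"
    then show "q \<in> {p. Poly_Mapping.keys p \<subseteq> J}"
      by (auto simp: W_space J_def in_keys_iff W_map subset_iff split: if_splits)
  next
    fix q :: "real set \<times> nat \<Rightarrow>\<^sub>0 'f" assume q: "q \<in> {p. Poly_Mapping.keys p \<subseteq> J}"
    have "Poly_Mapping.lookup q j = 0" if "j \<notin> J" for j
      using q that by (meson in_keys_iff mem_Collect_eq subsetD)
    then have "pm_map W s t q = q"
      using q by (intro poly_mapping_eqI) (auto simp: W_map J_def)
    moreover have "q \<in> pm_space W s" using q by (auto simp: W_space J_def)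
    ultimately show "q \<in> pm_map W s t ` pm_space W s" by (metis image_eqI)
  qed
  have "h t ` {p. Poly_Mapping.keys p \<subseteq> K} = h t ` (H0_incl (X t) ` H0_space (X s))"
    unfolding K_def H0_image[OF mono[OF st]] ..
  also have "\<dots> = pm_map W s t ` (h s ` H0_space (X s))"
    unfolding image_image using comm[OF st] by (rule image_cong[OF refl])
  also have "h s ` H0_space (X s) = pm_space W s" using bij by (simp add: bij_betw_def)
  finally have im: "h t ` {p. Poly_Mapping.keys p \<subseteq> K} = {p. Poly_Mapping.keys p \<subseteq> J}"
    by (simp add: W_image)
  have add: "h t (p + q) = h t p + h t q" and scale: "h t (Poly_Mapping.map ((*) c) p) = Poly_Mapping.map ((*) c) (h t p)"
    if "Poly_Mapping.keys p \<subseteq> K" "Poly_Mapping.keys q \<subseteq> K" for p q c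
    using lin[of t] Ksub that unfolding linear_betw_def W_scale H0_scale_def by blast+
  have 1: "finite J \<and> card J \<le> card K"
  proof (rule free_module_surj_card[where f = "h t"])
    show "\<exists>p. Poly_Mapping.keys p \<subseteq> K \<and> h t p = q" if "Poly_Mapping.keys q \<subseteq> J" for q
    proof -
      have "q \<in> h t ` {p. Poly_Mapping.keys p \<subseteq> K}" using im that by simp
      then show ?thesis by auto
    qed
  qed (use finK add scale in auto)
  define g where "g = inv_into {p. Poly_Mapping.keys p \<subseteq> K} (h t)"
  have inj: "inj_on (h t) {p. Poly_Mapping.keys p \<subseteq> K}"
    using bij[of t] Ksub by (auto simp: bij_betw_def intro: inj_on_subset)
  have gh: "g (h t p) = p" if "Poly_Mapping.keys p \<subseteq> K" for p
    unfolding g_def using inj that by (simp add: inv_into_f_f)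
  have g: "Poly_Mapping.keys (g q) \<subseteq> K" "h t (g q) = q" if "Poly_Mapping.keys q \<subseteq> J" for q
  proof -
    have "q \<in> h t ` {p. Poly_Mapping.keys p \<subseteq> K}" using that im by simp
    then show "Poly_Mapping.keys (g q) \<subseteq> K" "h t (g q) = q"
      unfolding g_def using inv_into_into[of q "h t" "{p. Poly_Mapping.keys p \<subseteq> K}"]
        f_inv_into_f[of q "h t" "{p. Poly_Mapping.keys p \<subseteq> K}"] by auto
  qed
  have keys_add': "Poly_Mapping.keys (p + q) \<subseteq> K" if "Poly_Mapping.keys p \<subseteq> K" "Poly_Mapping.keys q \<subseteq> K"
    for p q :: "'a set \<Rightarrow>\<^sub>0 'f" using that Poly_Mapping.keys_add[of p q] by blast
  have keys_scale: "Poly_Mapping.keys (Poly_Mapping.map ((*) c) p) \<subseteq> K" if "Poly_Mapping.keys p \<subseteq> K"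
    for c and p :: "'a set \<Rightarrow>\<^sub>0 'f" using that by (auto simp: in_keys_iff lookup_map_times subset_iff)
  have "finite K \<and> card K \<le> card J"
  proof (rule free_module_surj_card[where f = g])
    show "finite J" using 1 by simp
    show "g (p + q) = g p + g q" if "Poly_Mapping.keys p \<subseteq> J" "Poly_Mapping.keys q \<subseteq> J" for p q
      using gh[of "g p + g q"] g[OF that(1)] g[OF that(2)] by (simp add: add keys_add')
    show "g (Poly_Mapping.map ((*) c) p) = Poly_Mapping.map ((*) c) (g p)" if "Poly_Mapping.keys p \<subseteq> J" for c p
      using gh[of "Poly_Mapping.map ((*) c) (g p)"] g[OF that] by (simp add: scale keys_scale)
    show "\<exists>p. Poly_Mapping.keys p \<subseteq> J \<and> g p = q" if "Poly_Mapping.keys q \<subseteq> K" for q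
      using gh[OF that] that im by (intro exI[of _ "h t q"]) auto
  qed
  with 1 show ?thesis by (simp add: J_def K_def)
qed

text \<open>
  Finitely many vectors involve finitely many components, and every component is a basis vector.
\<close>

lemma finite_dim_imp_finite_components:
  assumes "pointwise_finite_dim (H0_module X :: ('f::field, 'a::topological_space set \<Rightarrow>\<^sub>0 'f) pers_module)"
  shows "finite (components (X t))"
proof -
  interpret vector_space "H0_scale :: 'f::field \<Rightarrow> ('a set \<Rightarrow>\<^sub>0 'f) \<Rightarrow> _"
    by (rule vector_space_H0_scale)
  obtain S :: "('a set \<Rightarrow>\<^sub>0 'f) set" where S: "finite S" "span S = H0_space (X t)"
    using assms unfolding pointwise_finite_dim_def H0_module_simps by blast
  define U where "U = (\<Union>p\<in>S. Poly_Mapping.keys p)"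
  have "span S \<subseteq> {p. Poly_Mapping.keys p \<subseteq> U}"
  proof (rule span_minimal)
    show "S \<subseteq> {p. Poly_Mapping.keys p \<subseteq> U}" by (auto simp: U_def)
    show "subspace {p. Poly_Mapping.keys p \<subseteq> U}"
      unfolding subspace_def
    proof (intro conjI ballI allI)
      fix p q :: "'a set \<Rightarrow>\<^sub>0 'f" and c :: 'f
      assume "p \<in> {p. Poly_Mapping.keys p \<subseteq> U}" "q \<in> {p. Poly_Mapping.keys p \<subseteq> U}"
      then show "p + q \<in> {p. Poly_Mapping.keys p \<subseteq> U}"
        using Poly_Mapping.keys_add[of p q] by blast
    next
      fix p :: "'a set \<Rightarrow>\<^sub>0 'f" and c :: 'f assume "p \<in> {p. Poly_Mapping.keys p \<subseteq> U}"
      then show "H0_scale c p \<in> {p. Poly_Mapping.keys p \<subseteq> U}"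
        by (auto simp: in_keys_iff lookup_H0_scale subset_iff)
    qed simp
  qed
  then have "components (X t) \<subseteq> U"
    using S(2) single_in_H0_space[of _ "X t" "1::'f"] by fastforce
  moreover have "finite U" using S(1) by (simp add: U_def)
  ultimately show ?thesis by (rule finite_subset)
qed

section \<open>The diagrams of a star-shaped plane set\<close>

text \<open>
  The rank formula on the side of bars, by inclusion and exclusion.
\<close>

lemma card_interval_corner:
  fixes S :: "'j set" and A :: "'j \<Rightarrow> real set"
  assumes int: "\<And>j. j \<in> S \<Longrightarrow> is_interval (A j)"
    and ord: "a1 \<le> a2" "a2 \<le> b1" "b1 \<le> b2"
    and fin: "finite {j \<in> S. a2 \<in> A j \<and> b1 \<in> A j}"
  shows "int (card {j \<in> S. a1 \<notin> A j \<and> a2 \<in> A j \<and> b1 \<in> A j \<and> b2 \<notin> A j}) =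
     int (card {j \<in> S. a2 \<in> A j \<and> b1 \<in> A j}) - card {j \<in> S. a1 \<in> A j \<and> b1 \<in> A j}
     - card {j \<in> S. a2 \<in> A j \<and> b2 \<in> A j} + card {j \<in> S. a1 \<in> A j \<and> b2 \<in> A j}"
proof -
  let ?P = "{j \<in> S. a2 \<in> A j \<and> b1 \<in> A j}" and ?Q = "{j \<in> S. a1 \<in> A j \<and> b1 \<in> A j}"
    and ?R = "{j \<in> S. a2 \<in> A j \<and> b2 \<in> A j}" and ?T = "{j \<in> S. a1 \<in> A j \<and> b2 \<in> A j}"
  have btw: "x \<in> A j" if "j \<in> S" "p \<in> A j" "q \<in> A j" "p \<le> x" "x \<le> q" for j x p q
    using int[OF that(1)] that unfolding is_interval_1 by blast
  have 1: "?Q \<subseteq> ?P" "?R \<subseteq> ?P"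
    using btw[of _ a1 b1 a2] btw[of _ a2 b2 b1] ord by blast+
  have "?Q \<inter> ?R = ?T"
  proof
    show "?T \<subseteq> ?Q \<inter> ?R"
      using btw[of _ a1 b2 a2] btw[of _ a1 b2 b1] order_trans[OF ord(1,2)] order_trans[OF ord(2,3)] ord
      by blast
  qed blast
  note 1 = 1 this
  have 2: "{j \<in> S. a1 \<notin> A j \<and> a2 \<in> A j \<and> b1 \<in> A j \<and> b2 \<notin> A j} = ?P - (?Q \<union> ?R)" by auto
  have finQR: "finite ?Q" "finite ?R" using fin 1 finite_subset by blast+
  have "card (?P - (?Q \<union> ?R)) = card ?P - card (?Q \<union> ?R)"
    using 1 finQR by (intro card_Diff_subset) auto
  moreover have "card (?Q \<union> ?R) \<le> card ?P" using 1 fin by (intro card_mono) auto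
  moreover have "card (?Q \<union> ?R) + card ?T = card ?Q + card ?R"
    using card_Un_Int[OF finQR] 1(3) by simp
  ultimately show ?thesis unfolding 2 by linarith
qed

lemma ereal_Sup_bdd:
  assumes "A \<noteq> {}" "bdd_above A" shows "ereal (Sup A) = Sup (ereal ` A)"
proof (rule ereal_Sup)
  obtain a where a: "a \<in> A" using assms by blast
  obtain b where b: "\<And>x. x \<in> A \<Longrightarrow> x \<le> b" using assms by (auto simp: bdd_above_def)
  have "ereal a \<le> Sup (ereal ` A)" using a by (intro Sup_upper) auto
  moreover have "Sup (ereal ` A) \<le> ereal b" using b by (intro Sup_least) auto
  ultimately show "\<bar>Sup (ereal ` A)\<bar> \<noteq> \<infinity>" by auto
qed

text \<open>
  The bound \<open>R\<close> turns closeness of directions into closeness of heights. The type argument \<open>F\<close> fixes the field of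
  coefficients, which no other parameter mentions.
\<close>

locale plane_star =
  fixes M :: "(real^2) set" and c :: "real^2" and R :: real and F :: "'f::field itself"
  assumes center: "c \<in> M"
    and star: "x \<in> M \<Longrightarrow> closed_segment c x \<subseteq> M"
    and bounded: "x \<in> M \<Longrightarrow> norm x \<le> R"
    and finite_comps: "v \<in> sphere 0 1 \<Longrightarrow> finite (components (sublevel M v t))"
    and simple: "simple_PD0 TYPE('f) M"
begin

lemma sublevel_mono: "s \<le> t \<Longrightarrow> sublevel M v s \<subseteq> sublevel M v t"
  by (auto simp: sublevel_def)

lemma abs_height_le: "x \<in> M \<Longrightarrow> norm v = 1 \<Longrightarrow> \<bar>x \<bullet> v\<bar> \<le> R"
  using Cauchy_Schwarz_ineq2[of x v] bounded[of x] by simp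

lemma finite_filtration_sublevel:
  assumes "v \<in> sphere 0 1" shows "finite_filtration (sublevel M v) (- R)"
proof
  show "sublevel M v s \<subseteq> sublevel M v t" if "s \<le> t" for s t by (rule sublevel_mono[OF that])
  show "finite (components (sublevel M v t))" for t by (rule finite_comps[OF assms])
  show "sublevel M v t = {}" if "t < - R" for t
    using abs_height_le[of _ v] assms that by (force simp: sublevel_def abs_le_iff)
qed

definition bars :: "real^2 \<Rightarrow> (real set \<times> nat) set" where
  "bars v = copies (barcode (PH0 M v :: ('f, (real^2) set \<Rightarrow>\<^sub>0 'f) pers_module))"

lemma bars:
  assumes v: "v \<in> sphere 0 1"
  shows "j \<in> bars v \<Longrightarrow> is_interval (fst j)" "j \<in> bars v \<Longrightarrow> fst j \<noteq> {}"
    and "s \<le> t \<Longrightarrow> finite {j \<in> bars v. s \<in> fst j \<and> t \<in> fst j}"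
    and "s \<le> t \<Longrightarrow> card {j \<in> bars v. s \<in> fst j \<and> t \<in> fst j} =
      card (comps_meeting (sublevel M v s) (sublevel M v t))"
proof -
  interpret finite_filtration "sublevel M v" "- R" by (rule finite_filtration_sublevel[OF v])
  have dec: "interval_decomposition (H0_module (sublevel M v) :: ('f, (real^2) set \<Rightarrow>\<^sub>0 'f) pers_module)
      (barcode (H0_module (sublevel M v) :: ('f, (real^2) set \<Rightarrow>\<^sub>0 'f) pers_module))"
    unfolding barcode_def by (rule someI_ex[OF H0_interval_decomposition])
  show "j \<in> bars v \<Longrightarrow> is_interval (fst j)" "j \<in> bars v \<Longrightarrow> fst j \<noteq> {}"
    using dec by (auto simp: bars_def PH0_eq_H0_module interval_decomposition_def copies_def)
  show "s \<le> t \<Longrightarrow> finite {j \<in> bars v. s \<in> fst j \<and> t \<in> fst j}"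
    "s \<le> t \<Longrightarrow> card {j \<in> bars v. s \<in> fst j \<and> t \<in> fst j} =
      card (comps_meeting (sublevel M v s) (sublevel M v t))"
    using card_bars_through[OF mono finite_comps dec] by (auto simp: bars_def PH0_eq_H0_module)
qed

lemma bar_betw:
  assumes "v \<in> sphere 0 1" "j \<in> bars v" "p \<in> fst j" "q \<in> fst j" "p \<le> x" "x \<le> q"
  shows "x \<in> fst j"
  using bars(1)[OF assms(1,2)] assms unfolding is_interval_1 by blast

lemma connected_sublevel:
  assumes "c \<bullet> v \<le> t" shows "connected (sublevel M v t)"
proof (rule starlike_imp_connected)
  have "closed_segment c x \<subseteq> sublevel M v t" if "x \<in> sublevel M v t" for x
  proof
    fix y assume y: "y \<in> closed_segment c x"
    have "convex {z. z \<bullet> v \<le> t}" using convex_halfspace_le[of v t] by (simp add: inner_commute)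
    then have "closed_segment c x \<subseteq> {z. z \<bullet> v \<le> t}"
      using assms that by (intro closed_segment_subset) (auto simp: sublevel_def)
    then show "y \<in> sublevel M v t" using star[of x] that y by (auto simp: sublevel_def)
  qed
  then show "starlike (sublevel M v t)"
    unfolding starlike_def using center assms by (auto simp: sublevel_def intro!: bexI[of _ c])
qed

lemma card_comps_meeting_above:
  assumes "c \<bullet> v \<le> t" "s \<le> t"
  shows "card (comps_meeting (sublevel M v s) (sublevel M v t)) =
    (if sublevel M v s = {} then 0 else 1)"
proof -
  have "sublevel M v t \<noteq> {}" using assms center by (auto simp: sublevel_def)
  then have "components (sublevel M v t) = {sublevel M v t}"
    using connected_sublevel[OF assms(1)] by (simp add: components_eq_sing_iff)
  then have "comps_meeting (sublevel M v s) (sublevel M v t) =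
      (if sublevel M v s = {} then {} else {sublevel M v t})"
    using sublevel_mono[OF assms(2), of v] by (auto simp: comps_meeting_def)
  then show ?thesis by simp
qed

text \<open>
  All sublevel sets above the height of the center are connected, so exactly one bar contains that height. It
  is the only infinite bar.
\<close>

definition essential :: "real^2 \<Rightarrow> real set \<times> nat" where
  "essential v = (THE j. j \<in> bars v \<and> c \<bullet> v \<in> fst j)"

lemma ex1_essential:
  assumes "v \<in> sphere 0 1" shows "\<exists>!j. j \<in> bars v \<and> c \<bullet> v \<in> fst j"
proof -
  have "sublevel M v (c \<bullet> v) \<noteq> {}" using center by (auto simp: sublevel_def)
  then have "card {j \<in> bars v. c \<bullet> v \<in> fst j} = 1"
    using bars(4)[OF assms, of "c \<bullet> v" "c \<bullet> v"] card_comps_meeting_above[of v "c \<bullet> v" "c \<bullet> v"] by simp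
  then obtain j where "{j \<in> bars v. c \<bullet> v \<in> fst j} = {j}" by (auto simp: card_1_singleton_iff)
  then have "i \<in> bars v \<and> c \<bullet> v \<in> fst i \<longleftrightarrow> i = j" for i
    by (metis (mono_tags, lifting) mem_Collect_eq singleton_iff)
  then show ?thesis by simp
qed

lemma essential:
  assumes "v \<in> sphere 0 1"
  shows "essential v \<in> bars v" "c \<bullet> v \<in> fst (essential v)"
    and "j \<in> bars v \<Longrightarrow> c \<bullet> v \<in> fst j \<Longrightarrow> j = essential v"
  using theI'[OF ex1_essential[OF assms]] ex1_essential[OF assms] unfolding essential_def by blast+

lemma bar_nonempty_sublevel:
  assumes "v \<in> sphere 0 1" "j \<in> bars v" "t \<in> fst j" shows "sublevel M v t \<noteq> {}"
proof
  assume "sublevel M v t = {}"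
  then have "card {j \<in> bars v. t \<in> fst j \<and> t \<in> fst j} = 0"
    using bars(4)[OF assms(1), of t t] by (simp add: comps_meeting_def)
  then have "{j \<in> bars v. t \<in> fst j \<and> t \<in> fst j} = {}"
    using bars(3)[OF assms(1), of t t] by (simp only: card_eq_0_iff) simp
  then show False using assms(2,3) by blast
qed

lemma mem_essential:
  assumes v: "v \<in> sphere 0 1" shows "t \<in> fst (essential v) \<longleftrightarrow> sublevel M v t \<noteq> {}"
proof
  assume "t \<in> fst (essential v)"
  then show "sublevel M v t \<noteq> {}" using bar_nonempty_sublevel essential(1) v by blast
next
  assume ne: "sublevel M v t \<noteq> {}"
  define a b where "a = min t (c \<bullet> v)" and "b = max t (c \<bullet> v)"
  have "sublevel M v a \<noteq> {}" using ne center by (auto simp: a_def min_def sublevel_def)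
  then have "card {j \<in> bars v. a \<in> fst j \<and> b \<in> fst j} = 1"
    using bars(4)[OF v, of a b] card_comps_meeting_above[of v b a] by (simp add: a_def b_def)
  then obtain j where "j \<in> bars v" "a \<in> fst j" "b \<in> fst j" by (auto simp: card_1_singleton_iff)
  then have "j \<in> bars v" "c \<bullet> v \<in> fst j" "t \<in> fst j" by (auto simp: a_def b_def min_def max_def split: if_splits)
  then show "t \<in> fst (essential v)" using essential(3)[OF v] by blast
qed

lemma nonessential_below:
  assumes v: "v \<in> sphere 0 1" and j: "j \<in> bars v" "j \<noteq> essential v" "t \<in> fst j"
  shows "t < c \<bullet> v"
proof (rule ccontr)
  assume "\<not> t < c \<bullet> v"
  then have "card {j \<in> bars v. t \<in> fst j} = 1"
    using bars(4)[OF v, of t t] card_comps_meeting_above[of v t t] bar_nonempty_sublevel[OF v j(1,3)] by simp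
  then obtain k where k: "{j \<in> bars v. t \<in> fst j} = {k}" by (auto simp: card_1_singleton_iff)
  have "t \<in> fst (essential v)" using mem_essential[OF v] bar_nonempty_sublevel[OF v j(1,3)] by simp
  then have "essential v \<in> {k}" "j \<in> {k}" using k j essential(1)[OF v] by blast+
  then show False using j(2) by simp
qed

definition lowest :: "real^2 \<Rightarrow> real" where
  "lowest v = Inf ((\<lambda>x. x \<bullet> v) ` M)"

lemma bdd_below_heights: "norm v = 1 \<Longrightarrow> bdd_below ((\<lambda>x. x \<bullet> v) ` M)"
  using abs_height_le[of _ v] by (intro bdd_belowI2[of _ "- R"]) (simp add: abs_le_iff minus_le_iff)

lemma lowest_le: "norm v = 1 \<Longrightarrow> x \<in> M \<Longrightarrow> lowest v \<le> x \<bullet> v"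
  unfolding lowest_def using bdd_below_heights by (auto intro: cInf_lower)

lemma essential_ends:
  assumes v: "v \<in> sphere 0 1"
  shows "Inf (ereal ` fst (essential v)) = ereal (lowest v)" "Sup (ereal ` fst (essential v)) = \<infinity>"
proof -
  have nv: "norm v = 1" using v by simp
  have mem: "t \<in> fst (essential v) \<longleftrightarrow> (\<exists>x\<in>M. x \<bullet> v \<le> t)" for t
    using mem_essential[OF v] by (auto simp: sublevel_def)
  have "Inf (fst (essential v)) = lowest v"
  proof (rule cInf_eq_non_empty)
    show "fst (essential v) \<noteq> {}" using essential(2)[OF v] by blast
    show "lowest v \<le> t" if "t \<in> fst (essential v)" for t
      using that lowest_le[OF nv] unfolding mem by force
    show "y \<le> lowest v" if "\<And>t. t \<in> fst (essential v) \<Longrightarrow> y \<le> t" for y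
      unfolding lowest_def using center that mem by (intro cINF_greatest) auto
  qed
  moreover have "bdd_below (fst (essential v))"
    using lowest_le[OF nv] unfolding mem by (intro bdd_belowI[of _ "lowest v"]) (force simp: mem)
  ultimately show "Inf (ereal ` fst (essential v)) = ereal (lowest v)"
    using ereal_Inf'[of "fst (essential v)"] essential(2)[OF v] by force
  show "Sup (ereal ` fst (essential v)) = \<infinity>"
  proof (rule ereal_top)
    fix B :: real
    have "max B (c \<bullet> v) \<in> fst (essential v)" 
      unfolding mem using center by (intro bexI[of _ c]) auto
    then have "ereal (max B (c \<bullet> v)) \<le> Sup (ereal ` fst (essential v))"
      by (intro Sup_upper imageI)
    then show "ereal B \<le> Sup (ereal ` fst (essential v))" by (rule order_trans[rotated]) simp
  qed
qed

definition pt_of_bar :: "real set \<times> nat \<Rightarrow> real \<times> real" where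
  "pt_of_bar j = (Inf (fst j), Sup (fst j))"

lemma nonessential_bdd:
  assumes v: "v \<in> sphere 0 1" and j: "j \<in> bars v" "j \<noteq> essential v"
  shows "bdd_below (fst j)" "bdd_above (fst j)" "fst j \<noteq> {}"
proof -
  show "bdd_above (fst j)"
    using nonessential_below[OF v j] by (intro bdd_aboveI[of _ "c \<bullet> v"]) (auto intro: less_imp_le)
  show "bdd_below (fst j)"
  proof (rule bdd_belowI[of _ "lowest v"])
    fix t assume "t \<in> fst j"
    then obtain x where "x \<in> M" "x \<bullet> v \<le> t"
      using bar_nonempty_sublevel[OF v j(1)] by (auto simp: sublevel_def)
    then show "lowest v \<le> t" using lowest_le[of v x] v by auto
  qed
  show "fst j \<noteq> {}" by (rule bars(2)[OF v j(1)])
qed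

lemma nonessential_ends:
  assumes v: "v \<in> sphere 0 1" and j: "j \<in> bars v" "j \<noteq> essential v"
  shows "Inf (ereal ` fst j) = ereal (fst (pt_of_bar j))" "Sup (ereal ` fst j) = ereal (snd (pt_of_bar j))"
  using ereal_Inf'[of "fst j"] ereal_Sup_bdd[of "fst j"] nonessential_bdd[OF assms]
  by (auto simp: pt_of_bar_def)

text \<open>
  The finite points of the diagram; only the essential bar gives a point outside this set.
\<close>

definition pts :: "real^2 \<Rightarrow> (real \<times> real) set" where
  "pts v = {(a, b). 0 < PD0 TYPE('f) M v (Pt (ereal a) (ereal b))}"

lemma PD0_Pt: "PD0 TYPE('f) M v (Pt a b) =
    card {j \<in> bars v. Inf (ereal ` fst j) = a \<and> Sup (ereal ` fst j) = b}"
proof -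
  have "{(A, k) \<in> S. P A} = {j \<in> S. P (fst j)}" for S :: "(real set \<times> nat) set" and P
    by auto
  then show ?thesis by (simp add: PD0_def diagram_of_module_def bars_def)
qed

lemma PD0_Diagonal: "PD0 TYPE('f) M v Diagonal = 1"
  by (simp add: PD0_def diagram_of_module_def)

lemma finite_pts: "v \<in> sphere 0 1 \<Longrightarrow> finite (pts v)"
proof -
  assume "v \<in> sphere 0 1"
  then have "finite {x. x \<noteq> Diagonal \<and> 0 < PD0 TYPE('f) M v x}"
    using simple by (simp add: simple_PD0_def)
  moreover have "(\<lambda>(a, b). Pt (ereal a) (ereal b)) ` pts v \<subseteq> {x. x \<noteq> Diagonal \<and> 0 < PD0 TYPE('f) M v x}"
    by (auto simp: pts_def)
  moreover have "inj_on (\<lambda>(a, b). Pt (ereal a) (ereal b)) (pts v)" by (auto intro!: inj_onI)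
  ultimately show ?thesis using finite_subset finite_imageD by blast
qed

text \<open>
  Bars with the same ends share their midpoint, and only finitely many bars contain a given level. This
  excludes that the cardinality in the definition of the diagram vanishes because the set of bars is infinite.
\<close>

lemma finite_bars_same_ends:
  assumes v: "v \<in> sphere 0 1" and j: "j0 \<in> bars v" "j0 \<noteq> essential v"
  shows "finite {j \<in> bars v. j \<noteq> essential v \<and> pt_of_bar j = pt_of_bar j0}"
proof -
  define a b where "a = Inf (fst j0)" and "b = Sup (fst j0)"
  define t where "t = (a + b) / 2"
  have "t \<in> fst j" if jj: "j \<in> bars v" "j \<noteq> essential v" "pt_of_bar j = pt_of_bar j0" for j
  proof -
    note bd = nonessential_bdd[OF v jj(1,2)]
    have ab: "Inf (fst j) = a" "Sup (fst j) = b" using jj(3) by (auto simp: pt_of_bar_def a_def b_def)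
    obtain y where y: "y \<in> fst j" using bd by blast
    have "a \<le> y" "y \<le> b" using bd y ab cInf_lower cSup_upper by blast+
    show "t \<in> fst j"
    proof (cases "a = b")
      case True then show ?thesis using y \<open>a \<le> y\<close> \<open>y \<le> b\<close> by (simp add: t_def)
    next
      case False
      then have "a < t" "t < b" using \<open>a \<le> y\<close> \<open>y \<le> b\<close> by (auto simp: t_def)
      then obtain p q where "p \<in> fst j" "p < t" "q \<in> fst j" "t < q"
        using ab bd cInf_lessD[of "fst j" t] less_cSupD[of "fst j" t] by auto
      then show ?thesis using bar_betw[OF v jj(1)] by (meson less_imp_le)
    qed
  qed
  then show ?thesis using bars(3)[OF v, of t t] by (auto elim!: finite_subset[rotated])
qed

lemma PD0_Pt_real:
  assumes v: "v \<in> sphere 0 1"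
  shows "PD0 TYPE('f) M v (Pt (ereal a) (ereal b)) =
    card {j \<in> bars v. j \<noteq> essential v \<and> pt_of_bar j = (a, b)}"
proof -
  have "Inf (ereal ` fst j) = ereal a \<and> Sup (ereal ` fst j) = ereal b \<longleftrightarrow>
      j \<noteq> essential v \<and> pt_of_bar j = (a, b)" if "j \<in> bars v" for j
  proof (cases "j = essential v")
    case True then show ?thesis using essential_ends[OF v] by simp
  next
    case False then show ?thesis using nonessential_ends[OF v that] by (simp add: prod_eq_iff)
  qed
  then have "{j \<in> bars v. Inf (ereal ` fst j) = ereal a \<and> Sup (ereal ` fst j) = ereal b} =
      {j \<in> bars v. j \<noteq> essential v \<and> pt_of_bar j = (a, b)}"
    by blast
  then show ?thesis by (simp add: PD0_Pt)
qed

text \<open>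
  Simplicity of the diagram means that a finite bar is determined by its two ends.
\<close>

lemma bij_pts:
  assumes v: "v \<in> sphere 0 1" shows "bij_betw pt_of_bar (bars v - {essential v}) (pts v)"
  unfolding bij_betw_def
proof
  have pos: "pt_of_bar j \<in> pts v" if "j \<in> bars v" "j \<noteq> essential v" for j
  proof -
    have "{k \<in> bars v. k \<noteq> essential v \<and> pt_of_bar k = pt_of_bar j} \<noteq> {}" using that by blast
    then have "0 < card {k \<in> bars v. k \<noteq> essential v \<and> pt_of_bar k = pt_of_bar j}"
      using finite_bars_same_ends[OF v that] by (simp add: card_gt_0_iff)
    then show ?thesis unfolding pts_def using PD0_Pt_real[OF v] by (auto simp: pt_of_bar_def)
  qed
  show "inj_on pt_of_bar (bars v - {essential v})"
  proof
    fix j k assume jk: "j \<in> bars v - {essential v}" "k \<in> bars v - {essential v}" "pt_of_bar j = pt_of_bar k"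
    have "card {i \<in> bars v. i \<noteq> essential v \<and> pt_of_bar i = pt_of_bar k} \<le> 1"
      using simple v PD0_Pt_real[OF v, of "fst (pt_of_bar k)" "snd (pt_of_bar k)"]
      unfolding simple_PD0_def by (metis pd_elem.distinct(1) prod.collapse)
    then have "\<forall>i\<in>{i \<in> bars v. i \<noteq> essential v \<and> pt_of_bar i = pt_of_bar k}.
        \<forall>l\<in>{i \<in> bars v. i \<noteq> essential v \<and> pt_of_bar i = pt_of_bar k}. i = l"
      using finite_bars_same_ends[OF v, of k] jk by (subst card_le_Suc0_iff_eq[symmetric]) auto
    then show "j = k" using jk by blast
  qed
  show "pt_of_bar ` (bars v - {essential v}) = pts v"
  proof
    show "pts v \<subseteq> pt_of_bar ` (bars v - {essential v})"
    proof clarify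
      fix a b assume "(a, b) \<in> pts v"
      then have "card {j \<in> bars v. j \<noteq> essential v \<and> pt_of_bar j = (a, b)} \<noteq> 0"
        using PD0_Pt_real[OF v] by (simp add: pts_def)
      then have "{j \<in> bars v. j \<noteq> essential v \<and> pt_of_bar j = (a, b)} \<noteq> {}" by (metis card.empty)
      then obtain j where "j \<in> bars v" "j \<noteq> essential v" "pt_of_bar j = (a, b)" by blast
      then show "(a, b) \<in> pt_of_bar ` (bars v - {essential v})" by (metis DiffI image_eqI singletonD)
    qed
    show "pt_of_bar ` (bars v - {essential v}) \<subseteq> pts v" using pos by blast
  qed
qed

lemma pts_bounds:
  assumes v: "v \<in> sphere 0 1" and p: "(a, b) \<in> pts v"
  shows "a \<le> b" "b \<le> c \<bullet> v"
proof -
  have "(a, b) \<in> pt_of_bar ` (bars v - {essential v})"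
    using bij_pts[OF v] p by (simp add: bij_betw_def)
  then obtain j where j: "j \<in> bars v" "j \<noteq> essential v" "a = Inf (fst j)" "b = Sup (fst j)"
    by (auto simp: pt_of_bar_def)
  note bd = nonessential_bdd[OF v j(1,2)]
  show "a \<le> b" using bd j(3,4) by (simp add: cInf_le_cSup)
  show "b \<le> c \<bullet> v" unfolding j(4)
    using nonessential_below[OF v j(1,2)] bd by (intro cSup_least) (auto intro: less_imp_le)
qed

lemma PD0_cases:
  assumes v: "v \<in> sphere 0 1"
  shows "PD0 TYPE('f) M v (Pt a b) =
    (if (\<exists>x y. a = ereal x \<and> b = ereal y \<and> (x, y) \<in> pts v) \<or> (a = ereal (lowest v) \<and> b = \<infinity>) then 1 else 0)"
proof -
  have le: "PD0 TYPE('f) M v (Pt a b) \<le> 1" using simple v by (simp add: simple_PD0_def)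
  have fin_ess: "{j \<in> bars v. Inf (ereal ` fst j) = ereal (lowest v) \<and> Sup (ereal ` fst j) = \<infinity>} = {essential v}"
    using essential_ends[OF v] essential(1)[OF v] nonessential_ends[OF v] by force
  consider (ess) "a = ereal (lowest v)" "b = \<infinity>" | (pt) x y where "a = ereal x" "b = ereal y" "(x, y) \<in> pts v"
    | (none) "\<not> ((\<exists>x y. a = ereal x \<and> b = ereal y \<and> (x, y) \<in> pts v) \<or> (a = ereal (lowest v) \<and> b = \<infinity>))"
    by blast
  then show ?thesis
  proof cases
    case ess then show ?thesis using fin_ess by (simp add: PD0_Pt)
  next
    case pt then show ?thesis using le by (auto simp: pts_def)
  next
    case none
    have "{j \<in> bars v. Inf (ereal ` fst j) = a \<and> Sup (ereal ` fst j) = b} = {}"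
    proof (rule ccontr)
      assume "{j \<in> bars v. Inf (ereal ` fst j) = a \<and> Sup (ereal ` fst j) = b} \<noteq> {}"
      then obtain j where j: "j \<in> bars v" "Inf (ereal ` fst j) = a" "Sup (ereal ` fst j) = b" by blast
      show False
      proof (cases "j = essential v")
        case True then show ?thesis using none j essential_ends[OF v] by auto
      next
        case False
        then have "pt_of_bar j \<in> pts v" using bij_pts[OF v] j(1) by (auto simp: bij_betw_def)
        then show ?thesis using none j nonessential_ends[OF v j(1) False] by (metis prod.collapse)
      qed
    qed
    then show ?thesis using none by (simp only: PD0_Pt) simp
  qed
qed

lemma is_pdiagram_PD0: "v \<in> sphere 0 1 \<Longrightarrow> is_pdiagram (PD0 TYPE('f) M v)"
  unfolding is_pdiagram_def using PD0_cases[of v] by (auto simp: PD0_Diagonal split: if_splits)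

abbreviation box :: "real^2 \<Rightarrow> real \<Rightarrow> real \<Rightarrow> real \<Rightarrow> real \<Rightarrow> int" where
  "box v a1 a2 b1 b2 \<equiv>
     box_count (sublevel M v a1) (sublevel M v a2) (sublevel M v b1) (sublevel M v b2)"

text \<open>
  Whether the end of a bar belongs to the bar is invisible in the diagram. Therefore the number of bars counted by
  the box lies between the numbers of points in the open and in the closed box.
\<close>

lemma box_bounds:
  assumes v: "v \<in> sphere 0 1" and ord: "a1 < a2" "a2 \<le> b1" "b1 < b2"
  shows "int (card (pts v \<inter> {a1<..<a2} \<times> {b1<..<b2})) \<le> box v a1 a2 b1 b2"
    and "box v a1 a2 b1 b2 \<le> int (card (pts v \<inter> {a1..a2} \<times> {b1..b2}))"
proof -
  let ?S = "{j \<in> bars v. a1 \<notin> fst j \<and> a2 \<in> fst j \<and> b1 \<in> fst j \<and> b2 \<notin> fst j}"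
  have box: "int (card ?S) = box v a1 a2 b1 b2"
    using card_interval_corner[of "bars v" fst a1 a2 b1 b2] bars[OF v] ord
    by (simp add: box_count_def)
  have ness: "j \<noteq> essential v" if "j \<in> ?S" for j
    using that mem_essential[OF v] sublevel_mono[of b1 b2 v] ord by fastforce
  have im: "pt_of_bar ` ?S \<subseteq> pts v"
    using ness bij_pts[OF v] by (auto simp: bij_betw_def)
  have inj: "inj_on pt_of_bar ?S"
  proof (rule inj_on_subset)
    show "inj_on pt_of_bar (bars v - {essential v})" using bij_pts[OF v] by (simp add: bij_betw_def)
    show "?S \<subseteq> bars v - {essential v}" using ness by blast
  qed
  have "pt_of_bar ` ?S \<subseteq> pts v \<inter> {a1..a2} \<times> {b1..b2}"
  proof
    fix p assume "p \<in> pt_of_bar ` ?S"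
    then obtain j where j: "j \<in> ?S" "p = pt_of_bar j" by blast
    then have jj: "j \<in> bars v" "j \<noteq> essential v" using ness by auto
    note bd = nonessential_bdd[OF v jj]
    have "a1 \<le> t" if "t \<in> fst j" for t
      using bar_betw[OF v jj(1) that, of a2 a1] j ord by force
    moreover have "t \<le> b2" if "t \<in> fst j" for t
      using bar_betw[OF v jj(1), of b1 t b2] that j ord by force
    ultimately have "a1 \<le> Inf (fst j)" "Sup (fst j) \<le> b2" "Inf (fst j) \<le> a2" "b1 \<le> Sup (fst j)"
      using bd j by (auto intro: cInf_greatest cSup_least cInf_lower cSup_upper)
    then show "p \<in> pts v \<inter> {a1..a2} \<times> {b1..b2}" using j im by (auto simp: pt_of_bar_def)
  qed
  then have "card (pt_of_bar ` ?S) \<le> card (pts v \<inter> {a1..a2} \<times> {b1..b2})"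
    using finite_pts[OF v] by (intro card_mono) auto
  then show "box v a1 a2 b1 b2 \<le> int (card (pts v \<inter> {a1..a2} \<times> {b1..b2}))"
    using card_image[OF inj] box by simp
  have "pts v \<inter> {a1<..<a2} \<times> {b1<..<b2} \<subseteq> pt_of_bar ` ?S"
  proof
    fix p assume p: "p \<in> pts v \<inter> {a1<..<a2} \<times> {b1<..<b2}"
    then have "p \<in> pt_of_bar ` (bars v - {essential v})"
      using bij_pts[OF v] by (simp add: bij_betw_def)
    then obtain j where j: "j \<in> bars v" "j \<noteq> essential v" "p = pt_of_bar j" by blast
    note bd = nonessential_bdd[OF v j(1,2)]
    have ab: "a1 < Inf (fst j)" "Inf (fst j) < a2" "b1 < Sup (fst j)" "Sup (fst j) < b2"
      using p j by (auto simp: pt_of_bar_def)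
    obtain x y where xy: "x \<in> fst j" "x < a2" "y \<in> fst j" "b1 < y"
      using ab bd cInf_lessD[of "fst j" a2] less_cSupD[of "fst j" b1] by auto
    have "a2 \<in> fst j" "b1 \<in> fst j" using xy ord by (auto intro: bar_betw[OF v j(1), of x y])
    moreover have "a1 \<notin> fst j" using ab(1) bd cInf_lower[of a1 "fst j"] by auto
    moreover have "b2 \<notin> fst j" using ab(4) bd cSup_upper[of b2 "fst j"] by auto
    ultimately show "p \<in> pt_of_bar ` ?S" using j by auto
  qed
  moreover have "finite ?S" using bars(3)[OF v, of a2 b1] ord by (auto elim!: finite_subset[rotated])
  ultimately have "card (pts v \<inter> {a1<..<a2} \<times> {b1<..<b2}) \<le> card ?S"
    by (meson surj_card_le)
  then show "int (card (pts v \<inter> {a1<..<a2} \<times> {b1<..<b2})) \<le> box v a1 a2 b1 b2"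
    using box by simp
qed

end

section \<open>Stability of the diagrams\<close>

definition near :: "real \<Rightarrow> real \<times> real \<Rightarrow> real \<times> real \<Rightarrow> bool" where
  "near \<eta> x y \<longleftrightarrow> \<bar>fst x - fst y\<bar> \<le> \<eta> \<and> \<bar>snd x - snd y\<bar> \<le> \<eta>"

abbreviation len :: "real \<times> real \<Rightarrow> real" where "len x \<equiv> snd x - fst x"

lemma near_sym: "near \<eta> x y \<longleftrightarrow> near \<eta> y x"
  by (auto simp: near_def abs_minus_commute)

lemma near_trans: "near \<eta> x y \<Longrightarrow> near \<theta> y z \<Longrightarrow> near (\<eta> + \<theta>) x z"
  by (auto simp: near_def)

lemma near_mono: "near \<eta> x y \<Longrightarrow> \<eta> \<le> \<theta> \<Longrightarrow> near \<theta> x y"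
  by (auto simp: near_def)

lemma near_len: "near \<eta> x y \<Longrightarrow> len y \<ge> len x - 2 * \<eta>"
  by (auto simp: near_def)

context plane_star
begin

definition height_close :: "real \<Rightarrow> real^2 \<Rightarrow> real^2 \<Rightarrow> bool" where
  "height_close \<delta> v w \<longleftrightarrow> (\<forall>x\<in>M. \<bar>x \<bullet> v - x \<bullet> w\<bar> \<le> \<delta>)"

lemma height_close_sym: "height_close \<delta> v w \<longleftrightarrow> height_close \<delta> w v"
  by (auto simp: height_close_def abs_minus_commute)

lemma R_nonneg: "0 \<le> R"
  using bounded[OF center] norm_ge_zero[of c] by linarith

lemma height_close_dist: 
  assumes "dist v w \<le> \<delta> / (R + 1)" "0 \<le> \<delta>" shows "height_close \<delta> v w"
  unfolding height_close_def
proof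
  fix x assume x: "x \<in> M"
  have "\<bar>x \<bullet> v - x \<bullet> w\<bar> \<le> norm x * norm (v - w)"
    using Cauchy_Schwarz_ineq2[of x "v - w"] by (simp add: inner_diff_right)
  also have "\<dots> \<le> (R + 1) * (\<delta> / (R + 1))"
    using bounded[OF x] assms R_nonneg by (intro mult_mono) (auto simp: dist_norm)
  finally show "\<bar>x \<bullet> v - x \<bullet> w\<bar> \<le> \<delta>" using R_nonneg by simp
qed

lemma sublevel_shift:
  assumes "height_close \<delta> v w" "s + \<delta> \<le> t" shows "sublevel M v s \<subseteq> sublevel M w t"
proof
  fix x assume x: "x \<in> sublevel M v s"
  then have "\<bar>x \<bullet> v - x \<bullet> w\<bar> \<le> \<delta>" using assms(1) by (auto simp: height_close_def sublevel_def)
  then show "x \<in> sublevel M w t" using x assms(2) by (auto simp: sublevel_def)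
qed

lemma box_interleave:
  assumes v: "v \<in> sphere 0 1" and w: "w \<in> sphere 0 1" and cl: "height_close \<delta> v w" "0 \<le> \<delta>"
    and ord: "a1 \<le> a2" "a2 + \<delta> \<le> b1 - \<delta>" "b1 \<le> b2"
  shows "box v a1 a2 b1 b2 \<le> box w (a1 - \<delta>) (a2 + \<delta>) (b1 - \<delta>) (b2 + \<delta>)"
proof (rule box_count_mono)
  have cl': "height_close \<delta> w v" using cl height_close_sym by blast
  show "sublevel M w (a1 - \<delta>) \<subseteq> sublevel M v a1" by (rule sublevel_shift[OF cl']) simp
  show "sublevel M v a2 \<subseteq> sublevel M w (a2 + \<delta>)" by (rule sublevel_shift[OF cl(1)]) simp
  show "sublevel M w (b1 - \<delta>) \<subseteq> sublevel M v b1" by (rule sublevel_shift[OF cl']) simp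
  show "sublevel M v b2 \<subseteq> sublevel M w (b2 + \<delta>)" by (rule sublevel_shift[OF cl(1)]) simp
qed (use finite_comps v w ord in \<open>auto intro!: sublevel_mono\<close>)

text \<open>
  A point lies in a small open box, which has positive count; the enlarged box for the other direction has at
  least this count and so contains a point. The length keeps the two sides of the box apart.
\<close>

lemma pt_transfer:
  assumes v: "v \<in> sphere 0 1" and w: "w \<in> sphere 0 1" and cl: "height_close \<delta> v w" "0 \<le> \<delta>"
    and x: "x \<in> pts v" and \<eta>: "\<delta> < \<eta>" "2 * \<eta> \<le> len x"
  shows "\<exists>y\<in>pts w. near \<eta> x y"
proof -
  obtain a b where ab: "x = (a, b)" by force
  define e where "e = \<eta> - \<delta>"
  have e: "0 < e" using \<eta> by (simp add: e_def)
  have "x \<in> pts v \<inter> {a - e<..<a + e} \<times> {b - e<..<b + e}" using x e by (simp add: ab)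
  then have "1 \<le> card (pts v \<inter> {a - e<..<a + e} \<times> {b - e<..<b + e})"
    using finite_pts[OF v] by (simp add: Suc_le_eq card_gt_0_iff) blast
  also have "int \<dots> \<le> box v (a - e) (a + e) (b - e) (b + e)"
    using \<eta> e cl by (intro box_bounds(1)[OF v]) (auto simp: ab e_def)
  also have "\<dots> \<le> box w (a - e - \<delta>) (a + e + \<delta>) (b - e - \<delta>) (b + e + \<delta>)"
    using \<eta> e by (intro box_interleave[OF v w cl]) (auto simp: ab e_def)
  also have "\<dots> = box w (a - \<eta>) (a + \<eta>) (b - \<eta>) (b + \<eta>)"
    by (simp add: e_def)
  also have "\<dots> \<le> int (card (pts w \<inter> {a - \<eta>..a + \<eta>} \<times> {b - \<eta>..b + \<eta>}))"
    using \<eta> cl by (intro box_bounds(2)[OF w]) (auto simp: ab)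
  finally have "pts w \<inter> {a - \<eta>..a + \<eta>} \<times> {b - \<eta>..b + \<eta>} \<noteq> {}" by auto
  then show ?thesis by (force simp: near_def ab abs_le_iff)
qed

text \<open>
  The same argument with a box of count at least \<open>2\<close>.
\<close>

lemma two_pts_transfer:
  assumes v: "v \<in> sphere 0 1" and w: "w \<in> sphere 0 1" and cl: "height_close \<delta> v w" "0 \<le> \<delta>"
    and y: "y \<in> pts v" "y' \<in> pts v" "y \<noteq> y'" "near \<eta> x y" "near \<eta> x y'"
    and \<eta>: "\<eta> < \<theta>" "0 \<le> \<eta>" "2 * (\<theta> + \<delta>) \<le> len x"
  shows "\<exists>x'\<in>pts w. x' \<noteq> x \<and> near (\<theta> + \<delta>) x x'"
proof -
  obtain a b where ab: "x = (a, b)" by force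
  define \<kappa> where "\<kappa> = \<theta> + \<delta>"
  have "card {y, y'} \<le> card (pts v \<inter> {a - \<theta><..<a + \<theta>} \<times> {b - \<theta><..<b + \<theta>})"
    using y \<eta> finite_pts[OF v] by (intro card_mono) (auto simp: near_def ab abs_le_iff mem_Times_iff)
  then have "2 \<le> int (card (pts v \<inter> {a - \<theta><..<a + \<theta>} \<times> {b - \<theta><..<b + \<theta>}))" using y by simp
  also have "\<dots> \<le> box v (a - \<theta>) (a + \<theta>) (b - \<theta>) (b + \<theta>)"
    using \<eta> cl by (intro box_bounds(1)[OF v]) (auto simp: ab)
  also have "\<dots> \<le> box w (a - \<theta> - \<delta>) (a + \<theta> + \<delta>) (b - \<theta> - \<delta>) (b + \<theta> + \<delta>)"
    using \<eta> cl by (intro box_interleave[OF v w cl]) (auto simp: ab)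
  also have "\<dots> = box w (a - \<kappa>) (a + \<kappa>) (b - \<kappa>) (b + \<kappa>)"
    by (simp add: \<kappa>_def algebra_simps)
  also have "\<dots> \<le> int (card (pts w \<inter> {a - \<kappa>..a + \<kappa>} \<times> {b - \<kappa>..b + \<kappa>}))"
    using \<eta> cl by (intro box_bounds(2)[OF w]) (auto simp: ab \<kappa>_def)
  finally have "2 \<le> card (pts w \<inter> {a - \<kappa>..a + \<kappa>} \<times> {b - \<kappa>..b + \<kappa>})" by simp
  then have "\<not> pts w \<inter> {a - \<kappa>..a + \<kappa>} \<times> {b - \<kappa>..b + \<kappa>} \<subseteq> {x}"
    using card_mono[of "{x}" "pts w \<inter> {a - \<kappa>..a + \<kappa>} \<times> {b - \<kappa>..b + \<kappa>}"] by auto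
  then show ?thesis by (force simp: near_def ab abs_le_iff \<kappa>_def)
qed

definition pos :: "real^2 \<Rightarrow> (real \<times> real) set" where
  "pos v = {x \<in> pts v. 0 < len x}"

text \<open>
  The points of positive length are isolated, and long, on the scale \<open>\<eta>\<close>. The factor \<open>4\<close> exceeds the
  distance \<open>5 * \<eta> / 2\<close> by which a point can move when it is transferred to a nearby diagram and back, and the factor
  \<open>16\<close> keeps boxes of this size off the diagonal.
\<close>

definition good_radius :: "real^2 \<Rightarrow> real \<Rightarrow> bool" where
  "good_radius v \<eta> \<longleftrightarrow> 0 < \<eta> \<and>
     (\<forall>x\<in>pos v. 16 * \<eta> < len x \<and> (\<forall>x'\<in>pts v. x' \<noteq> x \<longrightarrow> \<not> near (4 * \<eta>) x x'))"

lemma good_radiusD: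
  assumes "good_radius v \<eta>"
  shows "0 < \<eta>" "x \<in> pos v \<Longrightarrow> 16 * \<eta> < len x"
    "x \<in> pos v \<Longrightarrow> x' \<in> pts v \<Longrightarrow> x' \<noteq> x \<Longrightarrow> \<not> near (4 * \<eta>) x x'"
  using assms unfolding good_radius_def by simp_all

lemma eventually_good_radius:
  assumes v: "v \<in> sphere 0 1"
  shows "eventually (good_radius v) (at_right 0)"
proof -
  have fin: "finite (pos v)" using finite_pts[OF v] by (simp add: pos_def)
  have 1: "\<forall>\<^sub>F \<eta> in at_right 0. 16 * \<eta> < len x" if "x \<in> pos v" for x
    unfolding eventually_at_right_field using that by (intro exI[of _ "len x / 16"]) (auto simp: pos_def)
  have 2: "\<forall>\<^sub>F \<eta> in at_right 0. x' \<noteq> x \<longrightarrow> \<not> near (4 * \<eta>) x x'" for x x'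
  proof (cases "x' = x")
    case False
    then have "0 < max \<bar>fst x - fst x'\<bar> \<bar>snd x - snd x'\<bar>" by (auto simp: less_max_iff_disj prod_eq_iff)
    then show ?thesis
      unfolding eventually_at_right_field
      by (intro exI[of _ "max \<bar>fst x - fst x'\<bar> \<bar>snd x - snd x'\<bar> / 4"]) (auto simp: near_def)
  qed simp
  have "\<forall>\<^sub>F \<eta> in at_right 0. \<forall>x\<in>pos v. 16 * \<eta> < len x \<and> (\<forall>x'\<in>pts v. x' \<noteq> x \<longrightarrow> \<not> near (4 * \<eta>) x x')"
    using fin finite_pts[OF v] 1 2 by (intro eventually_ball_finite ballI eventually_conj) auto
  moreover have "\<forall>\<^sub>F \<eta> in at_right (0::real). 0 < \<eta>" by (simp add: eventually_at_right_less)
  ultimately show ?thesis unfolding good_radius_def by eventually_elim blast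
qed

lemma good_radius_exists:
  assumes "v \<in> sphere 0 1" "0 < \<epsilon>" shows "\<exists>\<eta>. good_radius v \<eta> \<and> \<eta> < \<epsilon>"
proof -
  have "\<forall>\<^sub>F \<eta> in at_right 0. good_radius v \<eta> \<and> \<eta> < \<epsilon>"
    using eventually_good_radius[OF assms(1)] assms(2)
    by (intro eventually_conj) (auto simp: eventually_at_right_field)
  then show ?thesis by (rule eventually_happens'[rotated]) simp
qed

text \<open>
  One neighbour exists by transfer. Two neighbours would transfer back to a second point near \<open>x\<close>.
\<close>

lemma unique_near:
  assumes v: "v \<in> sphere 0 1" and w: "w \<in> sphere 0 1" and g: "good_radius v \<eta>"
    and cl: "height_close (\<eta> / 2) v w" and x: "x \<in> pos v"
  shows "\<exists>!y. y \<in> pos w \<and> near \<eta> x y"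
    and "y \<in> pts w \<Longrightarrow> near \<eta> x y \<Longrightarrow> y \<in> pos w"
proof -
  have \<eta>: "0 < \<eta>" "16 * \<eta> < len x" using g x by (auto simp: good_radius_def)
  have in_pos: "y \<in> pos w" if "y \<in> pts w" "near \<eta> x y" for y
    using near_len[OF that(2)] \<eta> that(1) by (simp add: pos_def)
  then show "y \<in> pts w \<Longrightarrow> near \<eta> x y \<Longrightarrow> y \<in> pos w" by blast
  have "\<exists>y\<in>pts w. near \<eta> x y"
    using x \<eta> by (intro pt_transfer[OF v w cl]) (auto simp: pos_def)
  moreover have "y = y'" if y: "y \<in> pts w" "near \<eta> x y" "y' \<in> pts w" "near \<eta> x y'" for y y'
  proof (rule ccontr)
    assume "y \<noteq> y'"
    then obtain x' where x': "x' \<in> pts v" "x' \<noteq> x" "near (2 * \<eta> + \<eta> / 2) x x'"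
      using two_pts_transfer[OF w v, of "\<eta> / 2" y y' \<eta> x "2 * \<eta>"] y \<eta> cl height_close_sym by auto
    have "near (4 * \<eta>) x x'" by (rule near_mono[OF x'(3)]) (use \<eta> in simp)
    then show False using good_radiusD(3)[OF g x] x' by blast
  qed
  ultimately show "\<exists>!y. y \<in> pos w \<and> near \<eta> x y" using in_pos by (auto simp: pos_def)
qed

lemma long_near_pos:
  assumes v: "v \<in> sphere 0 1" and w: "w \<in> sphere 0 1" and \<eta>: "0 < \<eta>"
    and cl: "height_close (\<eta> / 2) v w" and y: "y \<in> pts w" "4 * \<eta> < len y"
  shows "\<exists>x\<in>pos v. near \<eta> x y"
proof -
  obtain x where x: "x \<in> pts v" "near \<eta> y x"
    using pt_transfer[OF w v, of "\<eta> / 2" y \<eta>] cl height_close_sym y \<eta> by auto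
  then have "x \<in> pos v" using near_len[OF x(2)] y \<eta> by (simp add: pos_def)
  then show ?thesis using x near_sym by blast
qed

lemma lowest_close:
  assumes "v \<in> sphere 0 1" "w \<in> sphere 0 1" and cl: "height_close \<delta> v w"
  shows "\<bar>lowest v - lowest w\<bar> \<le> \<delta>"
proof -
  have "lowest v - \<delta> \<le> lowest w" if "norm v = 1" and cl: "height_close \<delta> v w" for v w
    unfolding lowest_def[of w]
  proof (rule cINF_greatest)
    fix x assume x: "x \<in> M"
    show "lowest v - \<delta> \<le> x \<bullet> w"
      using lowest_le[OF that(1) x] cl x by (force simp: height_close_def abs_le_iff)
  qed (use center in auto)
  from this[of v w] this[of w v] show ?thesis
    using assms height_close_sym by (auto simp: abs_le_iff)
qed

definition of_pair :: "real \<times> real \<Rightarrow> pd_elem" where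
  "of_pair x = Pt (ereal (fst x)) (ereal (snd x))"

lemma of_pair_inject [simp]: "of_pair x = of_pair y \<longleftrightarrow> x = y"
  and of_pair_neq [simp]: "of_pair x \<noteq> Diagonal" "Diagonal \<noteq> of_pair x" "of_pair x \<noteq> Pt a \<infinity>" "Pt a \<infinity> \<noteq> of_pair x"
  by (simp_all add: of_pair_def prod_eq_iff)

lemma of_pair_eqs:
  "(of_pair x = of_pair y) = (x = y)" "(of_pair x = Diagonal) = False" "(Diagonal = of_pair x) = False"
  "(of_pair x = Pt a \<infinity>) = False" "(Pt a \<infinity> = of_pair x) = False"
  by simp_all

lemma pd_dist_of_pair:
  "pd_dist (of_pair x) (of_pair y) = ennreal (max \<bar>fst x - fst y\<bar> \<bar>snd x - snd y\<bar>)"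
  "pd_dist (of_pair x) Diagonal = ennreal (len x / 2)"
  "pd_dist Diagonal (of_pair x) = ennreal (len x / 2)"
  by (simp_all add: of_pair_def)

lemma pd_dist_essential: "pd_dist (Pt (ereal a) \<infinity>) (Pt (ereal b) \<infinity>) = ennreal \<bar>a - b\<bar>"
  by (simp only: infinity_ereal_def pd_dist.simps)

lemma PD0_pos_iff:
  assumes v: "v \<in> sphere 0 1"
  shows "0 < PD0 TYPE('f) M v u \<longleftrightarrow>
    u = Diagonal \<or> u = Pt (ereal (lowest v)) \<infinity> \<or> (\<exists>x\<in>pts v. u = of_pair x)"
    and "PD0 TYPE('f) M v u \<le> 1"
proof -
  have "(0 < PD0 TYPE('f) M v u \<longleftrightarrow>
      u = Diagonal \<or> u = Pt (ereal (lowest v)) \<infinity> \<or> (\<exists>x\<in>pts v. u = of_pair x)) \<and>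
      PD0 TYPE('f) M v u \<le> 1"
  proof (cases u)
    case (Pt a b)
    have "(\<exists>x y. a = ereal x \<and> b = ereal y \<and> (x, y) \<in> pts v) \<longleftrightarrow> (\<exists>x\<in>pts v. u = of_pair x)"
      unfolding Pt of_pair_def by force
    then show ?thesis unfolding Pt using PD0_cases[OF v, of a b] by simp
  qed (simp add: PD0_Diagonal)
  then show "0 < PD0 TYPE('f) M v u \<longleftrightarrow>
    u = Diagonal \<or> u = Pt (ereal (lowest v)) \<infinity> \<or> (\<exists>x\<in>pts v. u = of_pair x)"
    "PD0 TYPE('f) M v u \<le> 1" by blast+
qed

lemma copies_PD0:
  assumes v: "v \<in> sphere 0 1"
  shows "(u, k) \<in> copies (PD0 TYPE('f) M v) \<longleftrightarrow> k = 0 \<and>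
    (u = Diagonal \<or> u = Pt (ereal (lowest v)) \<infinity> \<or> (\<exists>x\<in>pts v. u = of_pair x))"
proof -
  have "(u, k) \<in> copies (PD0 TYPE('f) M v) \<longleftrightarrow> k = 0 \<and> 0 < PD0 TYPE('f) M v u"
    using PD0_pos_iff(2)[OF v, of u] by (auto simp: copies_def)
  then show ?thesis using PD0_pos_iff(1)[OF v, of u] by simp
qed

text \<open>
  The matching pairs the infinite points, pairs each point of positive length with its unique neighbour, and sends the
  rest, which is short on the scale \<open>\<eta>\<close>, to the diagonal.
\<close>

lemma bottleneck_close:
  assumes v: "v \<in> sphere 0 1" and w: "w \<in> sphere 0 1" and g: "good_radius v \<eta>"
    and cl: "height_close (\<eta> / 2) v w"
  shows "bottleneck_dist (PD0 TYPE('f) M v) (PD0 TYPE('f) M w) \<le> ennreal (2 * \<eta>)"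
proof -
  have \<eta>: "0 < \<eta>" using g by (simp add: good_radius_def)
  define K where "K = (\<lambda>u u'. u = Pt (ereal (lowest v)) \<infinity> \<and> u' = Pt (ereal (lowest w)) \<infinity> \<or>
      (\<exists>x\<in>pos v. \<exists>y\<in>pts w. near \<eta> x y \<and> u = of_pair x \<and> u' = of_pair y) \<or>
      (\<exists>x\<in>pts v - pos v. u = of_pair x \<and> u' = Diagonal) \<or>
      (\<exists>y\<in>pts w. (\<forall>x\<in>pos v. \<not> near \<eta> x y) \<and> u = Diagonal \<and> u' = of_pair y))"
  define \<M> where "\<M> = {(p, q). snd p = (0 :: nat) \<and> snd q = (0 :: nat) \<and> K (fst p) (fst q)}"
  have mem_\<M>: "(p, q) \<in> \<M> \<longleftrightarrow> snd p = 0 \<and> snd q = 0 \<and> K (fst p) (fst q)" for p q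
    by (simp add: \<M>_def)
  have posx: "x = x'" if "x \<in> pos v" "x' \<in> pos v" "near \<eta> x y" "near \<eta> x' y" for x x' y
  proof (rule ccontr)
    assume "x \<noteq> x'"
    moreover have "near (\<eta> + \<eta>) x x'" using near_trans that near_sym by blast
    then have "near (4 * \<eta>) x x'" by (rule near_mono) (use \<eta> in simp)
    ultimately show False using good_radiusD(3)[OF g that(1), of x'] that(2) by (auto simp: pos_def)
  qed
  have "pd_matching (PD0 TYPE('f) M v) (PD0 TYPE('f) M w) \<M>"
    unfolding pd_matching_def
  proof (intro conjI ballI impI)
    have "(u, 0) \<in> copies (PD0 TYPE('f) M v) \<and> (u', 0) \<in> copies (PD0 TYPE('f) M w)" if "K u u'" for u u'
      using that unfolding K_def copies_PD0[OF v] copies_PD0[OF w] pos_def by blast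
    then show "\<M> \<subseteq> copies (PD0 TYPE('f) M v) \<times> copies (PD0 TYPE('f) M w)"
      using mem_\<M> by (auto simp: \<M>_def)
  next
    fix u assume u: "u \<in> copies (PD0 TYPE('f) M v)" "fst u \<noteq> Diagonal"
    obtain u0 where u0: "u = (u0, 0)" "u0 = Pt (ereal (lowest v)) \<infinity> \<or> (\<exists>x\<in>pts v. u0 = of_pair x)"
      using u copies_PD0[OF v] by (cases u) auto
    have "\<exists>!u'. K u0 u'"
    proof -
      consider "u0 = Pt (ereal (lowest v)) \<infinity>" | x where "x \<in> pos v" "u0 = of_pair x"
        | x where "x \<in> pts v - pos v" "u0 = of_pair x" using u0 by blast
      then show ?thesis
      proof cases
        case 1 then show ?thesis unfolding K_def by simp
      next
        case (2 x)
        obtain y where y0: "y \<in> pos w \<and> near \<eta> x y" and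
            uniq: "\<forall>y'. y' \<in> pos w \<and> near \<eta> x y' \<longrightarrow> y' = y"
          using unique_near(1)[OF v w g cl 2(1)] by (rule ex1E)
        have y: "y \<in> pts w" "near \<eta> x y" "\<And>y'. y' \<in> pts w \<Longrightarrow> near \<eta> x y' \<Longrightarrow> y' = y"
          using y0 uniq unique_near(2)[OF v w g cl 2(1)] unfolding pos_def by blast+
        show ?thesis
        proof (rule ex1I[of _ "of_pair y"])
          show "K u0 (of_pair y)" using 2 y unfolding K_def by blast
          show "u' = of_pair y" if "K u0 u'" for u'
            using that 2(1) y(3) unfolding K_def 2(2) of_pair_eqs by blast
        qed
      next
        case (3 x)
        show ?thesis
          using 3(1) unfolding K_def 3(2) of_pair_eqs by blast
      qed
    qed
    then obtain u' where u': "K u0 u'" and un: "\<And>u''. K u0 u'' \<Longrightarrow> u'' = u'" by blast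
    show "\<exists>!w. (u, w) \<in> \<M>"
    proof (rule ex1I[of _ "(u', 0)"])
      show "(u, (u', 0)) \<in> \<M>" using u' u0(1) by (simp only: mem_\<M> fst_conv snd_conv)
      fix w assume "(u, w) \<in> \<M>"
      then have "snd w = 0" "K u0 (fst w)" by (simp_all only: mem_\<M> u0(1) fst_conv)
      with un show "w = (u', 0)" by (metis prod.collapse)
    qed
  next
    fix u assume u: "u \<in> copies (PD0 TYPE('f) M w)" "fst u \<noteq> Diagonal"
    obtain u0 where u0: "u = (u0, 0)" "u0 = Pt (ereal (lowest w)) \<infinity> \<or> (\<exists>x\<in>pts w. u0 = of_pair x)"
      using u copies_PD0[OF w] by (cases u) auto
    have "\<exists>!u'. K u' u0"
    proof -
      consider "u0 = Pt (ereal (lowest w)) \<infinity>"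
        | y x where "y \<in> pts w" "u0 = of_pair y" "x \<in> pos v" "near \<eta> x y"
        | y where "y \<in> pts w" "u0 = of_pair y" "\<forall>x\<in>pos v. \<not> near \<eta> x y" using u0 by blast
      then show ?thesis
      proof cases
        case 1 then show ?thesis unfolding K_def by simp
      next
        case (2 y x)
        show ?thesis
        proof (rule ex1I[of _ "of_pair x"])
          show "K (of_pair x) u0" using 2 unfolding K_def by blast
          show "u' = of_pair x" if "K u' u0" for u'
            using that 2(1,3,4) posx unfolding K_def 2(2) of_pair_eqs by blast
        qed
      next
        case (3 y)
        show ?thesis
          using 3(1,3) unfolding K_def 3(2) of_pair_eqs by blast
      qed
    qed
    then obtain u' where u': "K u' u0" and un: "\<And>u''. K u'' u0 \<Longrightarrow> u'' = u'" by blast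
    show "\<exists>!w. (w, u) \<in> \<M>"
    proof (rule ex1I[of _ "(u', 0)"])
      show "((u', 0), u) \<in> \<M>" using u' u0(1) by (simp only: mem_\<M> fst_conv snd_conv)
      fix w assume "(w, u) \<in> \<M>"
      then have "snd w = 0" "K (fst w) u0" by (simp_all only: mem_\<M> u0(1) fst_conv)
      with un show "w = (u', 0)" by (metis prod.collapse)
    qed
  qed
  moreover have "(SUP (u, w)\<in>\<M>. pd_dist (fst u) (fst w)) \<le> ennreal (2 * \<eta>)"
  proof (rule SUP_least)
    fix p assume "p \<in> \<M>"
    then obtain u u' where p: "p = ((u, 0), (u', 0))" "K u u'"
      unfolding \<M>_def by (metis (mono_tags, lifting) case_prodE mem_Collect_eq prod.collapse)
    have "pd_dist u u' \<le> ennreal (2 * \<eta>)"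
      using p(2) unfolding K_def
    proof (elim disjE bexE conjE)
      assume "u = Pt (ereal (lowest v)) \<infinity>" "u' = Pt (ereal (lowest w)) \<infinity>"
      then show ?thesis using lowest_close[OF v w cl] \<eta> by (simp add: pd_dist_essential ennreal_leI)
    next
      fix x y assume "near \<eta> x y" "u = of_pair x" "u' = of_pair y"
      then show ?thesis using \<eta> by (auto simp: pd_dist_of_pair near_def intro!: ennreal_leI)
    next
      fix x assume "x \<in> pts v - pos v" "u = of_pair x" "u' = Diagonal"
      then show ?thesis using \<eta> by (auto simp: pd_dist_of_pair pos_def intro!: ennreal_leI)
    next
      fix y assume y: "y \<in> pts w" "\<forall>x\<in>pos v. \<not> near \<eta> x y" "u = Diagonal" "u' = of_pair y"
      then have "len y \<le> 4 * \<eta>" using long_near_pos[OF v w \<eta> cl y(1)] by force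
      then show ?thesis using y by (auto simp: pd_dist_of_pair intro!: ennreal_leI)
    qed
    then show "(case p of (u, w) \<Rightarrow> pd_dist (fst u) (fst w)) \<le> ennreal (2 * \<eta>)" by (simp add: p)
  qed
  ultimately show ?thesis unfolding bottleneck_dist_def by (intro INF_lower2[of \<M>]) auto
qed

lemma circle_nhd:
  assumes "v \<in> sphere 0 1" "0 < \<delta>"
  shows "\<exists>U. openin circle U \<and> v \<in> U \<and> (\<forall>w\<in>U. w \<in> sphere 0 1 \<and> height_close \<delta> v w)"
proof (intro exI conjI ballI)
  show "openin circle (sphere 0 1 \<inter> ball v (\<delta> / (R + 1)))" by (intro openin_open_Int) simp
  show "v \<in> sphere 0 1 \<inter> ball v (\<delta> / (R + 1))" using assms R_nonneg by simp
  fix w assume w: "w \<in> sphere 0 1 \<inter> ball v (\<delta> / (R + 1))"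
  then show "w \<in> sphere 0 1" by simp
  show "height_close \<delta> v w" using w assms by (intro height_close_dist) auto
qed

theorem pd_bundle_PD0: "pd_bundle circle (PD0 TYPE('f) M)"
  unfolding pd_bundle_def continuous_wrt_def
proof (intro conjI ballI allI impI)
  fix v :: "real^2" and \<epsilon> :: real
  assume "v \<in> topspace circle" and \<epsilon>: "0 < \<epsilon>"
  then have v: "v \<in> sphere 0 1" by simp
  obtain \<eta> where \<eta>: "good_radius v \<eta>" "\<eta> < \<epsilon> / 2" using good_radius_exists[OF v, of "\<epsilon> / 2"] \<epsilon> by auto
  then have pos: "0 < \<eta>" by (simp add: good_radius_def)
  obtain U where U: "openin circle U" "v \<in> U" "\<And>w. w \<in> U \<Longrightarrow> w \<in> sphere 0 1 \<and> height_close (\<eta> / 2) v w"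
    using circle_nhd[OF v, of "\<eta> / 2"] pos by auto
  have "bottleneck_dist (PD0 TYPE('f) M v) (PD0 TYPE('f) M w) < ennreal \<epsilon>" if "w \<in> U" for w
  proof -
    have "bottleneck_dist (PD0 TYPE('f) M v) (PD0 TYPE('f) M w) \<le> ennreal (2 * \<eta>)"
      using bottleneck_close[OF v _ \<eta>(1)] U(3)[OF that] by blast
    also have "\<dots> < ennreal \<epsilon>" using \<eta> \<epsilon> pos by (simp add: ennreal_less_iff)
    finally show ?thesis .
  qed
  then show "\<exists>U. openin circle U \<and> v \<in> U \<and>
      (\<forall>w\<in>U. bottleneck_dist (PD0 TYPE('f) M v) (PD0 TYPE('f) M w) < ennreal \<epsilon>)"
    using U by blast
qed (simp add: is_pdiagram_PD0)

end

section \<open>Components above a level and rays from the center\<close>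

text \<open>
  The oriented area of the parallelogram of \<open>a\<close> and \<open>b\<close>. The sign \<open>\<sigma>\<close>, which is \<open>1\<close> or \<open>-1\<close>, selects the orientation,
  so that an argument about the left side is also one about the right side.
\<close>

definition area :: "real \<Rightarrow> real^2 \<Rightarrow> real^2 \<Rightarrow> real" where
  "area \<sigma> a b = \<sigma> * (a $ 1 * b $ 2 - a $ 2 * b $ 1)"

lemma inner_plane: "(a :: real^2) \<bullet> b = a $ 1 * b $ 1 + a $ 2 * b $ 2"
  by (simp add: inner_vec_def sum_2)

lemma area_simps:
  "area \<sigma> (a + b) d = area \<sigma> a d + area \<sigma> b d" "area \<sigma> d (a + b) = area \<sigma> d a + area \<sigma> d b"
  "area \<sigma> (k *\<^sub>R a) d = k * area \<sigma> a d" "area \<sigma> d (k *\<^sub>R a) = k * area \<sigma> d a"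
  "area \<sigma> (a - b) d = area \<sigma> a d - area \<sigma> b d" "area \<sigma> d (a - b) = area \<sigma> d a - area \<sigma> d b"
  "area \<sigma> a a = 0"
  by (simp_all add: area_def algebra_simps)

lemma area_flip: "area \<sigma> a b = - area \<sigma> b a"
  by (simp add: area_def algebra_simps)

text \<open>
  The identity of Binet, Cauchy and Lagrange in the plane. It compares heights in two directions with angular order.
\<close>

lemma area_lagrange:
  assumes "\<sigma> * \<sigma> = 1"
  shows "(a \<bullet> u) * (b \<bullet> w) - (b \<bullet> u) * (a \<bullet> w) = area \<sigma> a b * area \<sigma> u w"
proof -
  have "area \<sigma> a b * area \<sigma> u w =
      (\<sigma> * \<sigma>) * ((a $ 1 * b $ 2 - a $ 2 * b $ 1) * (u $ 1 * w $ 2 - u $ 2 * w $ 1))"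
    by (simp add: area_def)
  then show ?thesis by (simp add: assms inner_plane algebra_simps)
qed

lemma area_three: "area \<sigma> y z *\<^sub>R q = area \<sigma> q z *\<^sub>R y + area \<sigma> y q *\<^sub>R z"
  by (simp add: vec_eq_iff forall_2 area_def algebra_simps)

lemma cone_coordinates:
  assumes "area \<sigma> y z \<noteq> 0"
  shows "q = (area \<sigma> q z / area \<sigma> y z) *\<^sub>R y + (area \<sigma> y q / area \<sigma> y z) *\<^sub>R z"
proof -
  have "q = (1 / area \<sigma> y z) *\<^sub>R (area \<sigma> y z *\<^sub>R q)" using assms by simp
  also have "\<dots> = (area \<sigma> q z / area \<sigma> y z) *\<^sub>R y + (area \<sigma> y q / area \<sigma> y z) *\<^sub>R z"
    by (subst area_three) (simp add: scaleR_add_right)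
  finally show ?thesis .
qed

lemma area_cone:
  "area \<sigma> y (\<alpha> *\<^sub>R y + \<beta> *\<^sub>R z) = \<beta> * area \<sigma> y z"
  "area \<sigma> (\<alpha> *\<^sub>R y + \<beta> *\<^sub>R z) z = \<alpha> * area \<sigma> y z"
  by (simp_all add: area_simps)

lemma same_ray:
  assumes s: "\<sigma> * \<sigma> = 1" and a: "0 < a \<bullet> u" "0 < b \<bullet> u" and 0: "area \<sigma> a b = 0"
  shows "\<exists>k>0. b = k *\<^sub>R a"
proof -
  define k where "k = (b \<bullet> u) / (a \<bullet> u)"
  have k: "k * (a \<bullet> u) = b \<bullet> u" using a by (simp add: k_def)
  have "(a \<bullet> u) * ((b - k *\<^sub>R a) \<bullet> w) = 0" for w
    using area_lagrange[OF s, of a u "b - k *\<^sub>R a" w] 0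
    by (simp add: area_simps inner_diff_left k)
  then have "(b - k *\<^sub>R a) \<bullet> w = 0" for w using a by simp
  then have "b - k *\<^sub>R a = 0" using inner_eq_zero_iff by blast
  then show ?thesis using a by (intro exI[of _ k]) (simp add: k_def)
qed

lemma finite_near_limit:
  assumes "finite S" "\<And>\<epsilon>. 0 < \<epsilon> \<Longrightarrow> \<epsilon> < \<epsilon>0 \<Longrightarrow> \<exists>y\<in>S. near \<epsilon> x y" "0 < \<epsilon>0"
  shows "x \<in> S"
proof (rule ccontr)
  assume x: "x \<notin> S"
  define m where "m = Min (insert \<epsilon>0 ((\<lambda>y. max \<bar>fst x - fst y\<bar> \<bar>snd x - snd y\<bar>) ` S))"
  have "0 < max \<bar>fst x - fst y\<bar> \<bar>snd x - snd y\<bar>" if "y \<in> S" for y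
  proof -
    have "fst x \<noteq> fst y \<or> snd x \<noteq> snd y" using that x by (metis prod_eqI)
    then show ?thesis by (auto simp: less_max_iff_disj)
  qed
  then have m: "0 < m" using assms by (auto simp: m_def)
  have "m \<le> \<epsilon>0" unfolding m_def using assms by (intro Min_le) auto
  then obtain y where y: "y \<in> S" "near (m / 2) x y" using assms(2)[of "m / 2"] m by auto
  have "m \<le> max \<bar>fst x - fst y\<bar> \<bar>snd x - snd y\<bar>"
    unfolding m_def using assms y by (intro Min_le) auto
  then show False using y m by (auto simp: near_def max_def split: if_splits)
qed

context plane_star
begin

definition depth :: "real^2 \<Rightarrow> real^2 \<Rightarrow> real" where "depth u x = (x - c) \<bullet> u"

text \<open>
  A sublevel set for the direction \<open>- u\<close>, with levels measured from the center and reversed.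
\<close>

definition deep :: "real^2 \<Rightarrow> real \<Rightarrow> (real^2) set" where
  "deep u e = {x \<in> M. e \<le> depth u x}"

lemma deep_eq_sublevel: "deep u e = sublevel M (- u) (- (c \<bullet> u) - e)"
  by (auto simp: deep_def sublevel_def depth_def inner_diff_left)

lemma sublevel_eq_deep: "sublevel M (- u) t = deep u (- (c \<bullet> u) - t)"
  by (simp add: deep_eq_sublevel)

lemma deep_anti: "e \<le> e' \<Longrightarrow> deep u e' \<subseteq> deep u e"
  by (auto simp: deep_def)

lemma conn_deep_anti: "conn (deep u e') x y \<Longrightarrow> e \<le> e' \<Longrightarrow> conn (deep u e) x y"
  using connected_component_of_subset deep_anti by metis

lemma conn_deepD: "conn (deep u e) x y \<Longrightarrow> x \<in> M \<and> y \<in> M \<and> e \<le> depth u x \<and> e \<le> depth u y"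
  using connected_component_in by (fastforce simp: deep_def)

lemma depth_center [simp]: "depth u c = 0" by (simp add: depth_def)

lemma depth_add_scale [simp]: "depth u (c + k *\<^sub>R w) = k * (w \<bullet> u)" by (simp add: depth_def)

lemma deep_segment:
  assumes "x \<in> M" "y \<in> closed_segment c x" "e \<le> depth u x" "e \<le> depth u y"
  shows "conn (deep u e) x y"
proof -
  have "closed_segment x y \<subseteq> closed_segment c x"
    using assms by (simp add: subset_closed_segment)
  then have "closed_segment x y \<subseteq> M" using star[OF assms(1)] by blast
  moreover have "closed_segment x y \<subseteq> {z. e + c \<bullet> u \<le> z \<bullet> u}"
  proof (rule closed_segment_subset)
    show "convex {z. e + c \<bullet> u \<le> z \<bullet> u}"
      using convex_halfspace_ge[of "e + c \<bullet> u" u] by (simp add: inner_commute)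
  qed (use assms in \<open>auto simp: depth_def inner_diff_left\<close>)
  ultimately have "closed_segment x y \<subseteq> deep u e" by (auto simp: deep_def depth_def inner_diff_left)
  then show ?thesis unfolding connected_component_def by (intro exI[of _ "closed_segment x y"]) auto
qed

lemma ray_segment:
  assumes "0 \<le> k" "k \<le> l" "c + l *\<^sub>R w \<in> M"
  shows "c + k *\<^sub>R w \<in> closed_segment c (c + l *\<^sub>R w)"
proof (cases "l = 0")
  case False
  then show ?thesis unfolding in_segment
    using assms by (intro exI[of _ "k / l"]) (auto simp: algebra_simps scaleR_collapse)
qed (use assms in auto)

text \<open>
  Of two points on one ray from the center, the lower one lies on the segment to the higher one, and both ends
  of the segment between them are above the level.
\<close>

lemma conn_same_ray:
  assumes s: "\<sigma> * \<sigma> = 1" and e: "0 < e" and x: "x \<in> deep u e" "y \<in> deep u e"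
    and 0: "area \<sigma> (x - c) (y - c) = 0"
  shows "conn (deep u e) x y"
proof -
  have d: "x \<in> M" "y \<in> M" "e \<le> depth u x" "e \<le> depth u y" using x by (auto simp: deep_def)
  then obtain k where k: "0 < k" "y - c = k *\<^sub>R (x - c)"
    using same_ray[OF s, of "x - c" u "y - c"] 0 e by (auto simp: depth_def)
  have y: "y = c + k *\<^sub>R (x - c)" using k by (metis add.commute diff_add_cancel)
  have xx: "x = c + 1 *\<^sub>R (x - c)" by simp
  show ?thesis
  proof (cases "k \<le> 1")
    case True
    have "y \<in> closed_segment c x" using ray_segment[of k 1 "x - c"] True k d y by simp
    then show ?thesis using deep_segment d by blast
  next
    case False
    have "x \<in> closed_segment c y" using ray_segment[of 1 k "x - c"] False d y by simp
    then have "conn (deep u e) y x" using deep_segment d by blast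
    then show ?thesis by (simp add: connected_component_sym_eq)
  qed
qed

text \<open>
  Intermediate value theorem on a component.
\<close>

lemma area_sign_const:
  assumes conn: "conn S x x'" and nz: "\<And>p. conn S x p \<Longrightarrow> area \<sigma> (p - c) w \<noteq> 0"
    and pos: "0 < area \<sigma> (x - c) w"
  shows "0 < area \<sigma> (x' - c) w"
proof (rule ccontr)
  assume neg: "\<not> 0 < area \<sigma> (x' - c) w"
  let ?K = "connected_component_set S x" and ?f = "\<lambda>p. area \<sigma> (p - c) w"
  have "continuous_on ?K ?f" unfolding area_def by (intro continuous_intros)
  then have "connected (?f ` ?K)" by (rule connected_continuous_image) simp
  moreover have "?f x \<in> ?f ` ?K" "?f x' \<in> ?f ` ?K"
    using conn connected_component_in[OF conn] by auto
  moreover have "?f x' \<le> 0" "0 \<le> ?f x" using neg pos by auto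
  ultimately have "0 \<in> ?f ` ?K" unfolding connected_iff_interval by blast
  then show False using nz by force
qed

text \<open>
  A component that does not contain \<open>w\<close> avoids the ray through \<open>w\<close> and so stays on one side of it.
\<close>

lemma side_const:
  assumes s: "\<sigma> * \<sigma> = 1" and e: "0 < e" and w: "w \<in> deep u e" and xy: "conn (deep u e) x x'"
    and n: "\<not> conn (deep u e) x w" and pos: "0 < area \<sigma> (x - c) (w - c)"
  shows "0 < area \<sigma> (x' - c) (w - c)"
proof (rule area_sign_const[OF xy _ pos])
  fix p assume p: "conn (deep u e) x p"
  show "area \<sigma> (p - c) (w - c) \<noteq> 0"
  proof
    assume "area \<sigma> (p - c) (w - c) = 0"
    then have "conn (deep u e) p w"
      using conn_same_ray[OF s e _ w] connected_component_in[OF p] by blast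
    then show False using n p connected_component_trans by metis
  qed
qed

lemma side_const':
  assumes s: "\<sigma> * \<sigma> = 1" and e: "0 < e" and w: "w \<in> deep u e" and xy: "conn (deep u e) x x'"
    and n: "\<not> conn (deep u e) x w" and pos: "0 < area \<sigma> (w - c) (x - c)"
  shows "0 < area \<sigma> (w - c) (x' - c)"
  using side_const[of "- \<sigma>", OF _ e w xy n] s pos
  by (simp add: area_def algebra_simps)

definition meets :: "real^2 \<Rightarrow> real \<Rightarrow> real^2 \<Rightarrow> bool" where
  "meets u e w \<longleftrightarrow> (\<exists>k\<ge>0. c + k *\<^sub>R w \<in> deep u e)"

text \<open>
  A component cannot pass from \<open>y\<close> to \<open>z\<close> without crossing each ray between them.
\<close>

lemma conn_imp_meets:
  assumes s: "\<sigma> * \<sigma> = 1" and conn: "conn (deep u e) y z" and p: "0 < area \<sigma> (y - c) (z - c)"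
    and d: "0 < depth u y" "0 < depth u z"
    and w: "0 \<le> area \<sigma> (y - c) w" "0 \<le> area \<sigma> w (z - c)"
  shows "w = 0 \<or> meets u e w"
proof (rule ccontr)
  assume neg: "\<not> (w = 0 \<or> meets u e w)"
  have "\<not> e \<le> 0"
  proof
    assume "e \<le> 0"
    then have "c + 0 *\<^sub>R w \<in> deep u e" using center by (simp add: deep_def)
    then show False using neg by (auto simp: meets_def)
  qed
  then have e: "0 < e" by simp
  define \<alpha> \<beta> where "\<alpha> = area \<sigma> w (z - c) / area \<sigma> (y - c) (z - c)"
    and "\<beta> = area \<sigma> (y - c) w / area \<sigma> (y - c) (z - c)"
  have ab: "w = \<alpha> *\<^sub>R (y - c) + \<beta> *\<^sub>R (z - c)" "0 \<le> \<alpha>" "0 \<le> \<beta>"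
    using cone_coordinates[of \<sigma> "y - c" "z - c" w] p w by (auto simp: \<alpha>_def \<beta>_def)
  have pos: "0 < w \<bullet> u"
  proof -
    have "\<alpha> \<noteq> 0 \<or> \<beta> \<noteq> 0" using ab neg by auto
    then have "0 < \<alpha> * depth u y + \<beta> * depth u z"
      using ab d by (metis add_nonneg_pos add_pos_nonneg less_eq_real_def mult_nonneg_nonneg mult_pos_pos)
    then show ?thesis by (simp add: ab(1) depth_def inner_add_left)
  qed
  have nz: "area \<sigma> (x - c) w \<noteq> 0" if x: "conn (deep u e) y x" for x
  proof
    assume 0: "area \<sigma> (x - c) w = 0"
    have xd: "x \<in> deep u e" "e \<le> depth u x" using connected_component_in[OF x] conn_deepD[OF x] by auto
    then obtain k where k: "0 < k" "x - c = k *\<^sub>R w"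
      using same_ray[OF s pos, of "x - c"] 0 e by (auto simp: depth_def area_flip[of \<sigma> w])
    then have "c + k *\<^sub>R w = x" by (metis add.commute diff_add_cancel)
    then show False using neg k xd by (auto simp: meets_def intro: less_imp_le)
  qed
  have y0: "conn (deep u e) y y" using connected_component_in[OF conn] by simp
  have "0 < area \<sigma> (y - c) w" using nz[OF y0] w by simp
  from area_sign_const[OF conn nz this] have "0 < area \<sigma> (z - c) w" .
  then show False using w(2) by (simp add: area_flip[of \<sigma> w])
qed

text \<open>
  Every ray that reaches the level \<open>e\<close> contains a point of \<open>M\<close> of depth exactly \<open>e\<close>. So the line of depth \<open>e\<close> is in
  \<open>M\<close> between the rays of \<open>y\<close> and \<open>z\<close>, and connects them.
\<close>

lemma meets_imp_conn:
  assumes s: "\<sigma> * \<sigma> = 1" and e: "0 < e" and y: "y \<in> deep u e" and z: "z \<in> deep u e"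
    and p: "0 < area \<sigma> (y - c) (z - c)"
    and m: "\<And>w. w \<noteq> 0 \<Longrightarrow> 0 \<le> area \<sigma> (y - c) w \<Longrightarrow> 0 \<le> area \<sigma> w (z - c) \<Longrightarrow> meets u e w"
  shows "conn (deep u e) y z"
proof -
  define top where "top x = c + (e / depth u x) *\<^sub>R (x - c)" for x
  have top: "conn (deep u e) x (top x)" "depth u (top x) = e" if x: "x \<in> deep u e" for x
  proof -
    have d: "x \<in> M" "e \<le> depth u x" using x by (auto simp: deep_def)
    have "top x \<in> closed_segment c x"
      using ray_segment[of "e / depth u x" 1 "x - c"] d e by (simp add: top_def)
    moreover show "depth u (top x) = e"
      using d e by (simp add: top_def depth_def)
    ultimately show "conn (deep u e) x (top x)" using d by (intro deep_segment) auto
  qed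
  have "closed_segment (top y) (top z) \<subseteq> deep u e"
  proof
    fix q assume q: "q \<in> closed_segment (top y) (top z)"
    then obtain t where t: "0 \<le> t" "t \<le> 1" "q = (1 - t) *\<^sub>R top y + t *\<^sub>R top z"
      by (auto simp: in_segment)
    have dq: "depth u q = e"
    proof -
      have "depth u q = (1 - t) * depth u (top y) + t * depth u (top z)"
        by (simp add: t(3) depth_def inner_diff_left inner_add_left algebra_simps)
      then show ?thesis using top(2) y z by (simp add: algebra_simps)
    qed
    have qc: "q - c = ((1 - t) * (e / depth u y)) *\<^sub>R (y - c) + (t * (e / depth u z)) *\<^sub>R (z - c)"
      by (simp add: t(3) top_def algebra_simps)
    have dp: "0 < depth u y" "0 < depth u z" using y z e by (auto simp: deep_def)
    have "0 \<le> area \<sigma> (y - c) (q - c)" "0 \<le> area \<sigma> (q - c) (z - c)"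
      unfolding qc area_cone using t dp e p by auto
    moreover have "q - c \<noteq> 0" using dq e by (auto simp: depth_def)
    ultimately obtain k where k: "0 \<le> k" "c + k *\<^sub>R (q - c) \<in> deep u e"
      using m unfolding meets_def by blast
    have "e \<le> k * e" using k dq by (simp add: deep_def) (simp add: depth_def)
    then have "1 \<le> k" using e by simp
    then have "c + 1 *\<^sub>R (q - c) \<in> closed_segment c (c + k *\<^sub>R (q - c))"
      using k by (intro ray_segment) (auto simp: deep_def)
    then have "q \<in> M" using star k by (auto simp: deep_def)
    then show "q \<in> deep u e" using dq by (simp add: deep_def)
  qed
  then have "conn (deep u e) (top y) (top z)"
    unfolding connected_component_def by (intro exI[of _ "closed_segment (top y) (top z)"]) auto
  then show ?thesis
    using top(1)[OF y] top(1)[OF z] connected_component_trans connected_component_sym by metis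
qed

text \<open>
  Approximate witnesses for a bar with birth depth \<open>B\<close> and death depth \<open>E\<close>: the component of \<open>y\<close> reaches about depth \<open>B\<close>
  and is joined at about depth \<open>E\<close> with a component that reaches about as far or further.
\<close>

definition merging :: "real^2 \<Rightarrow> real \<Rightarrow> real \<Rightarrow> real \<Rightarrow> real^2 \<Rightarrow> real^2 \<Rightarrow> bool" where
  "merging u B E \<epsilon> y z \<longleftrightarrow>
     B - \<epsilon> \<le> depth u y \<and> B - \<epsilon> \<le> depth u z \<and> y \<in> M \<and> z \<in> M \<and>
     conn (deep u (E - \<epsilon>)) y z \<and> \<not> conn (deep u (E + \<epsilon>)) y z \<and>
     (\<forall>x. conn (deep u (E + \<epsilon>)) y x \<longrightarrow> depth u x < B + \<epsilon>)"

lemma merging_iff_merging_pair: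
  "merging u B E \<epsilon> y z \<longleftrightarrow>
    merging_pair (deep u (B + \<epsilon>)) (deep u (B - \<epsilon>)) (deep u (E + \<epsilon>)) (deep u (E - \<epsilon>)) y z"
proof -
  have "(x \<notin> deep u (B + \<epsilon>)) = (depth u x < B + \<epsilon>)" if "conn (deep u (E + \<epsilon>)) y x" for x
    using conn_deepD[OF that] by (auto simp: deep_def)
  moreover have "x \<in> deep u (B - \<epsilon>) \<longleftrightarrow> x \<in> M \<and> B - \<epsilon> \<le> depth u x" for x
    by (simp add: deep_def)
  ultimately show ?thesis unfolding merging_def merging_pair_def by blast
qed

lemma merging_mono:
  assumes "merging u B E \<epsilon> y z" "\<epsilon> \<le> \<epsilon>'" shows "merging u B E \<epsilon>' y z"
proof -
  have "conn (deep u (E - \<epsilon>')) y z"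
    using assms conn_deep_anti[of u "E - \<epsilon>" y z "E - \<epsilon>'"] by (simp add: merging_def)
  moreover have "conn (deep u (E + \<epsilon>)) y x" if "conn (deep u (E + \<epsilon>')) y x" for x
    using conn_deep_anti[OF that, of "E + \<epsilon>"] assms(2) by simp
  moreover have "depth u x < B + \<epsilon>'" if "conn (deep u (E + \<epsilon>)) y x" for x
    using assms that unfolding merging_def by (meson add_left_mono less_le_trans)
  ultimately show ?thesis using assms unfolding merging_def by auto
qed

text \<open>
  In terms of heights in direction \<open>- u\<close>, the bar starts at \<open>- (c \<bullet> u) - B\<close> and ends at \<open>- (c \<bullet> u) - E\<close>.
\<close>

definition bar_at :: "real^2 \<Rightarrow> real \<Rightarrow> real \<Rightarrow> bool" where
  "bar_at u B E \<longleftrightarrow> (- (c \<bullet> u) - B, - (c \<bullet> u) - E) \<in> pts (- u)"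

text \<open>
  Witnesses with tolerance \<open>\<epsilon>\<close> correspond to a positive count of the box of radius \<open>\<epsilon>\<close>, and the points of the
  diagram are finitely many, so that points in arbitrarily small boxes around a position are at this position.
\<close>

lemma bar_at_iff:
  assumes u: "norm u = 1" and BE: "E < B"
  shows "bar_at u B E \<longleftrightarrow> (\<forall>\<epsilon>>0. \<exists>y z. merging u B E \<epsilon> y z)"
proof -
  have v: "- u \<in> sphere 0 1" using u by simp
  define b d where "b = - (c \<bullet> u) - B" and "d = - (c \<bullet> u) - E"
  have sub: "sublevel M (- u) (b - \<epsilon>) = deep u (B + \<epsilon>)" "sublevel M (- u) (b + \<epsilon>) = deep u (B - \<epsilon>)"
      "sublevel M (- u) (d - \<epsilon>) = deep u (E + \<epsilon>)" "sublevel M (- u) (d + \<epsilon>) = deep u (E - \<epsilon>)" for \<epsilon>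
    by (simp_all add: sublevel_eq_deep b_def d_def algebra_simps)
  have fin: "finite (components (deep u e))" for e
    unfolding deep_eq_sublevel by (rule finite_comps[OF v])
  have box_iff: "1 \<le> box (- u) (b - \<epsilon>) (b + \<epsilon>) (d - \<epsilon>) (d + \<epsilon>) \<longleftrightarrow> (\<exists>y z. merging u B E \<epsilon> y z)"
    if "0 < \<epsilon>" "2 * \<epsilon> < B - E" for \<epsilon>
  proof -
    have inc: "deep u (B + \<epsilon>) \<subseteq> deep u (B - \<epsilon>)" "deep u (B - \<epsilon>) \<subseteq> deep u (E + \<epsilon>)"
      "deep u (E + \<epsilon>) \<subseteq> deep u (E - \<epsilon>)" using that by (auto intro!: deep_anti)
    show ?thesis
      unfolding sub merging_iff_merging_pair
      using box_count_imp_merging_pair[OF _ inc fin fin] merging_pair_imp_box_count[OF _ inc fin fin]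
      by blast
  qed
  show ?thesis
  proof
    assume bar: "bar_at u B E"
    show "\<forall>\<epsilon>>0. \<exists>y z. merging u B E \<epsilon> y z"
    proof (intro allI impI)
      fix \<epsilon> :: real assume e: "0 < \<epsilon>"
      define \<theta> where "\<theta> = min \<epsilon> ((B - E) / 4)"
      have t: "0 < \<theta>" "2 * \<theta> < B - E" "\<theta> \<le> \<epsilon>" using e BE by (auto simp: \<theta>_def min_def)
      have "(b, d) \<in> pts (- u) \<inter> {b - \<theta><..<b + \<theta>} \<times> {d - \<theta><..<d + \<theta>}"
        using bar t by (simp add: bar_at_def b_def d_def)
      then have "1 \<le> card (pts (- u) \<inter> {b - \<theta><..<b + \<theta>} \<times> {d - \<theta><..<d + \<theta>})"
        using finite_pts[OF v] by (metis card_0_eq empty_iff finite_Int less_one not_le)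
      also have "int \<dots> \<le> box (- u) (b - \<theta>) (b + \<theta>) (d - \<theta>) (d + \<theta>)"
        using t by (intro box_bounds(1)[OF v]) (auto simp: b_def d_def)
      finally have "\<exists>y z. merging u B E \<theta> y z" using box_iff t by simp
      then show "\<exists>y z. merging u B E \<epsilon> y z" using merging_mono t by blast
    qed
  next
    assume m: "\<forall>\<epsilon>>0. \<exists>y z. merging u B E \<epsilon> y z"
    have "(b, d) \<in> pts (- u)"
    proof (rule finite_near_limit[OF finite_pts[OF v], of "(B - E) / 4"])
      fix \<epsilon> :: real assume e: "0 < \<epsilon>" "\<epsilon> < (B - E) / 4"
      have "1 \<le> box (- u) (b - \<epsilon>) (b + \<epsilon>) (d - \<epsilon>) (d + \<epsilon>)" using box_iff[of \<epsilon>] m e by simp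
      also have "\<dots> \<le> int (card (pts (- u) \<inter> {b - \<epsilon>..b + \<epsilon>} \<times> {d - \<epsilon>..d + \<epsilon>}))"
        using e by (intro box_bounds(2)[OF v]) (auto simp: b_def d_def)
      finally have "pts (- u) \<inter> {b - \<epsilon>..b + \<epsilon>} \<times> {d - \<epsilon>..d + \<epsilon>} \<noteq> {}" by auto
      then show "\<exists>y\<in>pts (- u). near \<epsilon> (b, d) y" by (force simp: near_def abs_le_iff)
    qed (use BE in simp)
    then show "bar_at u B E" by (simp add: bar_at_def b_def d_def)
  qed
qed

end

section \<open>The side on which a component merges\<close>

text \<open>
  If for each tolerance one of finitely many candidates works, a single candidate works for all of them.
\<close>

lemma pigeonhole_small:
  fixes Q :: "'i \<Rightarrow> real \<Rightarrow> bool"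
  assumes fin: "finite I" and ex: "\<And>\<epsilon>. 0 < \<epsilon> \<Longrightarrow> \<exists>i\<in>I. Q i \<epsilon>"
    and mono: "\<And>i \<epsilon> \<epsilon>'. Q i \<epsilon> \<Longrightarrow> \<epsilon> \<le> \<epsilon>' \<Longrightarrow> Q i \<epsilon>'"
  shows "\<exists>i\<in>I. \<forall>\<epsilon>>0. Q i \<epsilon>"
proof (rule ccontr)
  assume "\<not> ?thesis"
  then have "\<forall>i\<in>I. \<exists>\<epsilon>>0. \<not> Q i \<epsilon>" by blast
  then obtain e where e: "\<And>i. i \<in> I \<Longrightarrow> 0 < e i \<and> \<not> Q i (e i)" by metis
  have "I \<noteq> {}" using ex[of 1] by auto
  then have "0 < Min (e ` I)" using fin e by simp
  then obtain i where i: "i \<in> I" "Q i (Min (e ` I))" using ex by blast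
  moreover have "Min (e ` I) \<le> e i" using fin i by simp
  ultimately show False using mono e by blast
qed

lemma conn_in_component: "K \<in> components S \<Longrightarrow> x \<in> K \<Longrightarrow> y \<in> K \<Longrightarrow> conn S x y"
  unfolding connected_component_def using in_components_connected in_components_subset by blast

lemma cone_nonneg_pos:
  assumes p: "0 < area \<sigma> y z" and w: "0 \<le> area \<sigma> y w" "0 \<le> area \<sigma> w z" "w \<noteq> 0"
    and f: "\<And>\<alpha> \<beta>. w = \<alpha> *\<^sub>R y + \<beta> *\<^sub>R z \<Longrightarrow> g w = \<alpha> * g y + \<beta> * (g z :: real)"
    and g: "0 < g y" "0 < g z"
  shows "0 < g w"
proof -
  define \<alpha> \<beta> where "\<alpha> = area \<sigma> w z / area \<sigma> y z" and "\<beta> = area \<sigma> y w / area \<sigma> y z"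
  have ab: "w = \<alpha> *\<^sub>R y + \<beta> *\<^sub>R z" "0 \<le> \<alpha>" "0 \<le> \<beta>"
    using cone_coordinates[of \<sigma> y z w] p w by (auto simp: \<alpha>_def \<beta>_def)
  have "\<alpha> \<noteq> 0 \<or> \<beta> \<noteq> 0" using ab w(3) by auto
  then have "0 < \<alpha> * g y + \<beta> * g z"
    using ab g by (metis add_nonneg_pos add_pos_nonneg less_eq_real_def mult_nonneg_nonneg mult_pos_pos)
  then show ?thesis using f ab by metis
qed

lemma cone_nonneg:
  assumes p: "0 < area \<sigma> y z" and w: "0 \<le> area \<sigma> y w" "0 \<le> area \<sigma> w z"
    and f: "\<And>\<alpha> \<beta>. w = \<alpha> *\<^sub>R y + \<beta> *\<^sub>R z \<Longrightarrow> g w = \<alpha> * g y + \<beta> * (g z :: real)"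
    and g: "0 \<le> g y" "0 \<le> g z"
  shows "0 \<le> g w"
proof -
  have "w = (area \<sigma> w z / area \<sigma> y z) *\<^sub>R y + (area \<sigma> y w / area \<sigma> y z) *\<^sub>R z"
    using cone_coordinates[of \<sigma> y z w] p by auto
  from f[OF this] show ?thesis using p w g by simp
qed

context plane_star
begin

text \<open>
  The bar has witnesses \<open>y\<close>, \<open>z\<close> of any precision with \<open>z\<close> on the side \<open>\<sigma>\<close> of \<open>y\<close>, and the component of \<open>y\<close> up to its
  death stays on the other side of the ray \<open>r\<close>. The ray is the same for all precisions, and it will be
  kept fixed while the direction turns.
\<close>

definition sided :: "real \<Rightarrow> real^2 \<Rightarrow> real \<Rightarrow> real \<Rightarrow> real^2 \<Rightarrow> bool" where
  "sided \<sigma> u B E r \<longleftrightarrow> (\<forall>\<epsilon>>0. \<exists>y z. merging u B E \<epsilon> y z \<and> 0 < area \<sigma> (y - c) (z - c) \<and>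
     (\<forall>x. conn (deep u (E + \<epsilon>)) y x \<longrightarrow> 0 < area \<sigma> (x - c) r))"

definition close_dirs :: "real \<Rightarrow> real^2 \<Rightarrow> real^2 \<Rightarrow> bool" where
  "close_dirs \<delta> u u' \<longleftrightarrow> (\<forall>x\<in>M. \<bar>depth u x - depth u' x\<bar> \<le> \<delta>)"

lemma close_dirs_sym: "close_dirs \<delta> u u' \<longleftrightarrow> close_dirs \<delta> u' u"
  by (auto simp: close_dirs_def abs_minus_commute)

lemma close_dirs_dist:
  assumes "dist u u' \<le> \<delta> / (2 * R + 1)" "0 \<le> \<delta>" shows "close_dirs \<delta> u u'"
  unfolding close_dirs_def
proof
  fix x assume x: "x \<in> M"
  have "norm (x - c) \<le> 2 * R + 1"
    using norm_triangle_ineq4[of x c] bounded[OF x] bounded[OF center] by linarith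
  then have "norm (x - c) * norm (u - u') \<le> (2 * R + 1) * (\<delta> / (2 * R + 1))"
    using assms R_nonneg by (intro mult_mono) (auto simp: dist_norm)
  moreover have "\<bar>depth u x - depth u' x\<bar> \<le> norm (x - c) * norm (u - u')"
    using Cauchy_Schwarz_ineq2[of "x - c" "u - u'"] by (simp add: depth_def inner_diff_right)
  ultimately show "\<bar>depth u x - depth u' x\<bar> \<le> \<delta>" using R_nonneg by simp
qed

lemma conn_shift:
  assumes "conn (deep u e) x y" "close_dirs \<delta> u u'" "e' + \<delta> \<le> e" shows "conn (deep u' e') x y"
proof -
  have "deep u e \<subseteq> deep u' e'" using assms(2,3) by (force simp: deep_def close_dirs_def)
  then show ?thesis using connected_component_of_subset assms(1) by metis
qed

lemma sided_imp_bar: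
  assumes "sided \<sigma> u B E r" "norm u = 1" "E < B" shows "bar_at u B E"
proof -
  have "\<exists>y z. merging u B E \<epsilon> y z" if "0 < \<epsilon>" for \<epsilon>
    using assms(1) that unfolding sided_def by blast
  then show ?thesis using bar_at_iff[OF assms(2,3)] by simp
qed

lemma finite_comps_deep: "norm u = 1 \<Longrightarrow> finite (components (deep u e))"
  unfolding deep_eq_sublevel by (rule finite_comps) simp

text \<open>
  At a level between birth and death there are only finitely many components to contain the witnesses, so witnesses
  of all precisions can be found in one fixed pair of components.
\<close>

lemma witnesses_in_one_component:
  assumes u: "norm u = 1" and BE: "E < B"
    and ex: "\<And>\<epsilon>. 0 < \<epsilon> \<Longrightarrow> \<exists>y z. P \<epsilon> y z" and mono: "\<And>\<epsilon> \<epsilon>' y z. P \<epsilon> y z \<Longrightarrow> \<epsilon> \<le> \<epsilon>' \<Longrightarrow> P \<epsilon>' y z"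
    and P: "\<And>\<epsilon> y z. P \<epsilon> y z \<Longrightarrow> merging u B E \<epsilon> y z"
  shows "\<exists>y z. y \<in> deep u ((B + E) / 2) \<and> z \<in> deep u ((B + E) / 2) \<and>
    (\<forall>\<epsilon>>0. \<exists>y' z'. conn (deep u ((B + E) / 2)) y y' \<and> conn (deep u ((B + E) / 2)) z z' \<and> P \<epsilon> y' z')"
proof -
  let ?S = "deep u ((B + E) / 2)"
  define I where "I = components ?S \<times> components ?S"
  have "\<exists>i\<in>I. \<forall>\<epsilon>>0. \<exists>y\<in>fst i. \<exists>z\<in>snd i. P \<epsilon> y z"
  proof (rule pigeonhole_small)
    show "finite I" using finite_comps_deep[OF u] by (simp add: I_def)
    show "\<exists>i\<in>I. \<exists>y\<in>fst i. \<exists>z\<in>snd i. P \<epsilon> y z" if e: "0 < \<epsilon>" for \<epsilon>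
    proof -
      define \<theta> where "\<theta> = min \<epsilon> ((B - E) / 2)"
      have t: "0 < \<theta>" "\<theta> \<le> \<epsilon>" "\<theta> \<le> (B - E) / 2" using e BE by (auto simp: \<theta>_def min_def field_simps)
      obtain y z where yz: "P \<theta> y z" using ex t by blast
      then have "y \<in> ?S" "z \<in> ?S" using P[OF yz] t by (auto simp: merging_def deep_def field_simps)
      then have "(connected_component_set ?S y, connected_component_set ?S z) \<in> I"
        by (auto simp: I_def intro: comp_set_in_components)
      moreover have "y \<in> connected_component_set ?S y" "z \<in> connected_component_set ?S z"
        using \<open>y \<in> ?S\<close> \<open>z \<in> ?S\<close> by auto
      moreover have "P \<epsilon> y z" using mono yz t by blast
      ultimately show ?thesis by force
    qed
    show "\<exists>y\<in>fst i. \<exists>z\<in>snd i. P \<epsilon>' y z" if "\<exists>y\<in>fst i. \<exists>z\<in>snd i. P \<epsilon> y z" "\<epsilon> \<le> \<epsilon>'" for i \<epsilon> \<epsilon>'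
      using that mono by blast
  qed
  then obtain K K' where K: "K \<in> components ?S" "K' \<in> components ?S"
    "\<And>\<epsilon>. 0 < \<epsilon> \<Longrightarrow> \<exists>y\<in>K. \<exists>z\<in>K'. P \<epsilon> y z" by (force simp: I_def)
  obtain y z where yz: "y \<in> K" "z \<in> K'" using K(3)[of 1] by auto
  moreover have "y \<in> ?S" "z \<in> ?S" using yz K in_components_subset by blast+
  moreover have "\<exists>y' z'. conn ?S y y' \<and> conn ?S z z' \<and> P \<epsilon> y' z'" if e: "0 < \<epsilon>" for \<epsilon>
  proof -
    obtain y' z' where "y' \<in> K" "z' \<in> K'" "P \<epsilon> y' z'" using K(3)[OF e] by blast
    then show ?thesis using conn_in_component[OF K(1) yz(1)] conn_in_component[OF K(2) yz(2)] by blast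
  qed
  ultimately show ?thesis by blast
qed

lemma merging_conn_levels:
  assumes BE: "E < B"
    and w: "\<And>\<epsilon>. 0 < \<epsilon> \<Longrightarrow> \<exists>y' z'. conn (deep u ((B + E) / 2)) y y' \<and> conn (deep u ((B + E) / 2)) z z' \<and>
        merging u B E \<epsilon> y' z'"
  shows "E < t \<Longrightarrow> \<not> conn (deep u t) y z" "t < E \<Longrightarrow> conn (deep u t) y z"
proof -
  let ?s = "(B + E) / 2"
  show "\<not> conn (deep u t) y z" if t: "E < t"
  proof
    assume yz: "conn (deep u t) y z"
    define \<epsilon> where "\<epsilon> = min (t - E) (?s - E)"
    have e: "0 < \<epsilon>" "E + \<epsilon> \<le> t" "E + \<epsilon> \<le> ?s" using t BE by (auto simp: \<epsilon>_def min_def field_simps)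
    obtain y' z' where *: "conn (deep u ?s) y y'" "conn (deep u ?s) z z'" "merging u B E \<epsilon> y' z'"
      using w[OF e(1)] by blast
    have "conn (deep u (E + \<epsilon>)) y' z'"
      using conn_deep_anti[OF *(1) e(3)] conn_deep_anti[OF *(2) e(3)] conn_deep_anti[OF yz e(2)]
        connected_component_trans connected_component_sym by metis
    then show False using *(3) by (simp add: merging_def)
  qed
  show "conn (deep u t) y z" if t: "t < E"
  proof -
    obtain y' z' where *: "conn (deep u ?s) y y'" "conn (deep u ?s) z z'" "merging u B E (E - t) y' z'"
      using w[of "E - t"] t by auto
    have "conn (deep u t) y' z'" using *(3) by (simp add: merging_def)
    moreover have "t \<le> ?s" using t BE by simp
    ultimately show ?thesis
      using conn_deep_anti[OF *(1)] conn_deep_anti[OF *(2)]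
        connected_component_trans connected_component_sym by metis
  qed
qed

text \<open>
  The ray of \<open>z\<close> separates: above the level \<open>E\<close> the components of \<open>y\<close> and \<open>z\<close> are different.
\<close>

lemma sided_exists:
  assumes bar: "bar_at u B E" and u: "norm u = 1" and BE: "0 \<le> E" "E < B"
  shows "\<exists>\<sigma>\<in>{1, -1}. \<exists>r. sided \<sigma> u B E r \<and> 0 < r \<bullet> u"
proof -
  let ?s = "(B + E) / 2"
  have s: "0 < ?s" using BE by simp
  have ex: "\<exists>y z. merging u B E \<epsilon> y z" if "0 < \<epsilon>" for \<epsilon> using bar_at_iff[OF u BE(2)] bar that by blast
  have "\<exists>y z. y \<in> deep u ?s \<and> z \<in> deep u ?s \<and>
    (\<forall>\<epsilon>>0. \<exists>y' z'. conn (deep u ?s) y y' \<and> conn (deep u ?s) z z' \<and> merging u B E \<epsilon> y' z')"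
    by (rule witnesses_in_one_component[where P = "merging u B E", OF u BE(2) ex])
      (auto intro: merging_mono)
  then obtain y z where yz: "y \<in> deep u ?s" "z \<in> deep u ?s" and
    w: "\<And>\<epsilon>. 0 < \<epsilon> \<Longrightarrow> \<exists>y' z'. conn (deep u ?s) y y' \<and> conn (deep u ?s) z z' \<and> merging u B E \<epsilon> y' z'"
    by (elim exE conjE) metis
  note nc = merging_conn_levels(1)[OF BE(2) w]
  have n: "\<not> conn (deep u ?s) y z" using nc[of ?s] BE by simp
  then have "area 1 (y - c) (z - c) \<noteq> 0" using conn_same_ray[of 1 ?s y u z] s yz by auto
  moreover have "area (- 1) (y - c) (z - c) = - area 1 (y - c) (z - c)" by (simp add: area_def)
  ultimately have "\<exists>\<sigma>\<in>{1, -1 :: real}. 0 < area \<sigma> (y - c) (z - c)"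
    by (cases "0 < area 1 (y - c) (z - c)") auto
  then obtain \<sigma> where \<sigma>: "\<sigma> \<in> {1, -1 :: real}" "0 < area \<sigma> (y - c) (z - c)" by blast
  have ss: "\<sigma> * \<sigma> = 1" using \<sigma> by auto
  have "sided \<sigma> u B E (z - c)" unfolding sided_def
  proof (intro allI impI)
    fix \<epsilon> :: real assume e: "0 < \<epsilon>"
    define \<theta> where "\<theta> = min \<epsilon> (?s - E)"
    have t: "0 < \<theta>" "\<theta> \<le> \<epsilon>" "E + \<theta> \<le> ?s" using e BE by (auto simp: \<theta>_def min_def field_simps)
    obtain y' z' where *: "conn (deep u ?s) y y'" "conn (deep u ?s) z z'" "merging u B E \<theta> y' z'"
      using w[OF t(1)] by blast
    have yz': "0 < area \<sigma> (y' - c) (z - c)" by (rule side_const[OF ss s yz(2) *(1) n \<sigma>(2)])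
    have "\<not> conn (deep u ?s) z y'"
      using n *(1) connected_component_trans connected_component_sym by metis
    then have "0 < area \<sigma> (y' - c) (z' - c)"
      using side_const'[OF ss s _ *(2) _ yz'] connected_component_in[OF *(1)] by blast
    moreover have "0 < area \<sigma> (x - c) (z - c)" if x: "conn (deep u (E + \<epsilon>)) y' x" for x
    proof (rule side_const[OF ss _ _ conn_deep_anti[OF x] _ yz'])
      show "0 < E + \<theta>" using BE t by simp
      show "z \<in> deep u (E + \<theta>)" using yz(2) deep_anti[OF t(3)] by blast
      show "E + \<theta> \<le> E + \<epsilon>" using t by simp
      show "\<not> conn (deep u (E + \<theta>)) y' z"
      proof
        assume "conn (deep u (E + \<theta>)) y' z"
        then have "conn (deep u (E + \<theta>)) y z"
          using conn_deep_anti[OF *(1) t(3)] connected_component_trans by metis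
        then show False using nc[of "E + \<theta>"] t by simp
      qed
    qed
    ultimately show "\<exists>y z'. merging u B E \<epsilon> y z' \<and> 0 < area \<sigma> (y - c) (z' - c) \<and>
        (\<forall>x. conn (deep u (E + \<epsilon>)) y x \<longrightarrow> 0 < area \<sigma> (x - c) (z - c))"
      using merging_mono[OF *(3) t(2)] by blast
  qed
  moreover have "0 < (z - c) \<bullet> u" using yz(2) s by (simp add: deep_def depth_def)
  ultimately show ?thesis using \<sigma>(1) by blast
qed

text \<open>
  Witnesses of precision \<open>\<epsilon> / 4\<close> for data within \<open>\<epsilon> / 4\<close> are witnesses of precision \<open>\<epsilon>\<close>.
\<close>

lemma sided_closed:
  assumes lim: "\<And>\<delta>. 0 < \<delta> \<Longrightarrow> \<exists>u' B' E'. close_dirs \<delta> u u' \<and> \<bar>B' - B\<bar> \<le> \<delta> \<and> \<bar>E' - E\<bar> \<le> \<delta> \<and> sided \<sigma> u' B' E' r"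
  shows "sided \<sigma> u B E r"
  unfolding sided_def
proof (intro allI impI)
  fix \<epsilon> :: real assume e: "0 < \<epsilon>"
  define \<delta> where "\<delta> = \<epsilon> / 4"
  have d: "0 < \<delta>" "\<epsilon> = 4 * \<delta>" using e by (simp_all add: \<delta>_def)
  obtain u' B' E' where *: "close_dirs \<delta> u u'" "\<bar>B' - B\<bar> \<le> \<delta>" "\<bar>E' - E\<bar> \<le> \<delta>" "sided \<sigma> u' B' E' r"
    using lim[OF d(1)] by blast
  have cl': "close_dirs \<delta> u' u" using *(1) close_dirs_sym by blast
  obtain y z where yz: "merging u' B' E' \<delta> y z" "0 < area \<sigma> (y - c) (z - c)"
      "\<And>x. conn (deep u' (E' + \<delta>)) y x \<Longrightarrow> 0 < area \<sigma> (x - c) r"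
    using *(4) d(1) unfolding sided_def by blast
  have m: "B' - \<delta> \<le> depth u' y" "B' - \<delta> \<le> depth u' z" "y \<in> M" "z \<in> M" "conn (deep u' (E' - \<delta>)) y z"
     "\<not> conn (deep u' (E' + \<delta>)) y z" "\<And>x. conn (deep u' (E' + \<delta>)) y x \<Longrightarrow> depth u' x < B' + \<delta>"
    using yz(1) by (auto simp: merging_def)
  have in_u': "conn (deep u' (E' + \<delta>)) y x" if "conn (deep u (E + \<epsilon>)) y x" for x
    by (rule conn_shift[OF that *(1)]) (use *(3) d in linarith)
  have cd: "\<bar>depth u x - depth u' x\<bar> \<le> \<delta>" if "x \<in> M" for x
    using *(1) that by (auto simp: close_dirs_def)
  have "merging u B E \<epsilon> y z" unfolding merging_def
  proof (intro conjI allI impI)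
    show "B - \<epsilon> \<le> depth u y" "B - \<epsilon> \<le> depth u z"
      using m(1,2) cd[OF m(3)] cd[OF m(4)] *(2) d by linarith+
    show "conn (deep u (E - \<epsilon>)) y z" by (rule conn_shift[OF m(5) cl']) (use *(3) d in linarith)
    show "\<not> conn (deep u (E + \<epsilon>)) y z" using in_u' m(6) by blast
    fix x assume x: "conn (deep u (E + \<epsilon>)) y x"
    show "depth u x < B + \<epsilon>" using m(7)[OF in_u'[OF x]] cd[of x] conn_deepD[OF x] *(2) d by linarith
  qed (use m in auto)
  then show "\<exists>y z. merging u B E \<epsilon> y z \<and> 0 < area \<sigma> (y - c) (z - c) \<and>
      (\<forall>x. conn (deep u (E + \<epsilon>)) y x \<longrightarrow> 0 < area \<sigma> (x - c) r)"
    using yz in_u' by blast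
qed

text \<open>
  The direction \<open>u\<close> has turned towards \<open>\<sigma>\<close> until it is orthogonal to \<open>r\<close>. All points on the same
  side of \<open>r\<close> as \<open>y\<close> then have negative depth, but \<open>y\<close> has positive depth.
\<close>

lemma sided_end:
  assumes s: "\<sigma> * \<sigma> = 1" and ty: "sided \<sigma> u B E r" and BE: "0 \<le> E" "E < B"
    and r: "0 < r \<bullet> u0" "r \<bullet> u = 0" and turn: "0 < area \<sigma> u0 u"
  shows False
proof -
  define \<epsilon> where "\<epsilon> = (B - E) / 2"
  have e: "0 < \<epsilon>" "0 < B - \<epsilon>" "E + \<epsilon> \<le> B - \<epsilon>" using BE by (auto simp: \<epsilon>_def field_simps)
  obtain y z where yz: "merging u B E \<epsilon> y z" "\<And>x. conn (deep u (E + \<epsilon>)) y x \<Longrightarrow> 0 < area \<sigma> (x - c) r"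
    using ty e unfolding sided_def by blast
  have y: "y \<in> M" "B - \<epsilon> \<le> depth u y" using yz(1) by (auto simp: merging_def)
  then have "conn (deep u (E + \<epsilon>)) y y" using e by (simp add: deep_def)
  then have "0 < area \<sigma> (y - c) r * area \<sigma> u0 u" using yz(2) turn by simp
  then have "0 < - ((r \<bullet> u0) * ((y - c) \<bullet> u))"
    using area_lagrange[OF s, of "y - c" u0 r u] r by simp
  moreover have "0 < (y - c) \<bullet> u" using y e by (simp add: depth_def)
  ultimately show False using r(1) by (simp add: mult_less_0_iff)
qed

end

section \<open>Turning towards the merging side\<close>

context plane_star
begin

text \<open>
  A description of the merge by exact data at two levels, in place of witnesses for every precision. The points \<open>y\<close> and
  \<open>z\<close> represent the merging components at the level \<open>s0\<close>, half-way between death and birth. The level \<open>s\<close> is so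
  close to \<open>E\<close> that no point deeper than \<open>s0\<close> joins the component of \<open>y\<close> between \<open>s\<close> and \<open>E\<close>.
\<close>

definition valley :: "real \<Rightarrow> real^2 \<Rightarrow> real \<Rightarrow> real \<Rightarrow> real^2 \<Rightarrow> real \<Rightarrow> real \<Rightarrow> real^2 \<Rightarrow> real^2 \<Rightarrow> bool" where
  "valley \<sigma> u B E r s0 s y z \<longleftrightarrow>
     E < s \<and> s \<le> s0 \<and> s0 = (B + E) / 2 \<and> y \<in> deep u s0 \<and> z \<in> deep u s0 \<and>
     (\<forall>t x. E < t \<longrightarrow> conn (deep u t) y x \<longrightarrow> depth u x \<le> B) \<and>
     (\<forall>\<epsilon>>0. \<exists>y'. conn (deep u s0) y y' \<and> B - \<epsilon> \<le> depth u y') \<and>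
     (\<forall>\<epsilon>>0. \<exists>z'. conn (deep u s0) z z' \<and> B - \<epsilon> \<le> depth u z') \<and>
     (\<forall>t<E. conn (deep u t) y z) \<and> (\<forall>t>E. \<not> conn (deep u t) y z) \<and>
     0 < area \<sigma> (y - c) (z - c) \<and>
     (\<forall>t x. E < t \<longrightarrow> conn (deep u t) y x \<longrightarrow> 0 < area \<sigma> (x - c) r) \<and>
     (\<forall>t x. x \<in> deep u s0 \<longrightarrow> E < t \<longrightarrow> conn (deep u t) y x \<longrightarrow> conn (deep u s) y x)"

text \<open>
  Of the finitely many components at level \<open>s0\<close>, those that join \<open>y\<close> above the level \<open>E\<close> do so at finitely
  many levels.
\<close>

lemma stable_level:
  assumes u: "norm u = 1" and E: "E < s0"
  shows "\<exists>s. E < s \<and> s \<le> s0 \<and>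
    (\<forall>t x. x \<in> deep u s0 \<longrightarrow> E < t \<longrightarrow> conn (deep u t) y x \<longrightarrow> conn (deep u s) y x)"
proof -
  define J where "J = {K \<in> components (deep u s0). \<exists>t>E. \<exists>x\<in>K. conn (deep u t) y x}"
  have fin: "finite J" using finite_comps_deep[OF u] by (simp add: J_def)
  have "\<forall>K\<in>J. \<exists>t>E. \<exists>x\<in>K. conn (deep u t) y x" by (simp add: J_def)
  then obtain f where f: "\<And>K. K \<in> J \<Longrightarrow> E < f K \<and> (\<exists>x\<in>K. conn (deep u (f K)) y x)" by metis
  define s where "s = Min (insert s0 (f ` J))"
  have "E < s" using fin f E by (simp add: s_def)
  moreover have s_le: "s \<le> s0" using fin by (simp add: s_def)
  moreover have "conn (deep u s) y x" if x: "x \<in> deep u s0" "E < t" "conn (deep u t) y x" for t x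
  proof -
    let ?K = "connected_component_set (deep u s0) x"
    have "x \<in> ?K" using x(1) by simp
    then have K: "?K \<in> J" unfolding J_def using x comp_set_in_components[OF x(1)] by blast
    then obtain x' where x': "x' \<in> ?K" "conn (deep u (f ?K)) y x'" using f by blast
    have "s \<le> f ?K" unfolding s_def using fin K by simp
    then have "conn (deep u s) y x'" using conn_deep_anti[OF x'(2)] by blast
    moreover have "conn (deep u s) x' x"
      using conn_deep_anti[OF _ s_le, of u x x'] x'(1) connected_component_sym by blast
    ultimately show ?thesis using connected_component_trans by metis
  qed
  ultimately show ?thesis by blast
qed

lemma sided_valley:
  assumes s: "\<sigma> * \<sigma> = 1" and ty: "sided \<sigma> u B E r" and u: "norm u = 1" and BE: "0 \<le> E" "E < B"
  shows "\<exists>s0 s y z. valley \<sigma> u B E r s0 s y z"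
proof -
  define s0 where "s0 = (B + E) / 2"
  have s0: "E < s0" "0 < s0" using BE by (auto simp: s0_def)
  define P where "P \<epsilon> y z \<longleftrightarrow> merging u B E \<epsilon> y z \<and> 0 < area \<sigma> (y - c) (z - c) \<and>
     (\<forall>x. conn (deep u (E + \<epsilon>)) y x \<longrightarrow> 0 < area \<sigma> (x - c) r)" for \<epsilon> y z
  have ex: "\<exists>y z. P \<epsilon> y z" if "0 < \<epsilon>" for \<epsilon> using ty that unfolding sided_def P_def by blast
  have mono: "P \<epsilon>' y z" if p: "P \<epsilon> y z" and le: "\<epsilon> \<le> \<epsilon>'" for \<epsilon> \<epsilon>' y z
  proof -
    have "conn (deep u (E + \<epsilon>)) y x" if "conn (deep u (E + \<epsilon>')) y x" for x
      using conn_deep_anti[OF that, of "E + \<epsilon>"] le by simp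
    then show ?thesis using p merging_mono[OF _ le] unfolding P_def by blast
  qed
  have "\<exists>y z. y \<in> deep u s0 \<and> z \<in> deep u s0 \<and>
    (\<forall>\<epsilon>>0. \<exists>y' z'. conn (deep u s0) y y' \<and> conn (deep u s0) z z' \<and> P \<epsilon> y' z')"
    unfolding s0_def
    by (rule witnesses_in_one_component[where P = P, OF u BE(2) ex mono]) (auto simp: P_def)
  then obtain y z where yz: "y \<in> deep u s0" "z \<in> deep u s0" and
    w: "\<And>\<epsilon>. 0 < \<epsilon> \<Longrightarrow> \<exists>y' z'. conn (deep u s0) y y' \<and> conn (deep u s0) z z' \<and> P \<epsilon> y' z'"
    by (elim exE conjE) metis
  have w': "\<exists>y' z'. conn (deep u ((B + E) / 2)) y y' \<and> conn (deep u ((B + E) / 2)) z z' \<and> merging u B E \<epsilon> y' z'"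
    if "0 < \<epsilon>" for \<epsilon> using w[OF that] unfolding s0_def P_def by blast
  note levels = merging_conn_levels[OF BE(2) w']
  obtain sl where sl: "E < sl" "sl \<le> s0"
    "\<And>t x. x \<in> deep u s0 \<Longrightarrow> E < t \<Longrightarrow> conn (deep u t) y x \<Longrightarrow> conn (deep u sl) y x"
    using stable_level[OF u s0(1), of y] by blast
  have near_y: "\<exists>y' z'. conn (deep u s0) y y' \<and> P \<epsilon> y' z' \<and> conn (deep u (E + \<epsilon>)) y' x \<and> 0 < \<epsilon> \<and> \<epsilon> \<le> \<epsilon>0"
    if x: "E < t" "conn (deep u t) y x" and e: "\<epsilon> = min \<epsilon>0 (min (t - E) (s0 - E))" "0 < \<epsilon>0" for t x \<epsilon> \<epsilon>0
  proof -
    have e': "0 < \<epsilon>" "\<epsilon> \<le> \<epsilon>0" "E + \<epsilon> \<le> t" "E + \<epsilon> \<le> s0" using e x s0 by (auto simp: min_def)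
    obtain y' z' where *: "conn (deep u s0) y y'" "P \<epsilon> y' z'" using w[OF e'(1)] by blast
    have "conn (deep u (E + \<epsilon>)) y' x"
      using conn_deep_anti[OF *(1) e'(4)] conn_deep_anti[OF x(2) e'(3)]
        connected_component_trans connected_component_sym by metis
    then show ?thesis using * e' by blast
  qed
  have "valley \<sigma> u B E r s0 sl y z" unfolding valley_def
  proof (intro conjI allI impI)
    fix t x assume t: "E < t" "conn (deep u t) y x"
    show "depth u x \<le> B"
    proof (rule field_le_epsilon)
      fix e :: real assume "0 < e"
      then obtain y' z' \<epsilon> where "P \<epsilon> y' z'" "conn (deep u (E + \<epsilon>)) y' x" "\<epsilon> \<le> e"
        using near_y[OF t refl] by blast
      then show "depth u x \<le> B + e" unfolding P_def merging_def by fastforce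
    qed
    show "0 < area \<sigma> (x - c) r" using near_y[OF t refl, of 1] unfolding P_def by auto
  next
    fix \<epsilon> :: real assume "0 < \<epsilon>"
    then obtain y' z' where "conn (deep u s0) y y'" "conn (deep u s0) z z'" "P \<epsilon> y' z'" using w by blast
    then show "\<exists>y'. conn (deep u s0) y y' \<and> B - \<epsilon> \<le> depth u y'"
      "\<exists>z'. conn (deep u s0) z z' \<and> B - \<epsilon> \<le> depth u z'" unfolding P_def merging_def by blast+
  next
    obtain y' z' where *: "conn (deep u s0) y y'" "conn (deep u s0) z z'" "P 1 y' z'" using w[of 1] by auto
    have n: "\<not> conn (deep u s0) y z" using levels(1) s0 by blast
    have n': "\<not> conn (deep u s0) y' z" "\<not> conn (deep u s0) z' y'"
      using n * connected_component_trans connected_component_sym by metis+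
    have p: "0 < area \<sigma> (y' - c) (z' - c)" using *(3) by (simp add: P_def)
    have "y' \<in> deep u s0" using connected_component_in[OF *(1)] by blast
    then have "0 < area \<sigma> (y' - c) (z - c)"
      by (rule side_const'[OF s s0(2) _ connected_component_sym[OF *(2)] n'(2) p])
    then show "0 < area \<sigma> (y - c) (z - c)"
      by (rule side_const[OF s s0(2) yz(2) connected_component_sym[OF *(1)] n'(1)])
  qed (use sl yz levels s0_def in blast)+
  then show ?thesis by blast
qed

text \<open>
  When the direction turns towards \<open>\<sigma>\<close>, the depth of \<open>p\<close> changes by at least the factor for \<open>a\<close> if \<open>p\<close> is on the
  side \<open>\<sigma>\<close> of \<open>a\<close>, and by at most this factor if \<open>p\<close> is on the other side.
\<close>

lemma depth_ratio:
  assumes s: "\<sigma> * \<sigma> = 1" and turn: "0 \<le> area \<sigma> u u'" and a: "0 < depth u a"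
  shows "0 \<le> area \<sigma> (a - c) (p - c) \<Longrightarrow> depth u' a / depth u a * depth u p \<le> depth u' p"
    and "area \<sigma> (a - c) (p - c) \<le> 0 \<Longrightarrow> depth u' p \<le> depth u' a / depth u a * depth u p"
proof -
  have id: "depth u a * depth u' p - depth u p * depth u' a = area \<sigma> (a - c) (p - c) * area \<sigma> u u'"
    using area_lagrange[OF s, of "a - c" u "p - c" u'] by (simp add: depth_def)
  show "0 \<le> area \<sigma> (a - c) (p - c) \<Longrightarrow> depth u' a / depth u a * depth u p \<le> depth u' p"
  proof -
    assume "0 \<le> area \<sigma> (a - c) (p - c)"
    then have "depth u p * depth u' a \<le> depth u a * depth u' p"
      using id mult_nonneg_nonneg[OF _ turn] by (metis diff_ge_0_iff_ge)
    then show ?thesis using a by (simp add: field_simps)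
  qed
  show "area \<sigma> (a - c) (p - c) \<le> 0 \<Longrightarrow> depth u' p \<le> depth u' a / depth u a * depth u p"
  proof -
    assume "area \<sigma> (a - c) (p - c) \<le> 0"
    then have "depth u a * depth u' p \<le> depth u p * depth u' a"
      using id mult_nonpos_nonneg[OF _ turn] by (metis diff_le_0_iff_le)
    then show ?thesis using a by (simp add: field_simps)
  qed
qed

lemma area_ray: "area \<sigma> a (c + k *\<^sub>R w - c) = k * area \<sigma> a w" "area \<sigma> (c + k *\<^sub>R w - c) a = k * area \<sigma> w a"
  by (simp_all add: area_simps(3,4))

lemma not_meets_depth:
  assumes "\<not> meets u e w" "meets u' e' w"
  shows "\<exists>k\<ge>0. c + k *\<^sub>R w \<in> M \<and> e' \<le> depth u' (c + k *\<^sub>R w) \<and> depth u (c + k *\<^sub>R w) < e"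
  using assms unfolding meets_def deep_def by (metis (mono_tags, lifting) mem_Collect_eq not_le)

text \<open>
  The new birth depth \<open>B'\<close> is the new depth of the old component \<open>K\<close> of \<open>y\<close>, and the new death depth \<open>E'\<close> is the
  level at which \<open>y\<close> is joined, on the side \<open>\<sigma>\<close>, to points outside \<open>K\<close> that come close to the depth \<open>B'\<close>. What could go
  wrong is that above \<open>E'\<close> the component of \<open>y\<close> is joined to a deeper one, or crosses the ray \<open>r\<close>. Either way it
  has passed a ray \<open>w\<close>, before or beyond \<open>y\<close>, that used to reach the old level \<open>E\<close> at most barely. The rays further on the
  side \<open>\<sigma>\<close> than \<open>w\<close> gain at least as much depth as \<open>w\<close>, by \<open>depth_ratio\<close>, and all rays between \<open>y\<close> and \<open>z\<close> did
  reach the level \<open>E\<close>; so they now reach beyond the level \<open>E'\<close>, and \<open>y\<close> and \<open>z\<close> are joined too early.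
\<close>

lemma sided_forward_near:
  assumes ss: "\<sigma> * \<sigma> = 1" and val: "valley \<sigma> u B E r s0 s y z"
    and BE: "0 \<le> E" "E < B" and r: "0 < r \<bullet> u" "0 < r \<bullet> u'"
    and \<delta>: "0 < \<delta>" "4 * \<delta> \<le> s - E" "16 * \<delta> \<le> B - E" and cl: "close_dirs \<delta> u u'"
    and turn: "0 \<le> area \<sigma> u u'"
  shows "\<exists>B' E'. \<bar>B' - B\<bar> \<le> \<delta> \<and> \<bar>E' - E\<bar> \<le> \<delta> \<and> 0 \<le> E' \<and> sided \<sigma> u' B' E' r"
proof -
  have v: "E < s" "s \<le> s0" "s0 = (B + E) / 2" "y \<in> deep u s0" "z \<in> deep u s0"
    and v_le: "\<And>t x. E < t \<Longrightarrow> conn (deep u t) y x \<Longrightarrow> depth u x \<le> B"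
    and v_y: "\<And>\<epsilon>. 0 < \<epsilon> \<Longrightarrow> \<exists>y'. conn (deep u s0) y y' \<and> B - \<epsilon> \<le> depth u y'"
    and v_z: "\<And>\<epsilon>. 0 < \<epsilon> \<Longrightarrow> \<exists>z'. conn (deep u s0) z z' \<and> B - \<epsilon> \<le> depth u z'"
    and v_conn: "\<And>t. t < E \<Longrightarrow> conn (deep u t) y z" and v_nconn: "\<And>t. E < t \<Longrightarrow> \<not> conn (deep u t) y z"
    and v_yz: "0 < area \<sigma> (y - c) (z - c)"
    and v_r: "\<And>t x. E < t \<Longrightarrow> conn (deep u t) y x \<Longrightarrow> 0 < area \<sigma> (x - c) r"
    and v_S: "\<And>t x. x \<in> deep u s0 \<Longrightarrow> E < t \<Longrightarrow> conn (deep u t) y x \<Longrightarrow> conn (deep u s) y x"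
    using val unfolding valley_def by blast+
  have s_pos: "0 < s" "0 < s0" "E < s0" "s0 < B" using v BE by auto
  have s0_gap: "B = 2 * s0 - E" using v(3) by (simp add: field_simps)
  have cl': "close_dirs \<delta> u' u" using cl close_dirs_sym by blast
  have cd: "\<bar>depth u x - depth u' x\<bar> \<le> \<delta>" if "x \<in> M" for x
    using cl that by (auto simp: close_dirs_def)
  have to_u': "conn (deep u' e') x q" if "conn (deep u e) x q" "e' + \<delta> \<le> e" for e e' x q
    by (rule conn_shift[OF that(1) cl that(2)])
  have to_u: "conn (deep u e') x q" if "conn (deep u' e) x q" "e' + \<delta> \<le> e" for e e' x q
    by (rule conn_shift[OF that(1) cl' that(2)])
  have yz_M: "y \<in> M" "z \<in> M" "s0 \<le> depth u y" "s0 \<le> depth u z" using v by (auto simp: deep_def)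
  have yz': "s0 - \<delta> \<le> depth u' y" "s0 - \<delta> \<le> depth u' z" using yz_M cd[of y] cd[of z] by auto
  have d_pos: "0 < depth u y" "0 < depth u z" "0 < depth u' y" "0 < depth u' z"
  proof -
    have "8 * \<delta> \<le> s0" using s0_gap \<delta>(3) BE(1) by linarith
    then show "0 < depth u' y" "0 < depth u' z" using yz' \<delta>(1) by linarith+
  qed (use yz_M s_pos in linarith)+
  have yy: "conn (deep u s) y y" using v deep_anti[of s s0 u] by auto

  define K where "K = {x. conn (deep u s) y x}"
  have yK: "y \<in> K" using yy by (simp add: K_def)
  have K_d: "x \<in> M" "depth u x \<le> B" "s \<le> depth u x" "depth u' x \<le> B + \<delta>" if "x \<in> K" for x
  proof -
    have x: "conn (deep u s) y x" using that by (simp add: K_def)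
    show "x \<in> M" "depth u x \<le> B" "s \<le> depth u x" using v_le[OF v(1) x] conn_deepD[OF x] by auto
    then show "depth u' x \<le> B + \<delta>" using cd[of x] by linarith
  qed
  define B' where "B' = Sup (depth u' ` K)"
  have bdd: "bdd_above (depth u' ` K)" using K_d(4) by (intro bdd_aboveI2[of _ _ "B + \<delta>"]) auto
  have B'_ge: "depth u' x \<le> B'" if "x \<in> K" for x
    unfolding B'_def using that bdd by (intro cSUP_upper)
  have B'_less: "\<exists>x\<in>K. B' - e < depth u' x" if "0 < e" for e
    using less_cSUP_iff[OF _ bdd, of "B' - e"] yK that unfolding B'_def by auto
  have B'1: "B' \<le> B + \<delta>" unfolding B'_def using yK K_d(4) by (intro cSUP_least) auto
  have B'2: "B - \<delta> \<le> B'"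
  proof (rule field_le_epsilon)
    fix e :: real assume "0 < e"
    then obtain y' where y': "conn (deep u s0) y y'" "B - e \<le> depth u y'" using v_y by blast
    then have "y' \<in> K" using conn_deep_anti[OF y'(1) v(2)] by (simp add: K_def)
    then show "B - \<delta> \<le> B' + e" using B'_ge[of y'] cd[of y'] K_d(1) y'(2) by fastforce
  qed
  have B'_pos: "0 < B'" using B'2 \<delta> BE by linarith

  define Q where "Q t \<longleftrightarrow> (\<forall>\<epsilon>>0. \<exists>x. 0 < area \<sigma> (y - c) (x - c) \<and> \<not> conn (deep u s) y x \<and>
      B' - \<epsilon> < depth u' x \<and> conn (deep u' t) y x)" for t
  have Q_mono: "Q t'" if "Q t" "t' \<le> t" for t t'
    using that conn_deep_anti[of u' t y _ t'] unfolding Q_def by blast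
  have z'_ex: "\<exists>z'. conn (deep u s0) z z' \<and> B' - \<epsilon> < depth u' z' \<and> 0 < area \<sigma> (y - c) (z' - c) \<and>
      \<not> conn (deep u s) y z'" if e: "0 < \<epsilon>" for \<epsilon>
  proof -
    \<comment> \<open>Points of the component of \<open>z\<close> gain depth relative to \<open>K\<close>, so that old depth above \<open>B - \<theta>\<close> gives new depth above \<open>(1 - \<theta> / B) * B'\<close>.\<close>
    define \<theta> where "\<theta> = min (\<epsilon> * B / (2 * B')) (B / 2)"
    have B: "0 < B" using BE by simp
    have t: "0 < \<theta>" "\<theta> \<le> \<epsilon> * B / (2 * B')" "\<theta> < B"
    proof -
      have "0 < \<epsilon> * B / (2 * B')" using e B B'_pos by simp
      then show "0 < \<theta>" using B by (simp add: \<theta>_def)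
      show "\<theta> \<le> \<epsilon> * B / (2 * B')" by (simp add: \<theta>_def)
      have "\<theta> \<le> B / 2" by (simp add: \<theta>_def)
      then show "\<theta> < B" using B by simp
    qed
    obtain z' where z': "conn (deep u s0) z z'" "B - \<theta> \<le> depth u z'" using v_z t by blast
    have n: "\<not> conn (deep u s) y z'"
      using v_nconn[OF v(1)] conn_deep_anti[OF z'(1) v(2)] connected_component_trans
        connected_component_sym by metis
    have z'M: "z' \<in> M" "s0 \<le> depth u z'" "z' \<in> deep u s0" "z' \<in> deep u s"
      using conn_deepD[OF z'(1)] v(2) by (auto simp: deep_def)
    have "\<not> conn (deep u s0) z y" using v_nconn[OF s_pos(3)] connected_component_sym by metis
    then have a: "0 < area \<sigma> (y - c) (z' - c)" by (rule side_const'[OF ss s_pos(2) v(4) z'(1) _ v_yz])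
    have z'pos: "0 < depth u z'" "0 < depth u' z'"
      using z'M cd[OF z'M(1)] s_pos \<delta> BE s0_gap by linarith+
    have "depth u' k \<le> B / (B - \<theta>) * depth u' z'" if k: "k \<in> K" for k
    proof -
      have "0 < area \<sigma> (k - c) (z' - c)"
        using k by (intro side_const[OF ss s_pos(1) z'M(4) _ n a]) (simp add: K_def)
      then have "area \<sigma> (z' - c) (k - c) \<le> 0" by (simp add: area_flip[of \<sigma> "z' - c"])
      then have "depth u' k \<le> depth u' z' / depth u z' * depth u k"
        by (rule depth_ratio(2)[OF ss turn z'pos(1)])
      also have "\<dots> \<le> depth u' z' / depth u z' * B"
        using z'pos K_d(2)[OF k] by (intro mult_left_mono) auto
      also have "\<dots> \<le> depth u' z' / (B - \<theta>) * B"
        using z'pos z'(2) t B by (intro mult_right_mono divide_left_mono) auto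
      finally show ?thesis by (simp add: mult.commute)
    qed
    then have "B' \<le> B / (B - \<theta>) * depth u' z'" unfolding B'_def using yK by (intro cSUP_least) auto
    then have "B' * (B - \<theta>) \<le> B * depth u' z'" using t by (simp add: field_simps)
    moreover have "\<theta> * (2 * B') \<le> \<epsilon> * B" using t(2) B'_pos by (simp add: field_simps)
    moreover have "0 < \<epsilon> * B" using e B by simp
    ultimately have "(B' - \<epsilon>) * B < depth u' z' * B" by (simp add: algebra_simps)
    then have "B' - \<epsilon> < depth u' z'" using B by simp
    then show ?thesis using z' n a by blast
  qed
  have Qz: "Q t" if t: "conn (deep u' t) y z" "t \<le> s0 - \<delta>" for t
    unfolding Q_def
  proof (intro allI impI)
    fix \<epsilon> :: real assume "0 < \<epsilon>"
    then obtain z' where z': "conn (deep u s0) z z'" "B' - \<epsilon> < depth u' z'" "0 < area \<sigma> (y - c) (z' - c)"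
      "\<not> conn (deep u s) y z'" using z'_ex by blast
    have "conn (deep u' t) z z'" using to_u'[OF z'(1)] t(2) by simp
    then show "\<exists>x. 0 < area \<sigma> (y - c) (x - c) \<and> \<not> conn (deep u s) y x \<and>
      B' - \<epsilon> < depth u' x \<and> conn (deep u' t) y x"
      using z' connected_component_trans[OF t(1)] by blast
  qed
  have Q_up: "t \<le> E + \<delta>" if "Q t" for t
  proof (rule ccontr)
    assume neg: "\<not> t \<le> E + \<delta>"
    obtain x where x: "\<not> conn (deep u s) y x" "B' - \<delta> < depth u' x" "conn (deep u' t) y x"
      using \<open>Q t\<close> \<delta>(1) unfolding Q_def by blast
    have "conn (deep u (t - \<delta>)) y x" by (rule to_u[OF x(3)]) simp
    moreover have "x \<in> deep u s0"
      using conn_deepD[OF x(3)] x(2) cd[of x] B'2 \<delta> s0_gap by (auto simp: deep_def)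
    ultimately show False using v_S[of x "t - \<delta>"] x(1) neg by simp
  qed
  define E' where "E' = Sup {t. Q t}"
  have bddQ: "bdd_above {t. Q t}" using Q_up by (intro bdd_aboveI[of _ "E + \<delta>"]) auto
  have Q0: "Q 0"
  proof (rule Qz)
    have "conn (deep u' 0) y c" "conn (deep u' 0) z c"
      using yz_M d_pos by (auto intro: deep_segment)
    then show "conn (deep u' 0) y z" using connected_component_trans connected_component_sym by metis
    show "0 \<le> s0 - \<delta>" using s_pos \<delta> s0_gap BE by linarith
  qed
  have E'_up: "\<not> Q t" if "E' < t" for t
    using that bddQ cSup_upper[of t "{t. Q t}"] unfolding E'_def by auto
  have E'_low: "Q t" if t: "t < E'" for t
  proof -
    obtain t' where "Q t'" "t < t'"
      using less_cSup_iff[of "{t. Q t}" t] Q0 bddQ t unfolding E'_def by auto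
    then show ?thesis using Q_mono by simp
  qed
  have E'0: "0 \<le> E'" unfolding E'_def using Q0 bddQ by (intro cSup_upper) auto
  have E'1: "E' \<le> E + \<delta>" unfolding E'_def using Q0 Q_up by (intro cSup_least) auto
  have E'2: "E - \<delta> \<le> E'"
  proof (rule field_le_epsilon)
    fix e :: real assume e: "0 < e"
    have "Q (E - \<delta> - e)"
    proof (rule Qz)
      show "conn (deep u' (E - \<delta> - e)) y z" using to_u'[OF v_conn[of "E - e"]] e by simp
    qed (use s_pos e in simp)
    then have "E - \<delta> - e \<le> E'" unfolding E'_def using bddQ by (intro cSup_upper) auto
    then show "E - \<delta> \<le> E' + e" by simp
  qed
  have no_yz: "\<not> conn (deep u' t) y z" if "E' < t" "t \<le> s0 - \<delta>" for t
    using Qz E'_up that by blast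

  have small: "\<exists>y' z'. merging u' B' E' \<epsilon> y' z' \<and> 0 < area \<sigma> (y' - c) (z' - c) \<and>
     (\<forall>x. conn (deep u' (E' + \<epsilon>)) y' x \<longrightarrow> 0 < area \<sigma> (x - c) r)"
    if e: "0 < \<epsilon>" "4 * \<epsilon> \<le> s - E" "16 * \<epsilon> \<le> B - E" for \<epsilon>
  proof -
    define t0 where "t0 = E' + \<epsilon>"
    have t0: "0 < t0" "t0 \<le> s - \<delta>" "t0 \<le> s0 - \<delta>" using E'0 e E'1 \<delta> v(2) by (auto simp: t0_def)
    have t0': "0 < E' + \<epsilon> / 2" "E' < E' + \<epsilon> / 2" "E' + \<epsilon> / 2 \<le> s0 - \<delta>" "t0 - \<epsilon> / 2 = E' + \<epsilon> / 2"
      using t0 e E'0 by (auto simp: t0_def)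
    have yz_in: "y \<in> deep u' (E' + \<epsilon> / 2)" "z \<in> deep u' (E' + \<epsilon> / 2)"
      using yz_M yz' t0' by (auto simp: deep_def)
    \<comment> \<open>Before the turn, all rays between \<open>y\<close> and \<open>z\<close> reach every level below \<open>E\<close>.\<close>
    have reach: "\<exists>k\<ge>0. c + k *\<^sub>R w \<in> M \<and> E - \<theta> \<le> depth u (c + k *\<^sub>R w)"
      if w: "w \<noteq> 0" "0 \<le> area \<sigma> (y - c) w" "0 \<le> area \<sigma> w (z - c)" and \<theta>: "0 < \<theta>" for w \<theta>
    proof -
      have "conn (deep u (E - \<theta>)) y z" using v_conn \<theta> by simp
      from conn_imp_meets[OF ss this v_yz d_pos(1,2) w(2,3)] w(1)
      show ?thesis by (auto simp: meets_def deep_def)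
    qed
    \<comment> \<open>Not all of these rays reach the level \<open>E' + \<epsilon> / 2\<close> after the turn, as \<open>y\<close> and \<open>z\<close> are not joined there.\<close>
    have contra: False
      if "\<And>w. w \<noteq> 0 \<Longrightarrow> 0 \<le> area \<sigma> (y - c) w \<Longrightarrow> 0 \<le> area \<sigma> w (z - c) \<Longrightarrow> meets u' (E' + \<epsilon> / 2) w"
      using meets_imp_conn[OF ss t0'(1) yz_in v_yz that] no_yz[OF t0'(2,3)] by blast
    \<comment> \<open>The component of \<open>y\<close> is not joined to a deeper one on the side away from \<open>\<sigma>\<close>.\<close>
    have left: "depth u' x < B' + \<epsilon>" if x: "conn (deep u' t0) y x" for x
    proof (rule ccontr)
      assume "\<not> depth u' x < B' + \<epsilon>"
      then have dx: "B' + \<epsilon> \<le> depth u' x" by simp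
      have xM: "x \<in> M" using conn_deepD[OF x] by simp
      have xs0: "x \<in> deep u s0" using dx xM cd[OF xM] B'2 \<delta> s0_gap e by (auto simp: deep_def)
      then have xs: "x \<in> deep u s" using deep_anti[OF v(2)] by blast
      have nK: "\<not> conn (deep u s) y x" using B'_ge[of x] dx e by (auto simp: K_def)
      have far: "\<not> conn (deep u t) y x" if "E < t" for t using v_S[OF xs0 that] nK by blast
      show False
      proof (cases "0 < area \<sigma> (y - c) (x - c)")
        case True
        have "Q t0" unfolding Q_def
          using True nK dx x e by (intro allI impI exI[of _ x]) auto
        then show False using E'_up[of t0] e by (simp add: t0_def)
      next
        case False
        have "area \<sigma> (y - c) (x - c) \<noteq> 0"
          using conn_same_ray[OF ss s_pos(1) _ xs, of y] yy nK connected_component_in by blast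
        then have neg: "area \<sigma> (y - c) (x - c) < 0" using False by simp
        then have pos: "0 < area \<sigma> (x - c) (y - c)" by (simp add: area_flip[of \<sigma> "x - c"])
        \<comment> \<open>The factor for \<open>y\<close> separates the ray \<open>w\<close> between \<open>x\<close> and \<open>y\<close> from the rays between \<open>y\<close> and \<open>z\<close>.\<close>
        define \<rho> where "\<rho> = depth u' y / depth u y"
        have \<rho>: "0 < \<rho>" using d_pos by (simp add: \<rho>_def)
        define \<theta> where "\<theta> = min (\<epsilon> / (4 * \<rho>)) (s0 - E)"
        have \<theta>: "0 < \<theta>" "\<rho> * \<theta> \<le> \<epsilon> / 4" "E + \<theta> \<le> s0"
          using e \<rho> s_pos by (auto simp: \<theta>_def min_def field_simps)
        have in_th: "x \<in> deep u (E + \<theta>)" "y \<in> deep u (E + \<theta>)"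
          using xs0 v(4) deep_anti[OF \<theta>(3)] by blast+
        have nxy: "\<not> conn (deep u (E + \<theta>)) x y"
          using far[of "E + \<theta>"] \<theta>(1) connected_component_sym by fastforce
        have dx_pos: "0 < depth u x" "0 < depth u' x"
          using xs0 s_pos dx B'_pos e by (auto simp: deep_def)
        obtain w where w: "w \<noteq> 0" "0 \<le> area \<sigma> (x - c) w" "0 \<le> area \<sigma> w (y - c)" "\<not> meets u (E + \<theta>) w"
          using meets_imp_conn[OF ss _ in_th pos] nxy \<theta> BE by (metis add_nonneg_pos)
        have "meets u' t0 w"
          using conn_imp_meets[OF ss connected_component_sym[OF x] pos dx_pos(2) d_pos(3) w(2,3)] w(1) by blast
        then obtain k where k: "0 \<le> k" "t0 \<le> depth u' (c + k *\<^sub>R w)" "depth u (c + k *\<^sub>R w) < E + \<theta>"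
          using not_meets_depth[OF w(4)] by blast
        have "area \<sigma> (y - c) (c + k *\<^sub>R w - c) \<le> 0"
          using k(1) w(3) unfolding area_ray area_flip[of \<sigma> "y - c" w] by simp
        then have "depth u' (c + k *\<^sub>R w) \<le> \<rho> * depth u (c + k *\<^sub>R w)"
          unfolding \<rho>_def by (rule depth_ratio(2)[OF ss turn d_pos(1)])
        also have "\<dots> < \<rho> * (E + \<theta>)" using k(3) \<rho> by simp
        finally have t0_less: "t0 < \<rho> * (E + \<theta>)" using k(2) by simp
        show False
        proof (rule contra)
          fix q assume q: "q \<noteq> 0" "0 \<le> area \<sigma> (y - c) q" "0 \<le> area \<sigma> q (z - c)"
          obtain l where l: "0 \<le> l" "c + l *\<^sub>R q \<in> M" "E - \<theta> \<le> depth u (c + l *\<^sub>R q)"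
            using reach[OF q \<theta>(1)] by blast
          have "\<rho> * (E - \<theta>) \<le> \<rho> * depth u (c + l *\<^sub>R q)" using l(3) \<rho> by simp
          also have "\<dots> \<le> depth u' (c + l *\<^sub>R q)"
            unfolding \<rho>_def using l(1) q(2)
            by (intro depth_ratio(1)[OF ss turn d_pos(1)]) (simp add: area_simps(3,4))
          finally have "E' + \<epsilon> / 2 \<le> depth u' (c + l *\<^sub>R q)"
            using t0_less \<theta>(2) t0'(4) by (simp add: algebra_simps)
          then show "meets u' (E' + \<epsilon> / 2) q" using l by (auto simp: meets_def deep_def)
        qed
      qed
    qed
    \<comment> \<open>The component of \<open>y\<close> does not cross the ray \<open>r\<close>; the factor is now that of a point \<open>p\<close> on a ray \<open>w\<close> between \<open>y\<close> and \<open>r\<close>.\<close>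
    have cut: "0 < area \<sigma> (x - c) r" if x: "conn (deep u' t0) y x" for x
    proof (rule ccontr)
      assume neg: "\<not> 0 < area \<sigma> (x - c) r"
      have yr: "0 < area \<sigma> (y - c) r" by (rule v_r[OF v(1) yy])
      obtain p0 where p0: "conn (deep u' t0) y p0" "area \<sigma> (p0 - c) r = 0"
        using area_sign_const[OF x _ yr] neg by blast
      have p0M: "p0 \<in> M" "t0 \<le> depth u' p0" using conn_deepD[OF p0(1)] by auto
      then obtain k0 where k0: "0 < k0" "p0 - c = k0 *\<^sub>R r"
        using same_ray[OF ss r(2), of "p0 - c"] p0(2) t0(1)
        by (auto simp: depth_def area_flip[of \<sigma> r])
      have yp0: "0 < area \<sigma> (y - c) (p0 - c)" using yr k0 by (simp add: area_simps)
      have p0_pos: "0 < depth u' p0" using p0M t0 by simp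
      have r0: "r \<noteq> 0" using r(1) by auto
      show False
      proof (cases "0 \<le> area \<sigma> (z - c) r")
        case True
        have "z \<in> deep u' t0" using yz_M yz' t0 by (auto simp: deep_def)
        moreover have "\<not> conn (deep u' t0) y z" using no_yz[of t0] t0 e by (simp add: t0_def)
        ultimately have "0 < area \<sigma> (p0 - c) (z - c)"
          by (intro side_const[OF ss t0(1) _ p0(1) _ v_yz])
        then have "area \<sigma> (z - c) r < 0"
          using k0 by (simp add: area_simps area_flip[of \<sigma> r] zero_less_mult_iff)
        with True show False by simp
      next
        case False
        then have rz: "0 < area \<sigma> r (z - c)" by (simp add: area_flip[of \<sigma> r])
        define \<rho>z where "\<rho>z = depth u' z / depth u z"
        have \<rho>z: "0 < \<rho>z" using d_pos by (simp add: \<rho>z_def)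
        define \<theta> where "\<theta> = min (\<epsilon> / (4 * \<rho>z)) (s0 - E)"
        have \<theta>: "0 < \<theta>" "\<rho>z * \<theta> \<le> \<epsilon> / 4" "E + \<theta> \<le> s0"
          using e \<rho>z s_pos by (auto simp: \<theta>_def min_def field_simps)
        have th_pos: "0 < E + \<theta>" "E < E + \<theta>" using BE \<theta> by auto
        have y_in: "y \<in> deep u (E + \<theta>)" using v(4) deep_anti[OF \<theta>(3)] by blast
        have "\<exists>w. w \<noteq> 0 \<and> 0 \<le> area \<sigma> (y - c) w \<and> 0 \<le> area \<sigma> w r \<and> \<not> meets u (E + \<theta>) w"
        proof (rule ccontr)
          assume no: "\<not> ?thesis"
          have m: "meets u (E + \<theta>) w" if "w \<noteq> 0" "0 \<le> area \<sigma> (y - c) w" "0 \<le> area \<sigma> w r" for w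
            using that no by blast
          obtain k1 where k1: "0 \<le> k1" "c + k1 *\<^sub>R r \<in> deep u (E + \<theta>)"
            using m[OF r0] yr by (auto simp: area_simps meets_def)
          then have "k1 \<noteq> 0" using th_pos by (auto simp: deep_def)
          then have k1p: "0 < k1" using k1 by simp
          have "conn (deep u (E + \<theta>)) y (c + k1 *\<^sub>R r)"
          proof (rule meets_imp_conn[OF ss th_pos(1) y_in k1(2)])
            show "0 < area \<sigma> (y - c) (c + k1 *\<^sub>R r - c)" using yr k1p by (simp add: area_simps(3,4))
            show "meets u (E + \<theta>) w" if "w \<noteq> 0" "0 \<le> area \<sigma> (y - c) w" "0 \<le> area \<sigma> w (c + k1 *\<^sub>R r - c)" for w
              using that k1p by (intro m) (auto simp: area_simps(3,4) zero_le_mult_iff)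
          qed
          from v_r[OF th_pos(2) this] show False by (simp add: area_simps(3,4,7))
        qed
        then obtain w where w: "w \<noteq> 0" "0 \<le> area \<sigma> (y - c) w" "0 \<le> area \<sigma> w r" "\<not> meets u (E + \<theta>) w"
          by blast
        have w_pos: "0 < w \<bullet> u"
          by (rule cone_nonneg_pos[OF yr w(2,3,1), of "\<lambda>w. w \<bullet> u"])
            (use d_pos r in \<open>auto simp: inner_add_left depth_def\<close>)
        have wz: "0 \<le> area \<sigma> w (z - c)"
          by (rule cone_nonneg[OF yr w(2,3), of "\<lambda>w. area \<sigma> w (z - c)"])
            (use v_yz rz in \<open>auto simp: area_simps(1,3)\<close>)
        have "0 \<le> area \<sigma> w (p0 - c)" using w(3) k0 by (simp add: area_simps)
        then have "meets u' t0 w"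
          using conn_imp_meets[OF ss p0(1) yp0 d_pos(3) p0_pos w(2)] w(1) by blast
        then obtain k where k: "0 \<le> k" "t0 \<le> depth u' (c + k *\<^sub>R w)" "depth u (c + k *\<^sub>R w) < E + \<theta>"
          using not_meets_depth[OF w(4)] by blast
        define p where "p = c + k *\<^sub>R w"
        have "k \<noteq> 0" using k(2) t0(1) by auto
        then have kp: "0 < k" using k(1) by simp
        have p_pos: "0 < depth u p" "0 < depth u' p" using kp w_pos k(2) t0(1) by (auto simp: p_def)
        define \<rho> where "\<rho> = depth u' p / depth u p"
        have \<rho>: "0 < \<rho>" using p_pos by (simp add: \<rho>_def)
        have "\<rho> * depth u z \<le> depth u' z" unfolding \<rho>_def
          using kp wz by (intro depth_ratio(1)[OF ss turn p_pos(1)]) (simp add: p_def area_simps(3,4))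
        then have "\<rho> \<le> \<rho>z" using d_pos by (simp add: \<rho>z_def field_simps)
        then have \<rho>\<theta>: "\<rho> * \<theta> \<le> \<epsilon> / 4" using \<theta> mult_right_mono[of \<rho> \<rho>z \<theta>] by linarith
        have "depth u' p = \<rho> * depth u p" using p_pos by (simp add: \<rho>_def)
        also have "\<dots> < \<rho> * (E + \<theta>)" using k(3) \<rho> by (simp add: p_def)
        finally have t0_less: "t0 < \<rho> * (E + \<theta>)" using k(2) by (simp add: p_def)
        show False
        proof (rule contra)
          fix q assume q: "q \<noteq> 0" "0 \<le> area \<sigma> (y - c) q" "0 \<le> area \<sigma> q (z - c)"
          show "meets u' (E' + \<epsilon> / 2) q"
          proof (cases "0 \<le> area \<sigma> q r")
            case True
            then have "0 \<le> area \<sigma> q (p0 - c)" using k0 by (simp add: area_simps)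
            then have "meets u' t0 q"
              using conn_imp_meets[OF ss p0(1) yp0 d_pos(3) p0_pos q(2)] q(1) by blast
            then show ?thesis using e by (auto simp: meets_def deep_def t0_def)
          next
            case False
            then have "0 \<le> area \<sigma> r q" by (simp add: area_flip[of \<sigma> r])
            then have wq: "0 \<le> area \<sigma> w q"
              by (intro cone_nonneg[OF yr w(2,3), of "\<lambda>w. area \<sigma> w q"])
                (use q(2) in \<open>auto simp: area_simps(1,3)\<close>)
            obtain l where l: "0 \<le> l" "c + l *\<^sub>R q \<in> M" "E - \<theta> \<le> depth u (c + l *\<^sub>R q)"
              using reach[OF q \<theta>(1)] by blast
            have "\<rho> * (E - \<theta>) \<le> \<rho> * depth u (c + l *\<^sub>R q)" using l(3) \<rho> by simp
            also have "\<dots> \<le> depth u' (c + l *\<^sub>R q)"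
              unfolding \<rho>_def using l(1) wq kp
              by (intro depth_ratio(1)[OF ss turn p_pos(1)]) (simp add: p_def area_simps(3,4))
            finally have "E' + \<epsilon> / 2 \<le> depth u' (c + l *\<^sub>R q)"
              using t0_less \<rho>\<theta> t0'(4) by (simp add: algebra_simps)
            then show ?thesis using l by (auto simp: meets_def deep_def)
          qed
        qed
      qed
    qed
    \<comment> \<open>Witnesses for the new bar: \<open>y'\<close> in \<open>K\<close> of depth near \<open>B'\<close>, and a point \<open>x\<close> that is joined to \<open>y\<close> at the level \<open>E' - \<epsilon>\<close> but not at \<open>E' + \<epsilon>\<close>.\<close>
    have "\<not> Q t0" using E'_up e by (simp add: t0_def)
    then obtain \<epsilon>2 where \<epsilon>2: "0 < \<epsilon>2" "\<And>x. 0 < area \<sigma> (y - c) (x - c) \<Longrightarrow> \<not> conn (deep u s) y x \<Longrightarrow>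
        B' - \<epsilon>2 < depth u' x \<Longrightarrow> \<not> conn (deep u' t0) y x"
      unfolding Q_def by blast
    have "Q (E' - \<epsilon>)" using E'_low e by simp
    then obtain x where x: "0 < area \<sigma> (y - c) (x - c)" "\<not> conn (deep u s) y x"
        "B' - min \<epsilon> \<epsilon>2 < depth u' x" "conn (deep u' (E' - \<epsilon>)) y x"
      using e \<epsilon>2(1) unfolding Q_def by (metis min_less_iff_conj)
    have nx: "\<not> conn (deep u' t0) y x" by (rule \<epsilon>2(2)[OF x(1,2)]) (use x(3) in linarith)
    obtain y' where y': "y' \<in> K" "B' - \<epsilon> < depth u' y'" using B'_less[OF e(1)] by blast
    have y'u: "conn (deep u s) y y'" using y' by (simp add: K_def)
    have y't0: "conn (deep u' t0) y y'" by (rule to_u'[OF y'u]) (use t0 in simp)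
    have xM: "x \<in> M" using conn_deepD[OF x(4)] by simp
    have "s0 \<le> depth u x" using x(3) cd[OF xM] B'2 e \<delta> s0_gap by linarith
    then have xs: "x \<in> deep u s" using xM v(2) by (simp add: deep_def)
    have "merging u' B' E' \<epsilon> y' x" unfolding merging_def
    proof (intro conjI allI impI)
      show "B' - \<epsilon> \<le> depth u' y'" "B' - \<epsilon> \<le> depth u' x" using y' x(3) by auto
      show "y' \<in> M" "x \<in> M" using K_d y' xM by auto
      have "conn (deep u' (E' - \<epsilon>)) y y'" using conn_deep_anti[OF y't0] e by (simp add: t0_def)
      then show "conn (deep u' (E' - \<epsilon>)) y' x"
        using x(4) connected_component_trans connected_component_sym by metis
      show "\<not> conn (deep u' (E' + \<epsilon>)) y' x"
        using nx y't0 connected_component_trans unfolding t0_def by metis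
      fix q assume "conn (deep u' (E' + \<epsilon>)) y' q"
      then have "conn (deep u' t0) y q" using y't0 connected_component_trans unfolding t0_def by metis
      then show "depth u' q < B' + \<epsilon>" by (rule left)
    qed
    moreover have "0 < area \<sigma> (y' - c) (x - c)"
      by (rule side_const[OF ss s_pos(1) xs y'u x(2,1)])
    moreover have "0 < area \<sigma> (q - c) r" if "conn (deep u' (E' + \<epsilon>)) y' q" for q
      using cut[of q] that y't0 connected_component_trans unfolding t0_def by metis
    ultimately show ?thesis by blast
  qed
  have "sided \<sigma> u' B' E' r" unfolding sided_def
  proof (intro allI impI)
    fix \<epsilon> :: real assume e: "0 < \<epsilon>"
    define \<theta> where "\<theta> = min \<epsilon> (min ((s - E) / 4) ((B - E) / 16))"
    have t: "0 < \<theta>" "\<theta> \<le> \<epsilon>" "4 * \<theta> \<le> s - E" "16 * \<theta> \<le> B - E"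
      using e v(1) BE by (auto simp: \<theta>_def min_def)
    obtain y' z' where yz: "merging u' B' E' \<theta> y' z'" "0 < area \<sigma> (y' - c) (z' - c)"
      "\<And>x. conn (deep u' (E' + \<theta>)) y' x \<Longrightarrow> 0 < area \<sigma> (x - c) r" using small[OF t(1,3,4)] by blast
    have "0 < area \<sigma> (x - c) r" if "conn (deep u' (E' + \<epsilon>)) y' x" for x
      using yz(3) conn_deep_anti[OF that, of "E' + \<theta>"] t(2) by simp
    then show "\<exists>y z. merging u' B' E' \<epsilon> y z \<and> 0 < area \<sigma> (y - c) (z - c) \<and>
        (\<forall>x. conn (deep u' (E' + \<epsilon>)) y x \<longrightarrow> 0 < area \<sigma> (x - c) r)"
      using merging_mono[OF yz(1) t(2)] yz(2) by blast
  qed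
  then show ?thesis using B'1 B'2 E'0 E'1 E'2 by (intro exI[of _ B'] exI[of _ E']) auto
qed

lemma sided_forward:
  assumes ss: "\<sigma> * \<sigma> = 1" and ty: "sided \<sigma> u B E r" and u: "norm u = 1"
    and BE: "0 \<le> E" "E < B" and r: "0 < r \<bullet> u" and \<eta>: "0 < \<eta>"
  shows "\<exists>\<kappa>>0. \<forall>u'. dist u u' < \<kappa> \<longrightarrow> 0 \<le> area \<sigma> u u' \<longrightarrow>
    (\<exists>B' E'. \<bar>B' - B\<bar> \<le> \<eta> \<and> \<bar>E' - E\<bar> \<le> \<eta> \<and> 0 \<le> E' \<and> sided \<sigma> u' B' E' r)"
proof -
  obtain s0 s y z where val: "valley \<sigma> u B E r s0 s y z" using sided_valley[OF ss ty u BE] by blast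
  then have s: "E < s" by (simp add: valley_def)
  define \<delta> where "\<delta> = min \<eta> (min ((s - E) / 4) ((B - E) / 16))"
  have \<delta>: "0 < \<delta>" "\<delta> \<le> \<eta>" "4 * \<delta> \<le> s - E" "16 * \<delta> \<le> B - E"
    using \<eta> s BE by (auto simp: \<delta>_def min_def)
  define \<kappa> where "\<kappa> = min (\<delta> / (2 * R + 1)) ((r \<bullet> u) / (norm r + 1))"
  have "0 < \<kappa>" using \<delta> R_nonneg r by (auto simp: \<kappa>_def add_nonneg_pos)
  moreover have "\<exists>B' E'. \<bar>B' - B\<bar> \<le> \<eta> \<and> \<bar>E' - E\<bar> \<le> \<eta> \<and> 0 \<le> E' \<and> sided \<sigma> u' B' E' r"
    if u': "dist u u' < \<kappa>" "0 \<le> area \<sigma> u u'" for u'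
  proof -
    have cl: "close_dirs \<delta> u u'" using u' \<delta> by (intro close_dirs_dist) (auto simp: \<kappa>_def)
    have n: "0 < norm r + 1" by (simp add: add_nonneg_pos)
    have "dist u u' * (norm r + 1) < r \<bullet> u" using u'(1) n by (simp add: \<kappa>_def field_simps)
    moreover have "r \<bullet> u - r \<bullet> u' \<le> norm r * dist u u'"
      using norm_cauchy_schwarz[of r "u - u'"] by (simp add: inner_diff_right dist_norm)
    moreover have "norm r * dist u u' \<le> dist u u' * (norm r + 1)" by (simp add: algebra_simps)
    ultimately have "0 < r \<bullet> u'" by linarith
    from sided_forward_near[OF ss val BE r this \<delta>(1,3,4) cl u'(2)]
    show ?thesis using \<delta>(2) by (meson order_trans)
  qed
  ultimately show ?thesis by blast
qed

end

section \<open>Paths of diagram points over the line of angles\<close>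

text \<open>
  Angles are used for \<open>u\<close>, so the diagram at the angle \<open>\<tau>\<close> is that of the direction \<open>- dir \<tau>\<close>.
\<close>

definition dir :: "real \<Rightarrow> real^2" where "dir \<tau> = vector [cos \<tau>, sin \<tau>]"

lemma dir_nth [simp]: "dir \<tau> $ 1 = cos \<tau>" "dir \<tau> $ 2 = sin \<tau>"
  by (simp_all add: dir_def)

lemma norm_dir [simp]: "norm (dir \<tau>) = 1"
  by (simp add: norm_eq_1 inner_plane flip: power2_eq_square)

lemma dir_in_sphere: "- dir \<tau> \<in> sphere 0 1" by simp

lemma area_dir: "area \<sigma> (dir a) (dir b) = \<sigma> * sin (b - a)"
  by (simp add: area_def sin_diff algebra_simps)

lemma dir_shift: "dir (\<tau> + 2 * pi * of_int k) = dir \<tau>"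
  unfolding dir_def using sin.plus_of_int[of \<tau> k] cos.plus_of_int[of \<tau> k] by (simp add: mult.commute mult.left_commute)

lemma dir_eq_iff: "dir a = dir b \<longleftrightarrow> (\<exists>k::int. a = b + 2 * pi * of_int k)"
proof
  assume "dir a = dir b"
  then have "sin a = sin b \<and> cos a = cos b" by (metis dir_nth)
  then obtain n where "a = b + 2 * pi * n" "n \<in> \<int>" using sin_cos_eq_iff by auto
  then show "\<exists>k::int. a = b + 2 * pi * of_int k" by (auto elim!: Ints_cases)
qed (auto simp: dir_shift)

lemma dir_surj:
  assumes "v \<in> sphere 0 1" shows "\<exists>\<tau>. v = - dir \<tau>"
proof -
  have "(- v $ 1)\<^sup>2 + (- v $ 2)\<^sup>2 = 1"
    using assms by (simp add: norm_eq_1 inner_plane flip: power2_eq_square)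
  then obtain t where "- v $ 1 = cos t" "- v $ 2 = sin t" by (rule sincos_total_2pi)
  then have "v = - dir t" by (simp add: vec_eq_iff forall_2)
  then show ?thesis by blast
qed

lemma dist_dir_le: "dist (dir a) (dir b) \<le> 2 * \<bar>a - b\<bar>"
proof -
  have "norm (dir a - dir b) \<le> (\<Sum>i\<in>UNIV. \<bar>(dir a - dir b) $ i\<bar>)" by (rule norm_le_l1_cart)
  also have "\<dots> = \<bar>cos a - cos b\<bar> + \<bar>sin a - sin b\<bar>" by (simp add: sum_2)
  finally have 1: "dist (dir a) (dir b) \<le> \<bar>cos a - cos b\<bar> + \<bar>sin a - sin b\<bar>"
    by (simp add: dist_norm)
  have half: "\<bar>2 * p * q\<bar> \<le> \<bar>a - b\<bar>" if "\<bar>p\<bar> \<le> 1" "\<bar>q\<bar> \<le> \<bar>a - b\<bar> / 2" for p q :: real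
  proof -
    have "\<bar>p\<bar> * \<bar>q\<bar> \<le> 1 * (\<bar>a - b\<bar> / 2)" using that by (intro mult_mono) auto
    then show ?thesis by (simp add: abs_mult)
  qed
  have "\<bar>cos a - cos b\<bar> \<le> \<bar>a - b\<bar>"
    unfolding cos_diff_cos using abs_sin_x_le_abs_x[of "(b - a) / 2"] by (intro half) (auto simp: abs_minus_commute)
  moreover have "\<bar>sin a - sin b\<bar> \<le> \<bar>a - b\<bar>"
    using half[of "cos ((a + b) / 2)" "sin ((a - b) / 2)"] abs_sin_x_le_abs_x[of "(a - b) / 2"]
    unfolding sin_diff_sin by (simp add: mult_ac)
  ultimately show ?thesis using 1 by simp
qed

text \<open>
  Directions near that of \<open>\<tau>\<close> have an angle near \<open>\<tau>\<close>: the chord between two directions is a strictly increasing function of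
  the angle up to a half turn.
\<close>

lemma dir_open:
  assumes "0 < \<kappa>"
  shows "\<exists>\<delta>>0. \<forall>v\<in>sphere 0 1. dist v (- dir \<tau>) < \<delta> \<longrightarrow> (\<exists>\<tau>'. \<bar>\<tau>' - \<tau>\<bar> < \<kappa> \<and> v = - dir \<tau>')"
proof -
  define \<mu> where "\<mu> = min \<kappa> pi"
  have l: "0 < \<mu>" "\<mu> \<le> pi" "\<mu> \<le> \<kappa>" using assms by (auto simp: \<mu>_def)
  define \<delta> where "\<delta> = 2 - 2 * cos \<mu>"
  have "cos \<mu> < 1" using cos_monotone_0_pi[of 0 \<mu>] l by simp
  then have d: "0 < \<delta>" by (simp add: \<delta>_def)
  have "\<exists>\<tau>'. \<bar>\<tau>' - \<tau>\<bar> < \<kappa> \<and> v = - dir \<tau>'" if v: "v \<in> sphere 0 1" "dist v (- dir \<tau>) < sqrt \<delta>" for v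
  proof -
    obtain a where a: "v = - dir a" using dir_surj[OF v(1)] by blast
    define k where "k = \<lfloor>(a - \<tau> + pi) / (2 * pi)\<rfloor>"
    define s where "s = a - \<tau> - 2 * pi * of_int k"
    have "of_int k \<le> (a - \<tau> + pi) / (2 * pi)" "(a - \<tau> + pi) / (2 * pi) < of_int k + 1"
      unfolding k_def by linarith+
    then have s: "- pi \<le> s" "s < pi" by (auto simp: s_def field_simps)
    have as: "a = (\<tau> + s) + 2 * pi * of_int k" by (simp add: s_def)
    then have va: "v = - dir (\<tau> + s)" using a dir_shift by simp
    have "(dist v (- dir \<tau>))\<^sup>2 = 2 - 2 * cos s"
    proof -
      have "(dist v (- dir \<tau>))\<^sup>2 = (cos (\<tau> + s) - cos \<tau>)\<^sup>2 + (sin (\<tau> + s) - sin \<tau>)\<^sup>2"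
        unfolding va dist_norm power2_norm_eq_inner inner_plane by (simp add: power2_eq_square algebra_simps)
      also have "\<dots> = ((cos (\<tau> + s))\<^sup>2 + (sin (\<tau> + s))\<^sup>2) + ((cos \<tau>)\<^sup>2 + (sin \<tau>)\<^sup>2)
          - 2 * (cos (\<tau> + s) * cos \<tau> + sin (\<tau> + s) * sin \<tau>)"
        by (simp only: power2_eq_square algebra_simps)
      also have "cos (\<tau> + s) * cos \<tau> + sin (\<tau> + s) * sin \<tau> = cos s"
        using cos_diff[of "\<tau> + s" \<tau>] by simp
      finally show ?thesis by simp
    qed
    moreover have "(dist v (- dir \<tau>))\<^sup>2 < \<delta>"
      using v(2) d by (metis real_sqrt_abs real_sqrt_less_iff zero_le_dist abs_of_nonneg)
    ultimately have "cos \<mu> < cos \<bar>s\<bar>" by (simp add: \<delta>_def)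
    then have "\<bar>s\<bar> < \<mu>"
      using cos_monotone_0_pi_le[of \<mu> "\<bar>s\<bar>"] l s by (cases "\<mu> \<le> \<bar>s\<bar>") (auto simp: abs_le_iff)
    then show ?thesis using va l by (intro exI[of _ "\<tau> + s"]) auto
  qed
  then show ?thesis using d by (intro exI[of _ "sqrt \<delta>"]) auto
qed

lemma real_induction:
  fixes P :: "real \<Rightarrow> bool"
  assumes "P a"
    and step: "\<And>t. a \<le> t \<Longrightarrow> t < b \<Longrightarrow> P t \<Longrightarrow> \<exists>\<kappa>>0. \<forall>t'. t \<le> t' \<longrightarrow> t' < t + \<kappa> \<longrightarrow> t' \<le> b \<longrightarrow> P t'"
    and lim: "\<And>t. a < t \<Longrightarrow> t \<le> b \<Longrightarrow> (\<And>s. a \<le> s \<Longrightarrow> s < t \<Longrightarrow> P s) \<Longrightarrow> P t"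
    and t: "a \<le> t" "t \<le> b"
  shows "P t"
proof (rule ccontr)
  assume n: "\<not> P t"
  define Z where "Z = {s. a \<le> s \<and> s \<le> b \<and> \<not> P s}"
  define m where "m = Inf Z"
  have Z: "t \<in> Z" "bdd_below Z" using n t by (auto simp: Z_def intro!: bdd_belowI[of _ a])
  have mt: "m \<le> t" unfolding m_def using Z by (intro cInf_lower)
  have am: "a \<le> m" unfolding m_def using Z by (intro cInf_greatest) (auto simp: Z_def)
  have below: "P s" if "a \<le> s" "s < m" for s
    using that cInf_lower[of s Z] Z mt t by (force simp: Z_def m_def)
  have Pm: "P m" using assms(1) lim[of m] below am mt t by (cases "a = m") auto
  have "m < b" using Pm n mt t by (cases "m = t") auto
  then obtain \<kappa> where k: "0 < \<kappa>" "\<And>t'. m \<le> t' \<Longrightarrow> t' < m + \<kappa> \<Longrightarrow> t' \<le> b \<Longrightarrow> P t'"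
    using step[OF am _ Pm] by blast
  have "m < m + \<kappa>" using k by simp
  then obtain s where "s \<in> Z" "s < m + \<kappa>" using cInf_lessD[of Z "m + \<kappa>"] Z by (auto simp: m_def)
  moreover have "m \<le> s" unfolding m_def using Z calculation by (intro cInf_lower)
  ultimately show False using k by (auto simp: Z_def)
qed

lemma near_dist: "near \<eta> x y \<Longrightarrow> dist x y \<le> 2 * \<eta>"
  unfolding near_def dist_prod_def dist_real_def
  using sqrt_sum_squares_le_sum_abs[of "\<bar>fst x - fst y\<bar>" "\<bar>snd x - snd y\<bar>"] by simp

lemma dist_near: "dist x y \<le> \<eta> \<Longrightarrow> near \<eta> x y"
  unfolding near_def using dist_fst_le[of x y] dist_snd_le[of x y] by (simp add: dist_real_def)

context plane_star
begin

definition Pos :: "real \<Rightarrow> (real \<times> real) set" where "Pos \<tau> = pos (- dir \<tau>)"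

lemma Pos_shift: "Pos (\<tau> + 2 * pi * of_int k) = Pos \<tau>"
  by (simp add: Pos_def dir_shift)

lemma height_close_dir:
  assumes "2 * \<bar>\<tau> - \<tau>'\<bar> \<le> \<delta> / (R + 1)" "0 \<le> \<delta>"
  shows "height_close \<delta> (- dir \<tau>) (- dir \<tau>')"
  using dist_dir_le[of \<tau> \<tau>'] assms by (intro height_close_dist) (auto simp: dist_minus)

text \<open>
  A neighbourhood of the angle \<open>\<rho>\<close> over which the points of positive length at \<open>\<rho>\<close> are matched with unique neighbours, and
  over which all other points are short.
\<close>

definition frame :: "real \<Rightarrow> real \<Rightarrow> real \<Rightarrow> bool" where
  "frame \<rho> \<eta> \<kappa> \<longleftrightarrow> 0 < \<eta> \<and> 0 < \<kappa> \<and> (\<forall>\<tau>. \<bar>\<tau> - \<rho>\<bar> < \<kappa> \<longrightarrow>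
     height_close (\<eta> / 2) (- dir \<rho>) (- dir \<tau>) \<and>
     (\<forall>x\<in>Pos \<rho>. \<exists>!y. y \<in> Pos \<tau> \<and> near \<eta> x y) \<and>
     (\<forall>y\<in>Pos \<tau>. 4 * \<eta> < len y \<longrightarrow> (\<exists>x\<in>Pos \<rho>. near \<eta> x y)))"

lemma frameD:
  assumes "frame \<rho> \<eta> \<kappa>"
  shows "0 < \<eta>" "0 < \<kappa>"
    "\<bar>\<tau> - \<rho>\<bar> < \<kappa> \<Longrightarrow> height_close (\<eta> / 2) (- dir \<rho>) (- dir \<tau>)"
    "\<bar>\<tau> - \<rho>\<bar> < \<kappa> \<Longrightarrow> x \<in> Pos \<rho> \<Longrightarrow> \<exists>!y. y \<in> Pos \<tau> \<and> near \<eta> x y"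
    "\<bar>\<tau> - \<rho>\<bar> < \<kappa> \<Longrightarrow> y \<in> Pos \<tau> \<Longrightarrow> 4 * \<eta> < len y \<Longrightarrow> \<exists>x\<in>Pos \<rho>. near \<eta> x y"
  using assms unfolding frame_def by simp_all

lemma frame_exists:
  assumes "0 < \<epsilon>" shows "\<exists>\<eta> \<kappa>. frame \<rho> \<eta> \<kappa> \<and> \<eta> < \<epsilon>"
proof -
  obtain \<eta> where \<eta>: "good_radius (- dir \<rho>) \<eta>" "\<eta> < \<epsilon>"
    using good_radius_exists[OF dir_in_sphere assms] by blast
  have pos: "0 < \<eta>" using good_radiusD(1)[OF \<eta>(1)] .
  define \<kappa> where "\<kappa> = \<eta> / 2 / (R + 1) / 2"
  have k: "0 < \<kappa>" using pos R_nonneg by (simp add: \<kappa>_def)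
  have cl: "height_close (\<eta> / 2) (- dir \<rho>) (- dir \<tau>)" if t: "\<bar>\<tau> - \<rho>\<bar> < \<kappa>" for \<tau>
  proof (rule height_close_dir)
    have "2 * \<bar>\<rho> - \<tau>\<bar> \<le> 2 * \<kappa>" using t by (simp add: abs_minus_commute less_imp_le)
    also have "2 * \<kappa> = \<eta> / 2 / (R + 1)" by (simp only: \<kappa>_def mult_2 field_sum_of_halves)
    finally show "2 * \<bar>\<rho> - \<tau>\<bar> \<le> \<eta> / 2 / (R + 1)" .
  qed (use pos in simp)
  have "frame \<rho> \<eta> \<kappa>" unfolding frame_def
  proof (intro conjI allI impI ballI)
    fix \<tau> x assume "\<bar>\<tau> - \<rho>\<bar> < \<kappa>" "x \<in> Pos \<rho>"
    then show "\<exists>!y. y \<in> Pos \<tau> \<and> near \<eta> x y"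
      using unique_near(1)[OF dir_in_sphere dir_in_sphere \<eta>(1) cl] unfolding Pos_def by blast
  next
    fix \<tau> y assume "\<bar>\<tau> - \<rho>\<bar> < \<kappa>" "y \<in> Pos \<tau>" "4 * \<eta> < len y"
    then show "\<exists>x\<in>Pos \<rho>. near \<eta> x y"
      using long_near_pos[OF dir_in_sphere dir_in_sphere pos cl] unfolding Pos_def pos_def by blast
  qed (use pos k cl in auto)
  then show ?thesis using \<eta>(2) by blast
qed

definition ispath :: "real set \<Rightarrow> (real \<Rightarrow> real \<times> real) \<Rightarrow> bool" where
  "ispath D \<gamma> \<longleftrightarrow> open D \<and> connected D \<and> continuous_on D \<gamma> \<and> (\<forall>\<tau>\<in>D. \<gamma> \<tau> \<in> Pos \<tau>)"

text \<open>
  A point \<open>y\<close> of length at least \<open>\<epsilon>\<close> near the angle \<open>\<tau>0\<close> is the neighbour of a point \<open>x\<close> at \<open>\<tau>0\<close>, and the neighbours of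
  \<open>x\<close> over the whole frame form a path. Two frames at \<open>\<tau>0\<close> are used: in the finer one, neighbours are so close
  to \<open>x\<close> that neighbours of neighbours still belong to the coarser one, which gives continuity. The size of
  the frame depends on \<open>\<epsilon>\<close> only, not on the point.
\<close>

lemma long_point_path:
  assumes "0 < \<epsilon>"
  shows "\<exists>\<kappa>>0. \<forall>\<tau> y. \<bar>\<tau> - \<tau>0\<bar> < \<kappa> \<longrightarrow> y \<in> Pos \<tau> \<longrightarrow> \<epsilon> \<le> len y \<longrightarrow>
    (\<exists>\<gamma>. ispath {\<tau>0 - \<kappa><..<\<tau>0 + \<kappa>} \<gamma> \<and> \<gamma> \<tau> = y)"
proof -
  obtain \<eta> \<kappa>1 where 1: "frame \<tau>0 \<eta> \<kappa>1" using frame_exists[OF assms] by blast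
  note 1 = frameD[OF 1]
  have "0 < min \<eta> (\<epsilon> / 4)" using 1 assms by simp
  then obtain \<theta> \<kappa>2 where loc2: "frame \<tau>0 \<theta> \<kappa>2" "\<theta> < min \<eta> (\<epsilon> / 4)"
    using frame_exists by blast
  have 2: "0 < \<theta>" "\<theta> < \<eta>" "4 * \<theta> < \<epsilon>" "0 < \<kappa>2" using frameD[OF loc2(1)] loc2(2) by auto
  define \<kappa> where "\<kappa> = min \<kappa>1 \<kappa>2"
  let ?I = "{\<tau>0 - \<kappa><..<\<tau>0 + \<kappa>}"
  have inI: "\<tau> \<in> ?I \<longleftrightarrow> \<bar>\<tau> - \<tau>0\<bar> < \<kappa>" for \<tau> by auto
  have "\<exists>\<gamma>. ispath ?I \<gamma> \<and> \<gamma> \<tau> = y" if y: "\<bar>\<tau> - \<tau>0\<bar> < \<kappa>" "y \<in> Pos \<tau>" "\<epsilon> \<le> len y" for \<tau> y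
  proof -
    obtain x where x: "x \<in> Pos \<tau>0" "near \<theta> x y" using frameD(5)[OF loc2(1), of \<tau> y] y 2(3) by (auto simp: \<kappa>_def)
    define \<gamma> where "\<gamma> \<sigma> = (THE y. y \<in> Pos \<sigma> \<and> near \<eta> x y)" for \<sigma>
    have \<gamma>_eq: "\<gamma> \<sigma> = y'" if "\<sigma> \<in> ?I" "y' \<in> Pos \<sigma>" "near \<eta> x y'" for \<sigma> y'
    proof -
      have "\<bar>\<sigma> - \<tau>0\<bar> < \<kappa>1" using inI that(1) by (simp add: \<kappa>_def)
      from the1_equality[OF 1(4)[OF this x(1)]] show ?thesis unfolding \<gamma>_def using that(2,3) by simp
    qed
    have \<gamma>: "\<gamma> \<sigma> \<in> Pos \<sigma>" "near \<theta> x (\<gamma> \<sigma>)" if s: "\<sigma> \<in> ?I" for \<sigma>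
    proof -
      obtain y' where y': "y' \<in> Pos \<sigma>" "near \<theta> x y'" using frameD(4)[OF loc2(1) _ x(1), of \<sigma>] s inI[of \<sigma>] unfolding \<kappa>_def by auto
      moreover have "near \<eta> x y'" by (rule near_mono[OF y'(2)]) (use 2 in simp)
      ultimately show "\<gamma> \<sigma> \<in> Pos \<sigma>" "near \<theta> x (\<gamma> \<sigma>)" using \<gamma>_eq[OF s] by auto
    qed
    have "continuous_on ?I \<gamma>"
      unfolding continuous_on_iff
    proof (intro ballI allI impI)
      fix \<sigma> e :: real assume s: "\<sigma> \<in> ?I" and e: "0 < e"
      have "0 < min (\<eta> - \<theta>) (e / 2)" using 2 e by simp
      then obtain \<zeta> \<kappa>3 where loc3: "frame \<sigma> \<zeta> \<kappa>3" "\<zeta> < min (\<eta> - \<theta>) (e / 2)"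
        using frame_exists by blast
      have 3: "0 < \<zeta>" "\<zeta> < \<eta> - \<theta>" "2 * \<zeta> < e" "0 < \<kappa>3" using frameD[OF loc3(1)] loc3(2) by auto
      have "dist (\<gamma> \<rho>) (\<gamma> \<sigma>) < e" if r: "\<rho> \<in> ?I" "dist \<rho> \<sigma> < \<kappa>3" for \<rho>
      proof -
        obtain y' where y': "y' \<in> Pos \<rho>" "near \<zeta> (\<gamma> \<sigma>) y'"
          using frameD(4)[OF loc3(1) _ \<gamma>(1)[OF s], of \<rho>] r(2) unfolding dist_real_def by blast
        have "near (\<theta> + \<zeta>) x y'" by (rule near_trans[OF \<gamma>(2)[OF s] y'(2)])
        then have "near \<eta> x y'" by (rule near_mono) (use 3 in simp)
        then have "\<gamma> \<rho> = y'" using \<gamma>_eq r y' by blast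
        then show ?thesis using near_dist[OF y'(2)] 3(3) by (simp add: dist_commute)
      qed
      then show "\<exists>d>0. \<forall>\<rho>\<in>?I. dist \<rho> \<sigma> < d \<longrightarrow> dist (\<gamma> \<rho>) (\<gamma> \<sigma>) < e" using 3(4) by blast
    qed
    then have "ispath ?I \<gamma>" using \<gamma>(1) by (auto simp: ispath_def)
    moreover have "\<gamma> \<tau> = y"
      by (rule \<gamma>_eq) (use y near_mono[OF x(2), of \<eta>] 2 inI in auto)
    ultimately show ?thesis by blast
  qed
  moreover have "0 < \<kappa>" using 1 2 by (simp add: \<kappa>_def)
  ultimately show ?thesis by blast
qed

text \<open>
  By uniqueness of neighbours, the set where two paths agree is open; it is also closed.
\<close>

lemma path_unique:
  assumes p: "ispath D \<gamma>" "ispath D' \<gamma>'" and I: "connected I" "open I" "I \<subseteq> D" "I \<subseteq> D'"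
    and a: "a \<in> I" "\<gamma> a = \<gamma>' a" and b: "b \<in> I"
  shows "\<gamma> b = \<gamma>' b"
proof (rule connected_induction_simple[of I a b "\<lambda>t. \<gamma> t = \<gamma>' t"])
  fix t assume t: "t \<in> I"
  have cont: "continuous_on I \<gamma>" "continuous_on I \<gamma>'"
    using p I by (auto simp: ispath_def intro: continuous_on_subset)
  show "\<exists>T. openin (top_of_set I) T \<and> t \<in> T \<and> (\<forall>x\<in>T. \<forall>y\<in>T. \<gamma> x = \<gamma>' x \<longrightarrow> \<gamma> y = \<gamma>' y)"
  proof (cases "\<gamma> t = \<gamma>' t")
    case True
    obtain \<eta> \<kappa> where "frame t \<eta> \<kappa>" using frame_exists[OF zero_less_one] by blast
    note 1 = frameD[OF this]
    obtain d1 where d1: "0 < d1" "\<And>x. x \<in> I \<Longrightarrow> dist x t < d1 \<Longrightarrow> dist (\<gamma> x) (\<gamma> t) < \<eta>"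
      using cont(1)[unfolded continuous_on_iff, rule_format, OF t 1(1)] by blast
    obtain d2 where d2: "0 < d2" "\<And>x. x \<in> I \<Longrightarrow> dist x t < d2 \<Longrightarrow> dist (\<gamma>' x) (\<gamma>' t) < \<eta>"
      using cont(2)[unfolded continuous_on_iff, rule_format, OF t 1(1)] by blast
    define d where "d = min \<kappa> (min d1 d2)"
    have "\<gamma> y = \<gamma>' y" if y: "y \<in> I \<inter> ball t d" for y
    proof -
      have yI: "y \<in> I" "dist y t < d" using y by (auto simp: dist_commute)
      have "near \<eta> (\<gamma> t) (\<gamma> y)" "near \<eta> (\<gamma> t) (\<gamma>' y)"
        using d1(2)[OF yI(1)] d2(2)[OF yI(1)] yI(2) True
        by (auto simp: d_def dist_commute intro!: dist_near less_imp_le)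
      moreover have "\<gamma> y \<in> Pos y" "\<gamma>' y \<in> Pos y" "\<gamma> t \<in> Pos t"
        using p yI t I by (auto simp: ispath_def)
      moreover have "\<bar>y - t\<bar> < \<kappa>" using yI(2) by (simp add: d_def dist_real_def)
      ultimately show ?thesis using 1(4)[of y "\<gamma> t"] by blast
    qed
    moreover have "openin (top_of_set I) (I \<inter> ball t d)" by (intro openin_open_Int) simp
    moreover have "t \<in> I \<inter> ball t d" using t 1 d1 d2 by (simp add: d_def)
    ultimately show ?thesis by blast
  next
    case False
    have "open (I \<inter> {x \<in> I. \<gamma> x \<noteq> \<gamma>' x})"
    proof -
      have "closedin (top_of_set I) {x \<in> I. dist (\<gamma> x) (\<gamma>' x) = 0}"
        using cont by (intro continuous_closedin_preimage_constant continuous_intros)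
      then have "openin (top_of_set I) (I - {x \<in> I. dist (\<gamma> x) (\<gamma>' x) = 0})"
        by (metis openin_diff openin_subtopology_self topspace_euclidean_subtopology)
      moreover have "I - {x \<in> I. dist (\<gamma> x) (\<gamma>' x) = 0} = I \<inter> {x \<in> I. \<gamma> x \<noteq> \<gamma>' x}" by auto
      ultimately show ?thesis using I(2) openin_open_eq by metis
    qed
    then have "openin (top_of_set I) {x \<in> I. \<gamma> x \<noteq> \<gamma>' x}"
      using I(2) by (simp add: openin_open_eq Int_def)
    then show ?thesis using False t by blast
  qed
qed (use I a b in auto)

end

section \<open>A path makes at most one full turn\<close>

lemma continuous_on_dir: "continuous_on S dir"
  unfolding continuous_on_iff
proof (intro ballI allI impI)
  fix x e :: real assume e: "0 < e"
  have "dist (dir y) (dir x) < e" if "dist y x < e / 2" for y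
  proof -
    have "2 * \<bar>y - x\<bar> < e" using that by (simp add: dist_real_def)
    then show ?thesis using dist_dir_le[of y x] by (rule order.strict_trans1[rotated])
  qed
  moreover have "0 < e / 2" using e by simp
  ultimately show "\<exists>d>0. \<forall>y\<in>S. dist y x < d \<longrightarrow> dist (dir y) (dir x) < e" by blast
qed

lemma abs_height_add:
  fixes p q h x \<eta> :: real
  assumes "\<bar>p - q\<bar> \<le> \<eta> / 2" "\<bar>h - (- q - x)\<bar> \<le> \<eta> / 2"
  shows "\<bar>x - (- p - h)\<bar> \<le> \<eta>"
proof -
  have "x - (- p - h) = (p - q) + (h - (- q - x))" by simp
  then have "\<bar>x - (- p - h)\<bar> \<le> \<bar>p - q\<bar> + \<bar>h - (- q - x)\<bar>" by (metis abs_triangle_ineq)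
  also have "\<dots> \<le> \<eta> / 2 + \<eta> / 2" using assms by (rule add_mono)
  finally show ?thesis by simp
qed

context plane_star
begin

definition birth_depth :: "real \<Rightarrow> real \<times> real \<Rightarrow> real" where
  "birth_depth \<tau> x = - (c \<bullet> dir \<tau>) - fst x"

definition death_depth :: "real \<Rightarrow> real \<times> real \<Rightarrow> real" where
  "death_depth \<tau> x = - (c \<bullet> dir \<tau>) - snd x"

lemma Pos_bar:
  assumes "x \<in> Pos \<tau>"
  shows "bar_at (dir \<tau>) (birth_depth \<tau> x) (death_depth \<tau> x)"
    "0 \<le> death_depth \<tau> x" "death_depth \<tau> x < birth_depth \<tau> x"
proof -
  have x: "x \<in> pts (- dir \<tau>)" "0 < len x" using assms by (auto simp: Pos_def pos_def)
  then show "bar_at (dir \<tau>) (birth_depth \<tau> x) (death_depth \<tau> x)"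
    by (simp add: bar_at_def birth_depth_def death_depth_def)
  show "0 \<le> death_depth \<tau> x"
    using pts_bounds(2)[OF dir_in_sphere, of "fst x" "snd x" \<tau>] x by (simp add: death_depth_def)
  show "death_depth \<tau> x < birth_depth \<tau> x" using x by (simp add: birth_depth_def death_depth_def)
qed

lemma bar_Pos:
  assumes "bar_at (dir \<tau>) B E" "E < B"
  shows "(- (c \<bullet> dir \<tau>) - B, - (c \<bullet> dir \<tau>) - E) \<in> Pos \<tau>"
  using assms by (simp add: bar_at_def Pos_def pos_def)

text \<open>
  The bar with the same side and ray that is provided in a nearby direction is a point near the path, hence on the
  path.
\<close>

lemma sided_step:
  assumes \<sigma>: "\<sigma> \<in> {1, -1}" and p: "ispath D \<gamma>" and \<tau>: "\<tau> \<in> D"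
    and ty: "sided \<sigma> (dir \<tau>) (birth_depth \<tau> (\<gamma> \<tau>)) (death_depth \<tau> (\<gamma> \<tau>)) r" and r: "0 < r \<bullet> dir \<tau>"
  shows "\<exists>\<kappa>>0. \<forall>s. 0 \<le> s \<longrightarrow> s < \<kappa> \<longrightarrow>
    sided \<sigma> (dir (\<tau> + \<sigma> * s)) (birth_depth (\<tau> + \<sigma> * s) (\<gamma> (\<tau> + \<sigma> * s)))
      (death_depth (\<tau> + \<sigma> * s) (\<gamma> (\<tau> + \<sigma> * s))) r"
proof -
  have ss: "\<sigma> * \<sigma> = 1" "\<bar>\<sigma>\<bar> = 1" using \<sigma> by auto
  define B E where "B = birth_depth \<tau> (\<gamma> \<tau>)" and "E = death_depth \<tau> (\<gamma> \<tau>)"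
  have x: "\<gamma> \<tau> \<in> Pos \<tau>" using p \<tau> by (simp add: ispath_def)
  have BE: "0 \<le> E" "E < B" using Pos_bar[OF x] by (auto simp: B_def E_def)
  have "0 < (B - E) / 4" using BE by simp
  then obtain \<eta> \<kappa>1 where fr: "frame \<tau> \<eta> \<kappa>1" "\<eta> < (B - E) / 4" using frame_exists by blast
  note fr1 = frameD[OF fr(1)]
  obtain \<kappa>2 where k2: "0 < \<kappa>2" "\<And>u'. dist (dir \<tau>) u' < \<kappa>2 \<Longrightarrow> 0 \<le> area \<sigma> (dir \<tau>) u' \<Longrightarrow>
      \<exists>B' E'. \<bar>B' - B\<bar> \<le> \<eta> / 2 \<and> \<bar>E' - E\<bar> \<le> \<eta> / 2 \<and> 0 \<le> E' \<and> sided \<sigma> u' B' E' r"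
    using sided_forward[OF ss(1) ty norm_dir, of "\<eta> / 2"] BE r fr1(1) unfolding B_def E_def by auto
  have "continuous_on D \<gamma>" "open D" using p by (auto simp: ispath_def)
  obtain \<kappa>3 where k3: "0 < \<kappa>3" "\<And>\<rho>. \<rho> \<in> D \<Longrightarrow> dist \<rho> \<tau> < \<kappa>3 \<Longrightarrow> dist (\<gamma> \<rho>) (\<gamma> \<tau>) < \<eta>"
    using \<open>continuous_on D \<gamma>\<close>[unfolded continuous_on_iff, rule_format, OF \<tau> fr1(1)] by blast
  obtain \<kappa>4 where k4: "0 < \<kappa>4" "ball \<tau> \<kappa>4 \<subseteq> D" using \<open>open D\<close> \<tau> open_contains_ball by blast
  define \<kappa> where "\<kappa> = min (min \<kappa>1 (\<kappa>2 / 2)) (min (min \<kappa>3 \<kappa>4) pi)"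
  have "sided \<sigma> (dir (\<tau> + \<sigma> * s)) (birth_depth (\<tau> + \<sigma> * s) (\<gamma> (\<tau> + \<sigma> * s)))
      (death_depth (\<tau> + \<sigma> * s) (\<gamma> (\<tau> + \<sigma> * s))) r" if s: "0 \<le> s" "s < \<kappa>" for s
  proof -
    define \<rho> where "\<rho> = \<tau> + \<sigma> * s"
    have d: "\<bar>\<rho> - \<tau>\<bar> = s" using s ss(2) by (simp add: \<rho>_def abs_mult)
    have sk: "s < \<kappa>1" "2 * s < \<kappa>2" "s < \<kappa>3" "s < \<kappa>4" "s < pi" using s by (auto simp: \<kappa>_def)
    have \<rho>D: "\<rho> \<in> D" using k4(2) d sk(4) by (auto simp: dist_real_def abs_minus_commute)
    have "dist (dir \<tau>) (dir \<rho>) < \<kappa>2" using dist_dir_le[of \<tau> \<rho>] d sk(2) by (simp add: abs_minus_commute)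
    moreover have "0 \<le> area \<sigma> (dir \<tau>) (dir \<rho>)"
      using \<sigma> sin_ge_zero[of s] s sk(5) by (auto simp: area_dir \<rho>_def)
    ultimately obtain B' E' where BE': "\<bar>B' - B\<bar> \<le> \<eta> / 2" "\<bar>E' - E\<bar> \<le> \<eta> / 2" "sided \<sigma> (dir \<rho>) B' E' r"
      using k2(2) by blast
    have "4 * \<eta> < B - E" using fr(2) by simp
    moreover have "2 * B - \<eta> \<le> 2 * B'" "2 * E' \<le> 2 * E + \<eta>"
      using BE'(1,2) abs_ge_minus_self[of "B' - B"] abs_ge_self[of "E' - E"] by argo+
    ultimately have less: "E' < B'" using fr1(1) by linarith
    define y where "y = (- (c \<bullet> dir \<rho>) - B', - (c \<bullet> dir \<rho>) - E')"
    have y: "y \<in> Pos \<rho>" unfolding y_def by (rule bar_Pos[OF sided_imp_bar[OF BE'(3) norm_dir less] less])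
    have close: "\<bar>c \<bullet> dir \<rho> - c \<bullet> dir \<tau>\<bar> \<le> \<eta> / 2"
      using fr1(3)[of \<rho>] d sk(1) center unfolding height_close_def by force
    have "near \<eta> (\<gamma> \<tau>) y"
      using abs_height_add[OF close BE'(1)[unfolded B_def birth_depth_def]]
        abs_height_add[OF close BE'(2)[unfolded E_def death_depth_def]]
      unfolding near_def y_def fst_conv snd_conv by blast
    moreover have "near \<eta> (\<gamma> \<tau>) (\<gamma> \<rho>)"
      using k3(2)[OF \<rho>D] d sk(3) by (intro dist_near) (simp add: dist_commute dist_real_def less_imp_le abs_minus_commute)
    moreover have "\<gamma> \<rho> \<in> Pos \<rho>" using p \<rho>D by (simp add: ispath_def)
    ultimately have "\<gamma> \<rho> = y" using fr1(4)[OF _ x, of \<rho>] d sk(1) y by blast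
    then have "birth_depth \<rho> (\<gamma> \<rho>) = B'" "death_depth \<rho> (\<gamma> \<rho>) = E'"
      by (simp_all add: y_def birth_depth_def death_depth_def)
    then show ?thesis using BE'(3) unfolding \<rho>_def by simp
  qed
  moreover have "0 < \<kappa>" using fr1(2) k2(1) k3(1) k4(1) by (simp add: \<kappa>_def)
  ultimately show ?thesis by blast
qed

text \<open>
  Starting at \<open>\<tau>0\<close> and turning towards \<open>\<sigma>\<close>, the ray \<open>r\<close> keeps separating until it becomes orthogonal to the direction
  of depth, which happens during a half turn.
\<close>

lemma no_half_turn:
  assumes \<sigma>: "\<sigma> \<in> {1, -1}" and p: "ispath D \<gamma>" and D: "\<And>t. 0 \<le> t \<Longrightarrow> t \<le> pi \<Longrightarrow> \<tau>0 + \<sigma> * t \<in> D"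
    and ty: "sided \<sigma> (dir \<tau>0) (birth_depth \<tau>0 (\<gamma> \<tau>0)) (death_depth \<tau>0 (\<gamma> \<tau>0)) r"
    and r: "0 < r \<bullet> dir \<tau>0"
  shows False
proof -
  have ss: "\<sigma> * \<sigma> = 1" "\<bar>\<sigma>\<bar> = 1" using \<sigma> by auto
  define f where "f t = r \<bullet> dir (\<tau>0 + \<sigma> * t)" for t
  have f_cont: "continuous_on S f" for S
    unfolding f_def inner_plane dir_nth by (intro continuous_intros)
  have f0: "0 < f 0" using r by (simp add: f_def)
  have fpi: "f pi = - f 0" using \<sigma> by (auto simp: f_def inner_plane)
  define Z where "Z = {t \<in> {0..pi}. f t = 0}"
  have "\<exists>t\<ge>0. t \<le> pi \<and> f t = 0"
    using IVT2'[of f pi 0 0] f_cont f0 fpi by auto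
  then have Zne: "Z \<noteq> {}" by (auto simp: Z_def)
  have "closed Z" unfolding Z_def
    by (intro continuous_closed_preimage_constant f_cont closed_atLeastAtMost)
  define te where "te = Inf Z"
  have bdd: "bdd_below Z" by (intro bdd_belowI[of _ 0]) (auto simp: Z_def)
  have te_Z: "te \<in> Z" unfolding te_def by (rule closed_contains_Inf[OF Zne bdd \<open>closed Z\<close>])
  then have te: "0 \<le> te" "te \<le> pi" "f te = 0" by (auto simp: Z_def)
  have te': "0 < te" "te < pi"
    using te f0 fpi by (metis less_eq_real_def less_irrefl, metis less_eq_real_def less_irrefl neg_0_equal_iff_equal)
  have f_pos: "0 < f t" if t: "0 \<le> t" "t < te" for t
  proof (rule ccontr)
    assume "\<not> 0 < f t"
    then have "\<exists>s\<ge>0. s \<le> t \<and> f s = 0"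
      using IVT2'[of f t 0 0] f_cont f0 t by auto
    then obtain s where "0 \<le> s" "s \<le> t" "f s = 0" by blast
    then have "s \<in> Z" using t te by (auto simp: Z_def)
    then have "te \<le> s" unfolding te_def using bdd by (intro cInf_lower)
    then show False using \<open>s \<le> t\<close> t by simp
  qed
  define b e where "b t = birth_depth (\<tau>0 + \<sigma> * t) (\<gamma> (\<tau>0 + \<sigma> * t))"
    and "e t = death_depth (\<tau>0 + \<sigma> * t) (\<gamma> (\<tau>0 + \<sigma> * t))" for t
  have \<gamma>_cont: "continuous_on {0..te} (\<lambda>t. \<gamma> (\<tau>0 + \<sigma> * t))"
    by (rule continuous_on_compose2[of D \<gamma>])
      (use p D te in \<open>auto simp: ispath_def intro!: continuous_intros\<close>)
  have b_cont: "continuous_on {0..te} b" "continuous_on {0..te} e"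
    unfolding b_def e_def birth_depth_def death_depth_def inner_plane dir_nth
    by (intro continuous_intros \<gamma>_cont)+
  have "sided \<sigma> (dir (\<tau>0 + \<sigma> * te)) (b te) (e te) r"
  proof (rule real_induction[of "\<lambda>t. sided \<sigma> (dir (\<tau>0 + \<sigma> * t)) (b t) (e t) r" 0 te te])
    show "sided \<sigma> (dir (\<tau>0 + \<sigma> * 0)) (b 0) (e 0) r" using ty by (simp add: b_def e_def)
  next
    fix t assume t: "0 \<le> t" "t < te" "sided \<sigma> (dir (\<tau>0 + \<sigma> * t)) (b t) (e t) r"
    have "\<tau>0 + \<sigma> * t \<in> D" using D t te by simp
    then obtain \<kappa> where k: "0 < \<kappa>" "\<And>s. 0 \<le> s \<Longrightarrow> s < \<kappa> \<Longrightarrow>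
        sided \<sigma> (dir (\<tau>0 + \<sigma> * t + \<sigma> * s)) (birth_depth (\<tau>0 + \<sigma> * t + \<sigma> * s) (\<gamma> (\<tau>0 + \<sigma> * t + \<sigma> * s)))
          (death_depth (\<tau>0 + \<sigma> * t + \<sigma> * s) (\<gamma> (\<tau>0 + \<sigma> * t + \<sigma> * s))) r"
      using sided_step[OF \<sigma> p _ t(3)[unfolded b_def e_def]] f_pos[OF t(1,2)] unfolding f_def by blast
    have "sided \<sigma> (dir (\<tau>0 + \<sigma> * t')) (b t') (e t') r" if "t \<le> t'" "t' < t + \<kappa>" for t'
    proof -
      have eq: "\<tau>0 + \<sigma> * t + \<sigma> * (t' - t) = \<tau>0 + \<sigma> * t'" by (simp add: algebra_simps)
      have "0 \<le> t' - t" "t' - t < \<kappa>" using that by simp_all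
      from k(2)[OF this] show ?thesis unfolding eq b_def e_def .
    qed
    then show "\<exists>\<kappa>>0. \<forall>t'\<ge>t. t' < t + \<kappa> \<longrightarrow> t' \<le> te \<longrightarrow> sided \<sigma> (dir (\<tau>0 + \<sigma> * t')) (b t') (e t') r"
      using k(1) by blast
  next
    fix t assume t: "0 < t" "t \<le> te" and
      before: "\<And>s. 0 \<le> s \<Longrightarrow> s < t \<Longrightarrow> sided \<sigma> (dir (\<tau>0 + \<sigma> * s)) (b s) (e s) r"
    show "sided \<sigma> (dir (\<tau>0 + \<sigma> * t)) (b t) (e t) r"
    proof (rule sided_closed)
      fix \<delta> :: real assume d: "0 < \<delta>"
      have tI: "t \<in> {0..te}" using t by simp
      obtain d1 where d1: "0 < d1" "\<And>s. s \<in> {0..te} \<Longrightarrow> dist s t < d1 \<Longrightarrow> dist (b s) (b t) < \<delta>"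
        using b_cont(1)[unfolded continuous_on_iff, rule_format, OF tI d] by blast
      obtain d2 where d2: "0 < d2" "\<And>s. s \<in> {0..te} \<Longrightarrow> dist s t < d2 \<Longrightarrow> dist (e s) (e t) < \<delta>"
        using b_cont(2)[unfolded continuous_on_iff, rule_format, OF tI d] by blast
      define X where "X = \<delta> / (2 * R + 1)"
      have X: "0 < X" using d R_nonneg by (simp add: X_def)
      define q where "q = min (min d1 d2) (min t X)"
      have q: "0 < q" "q \<le> X" "q \<le> t" "q \<le> d1" "q \<le> d2" using d1 d2 t X by (auto simp: q_def)
      define s where "s = t - q / 2"
      have s: "0 \<le> s" "s < t" "dist s t < d1" "dist s t < d2" "2 * \<bar>t - s\<bar> \<le> \<delta> / (2 * R + 1)"
        using q unfolding X_def[symmetric] by (auto simp: s_def dist_real_def)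
      have "s \<in> {0..te}" using s t by simp
      have cl: "close_dirs \<delta> (dir (\<tau>0 + \<sigma> * t)) (dir (\<tau>0 + \<sigma> * s))"
      proof (rule close_dirs_dist)
        have "\<bar>(\<tau>0 + \<sigma> * t) - (\<tau>0 + \<sigma> * s)\<bar> = \<bar>\<sigma> * (t - s)\<bar>" by (simp add: algebra_simps)
        also have "\<dots> = \<bar>t - s\<bar>" using ss(2) by (simp add: abs_mult)
        finally have eq: "\<bar>(\<tau>0 + \<sigma> * t) - (\<tau>0 + \<sigma> * s)\<bar> = \<bar>t - s\<bar>" .
        show "dist (dir (\<tau>0 + \<sigma> * t)) (dir (\<tau>0 + \<sigma> * s)) \<le> \<delta> / (2 * R + 1)"
          using dist_dir_le[of "\<tau>0 + \<sigma> * t" "\<tau>0 + \<sigma> * s"] s(5) unfolding eq by (rule order_trans)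
      qed (use d in simp)
      have "\<bar>b s - b t\<bar> \<le> \<delta>" "\<bar>e s - e t\<bar> \<le> \<delta>"
        using d1(2)[OF \<open>s \<in> {0..te}\<close> s(3)] d2(2)[OF \<open>s \<in> {0..te}\<close> s(4)] by (simp_all add: dist_real_def)
      then show "\<exists>u' B' E'. close_dirs \<delta> (dir (\<tau>0 + \<sigma> * t)) u' \<and> \<bar>B' - b t\<bar> \<le> \<delta> \<and> \<bar>E' - e t\<bar> \<le> \<delta> \<and> sided \<sigma> u' B' E' r"
        using cl before[OF s(1,2)] by blast
    qed
  qed (use te in auto)
  moreover have "\<gamma> (\<tau>0 + \<sigma> * te) \<in> Pos (\<tau>0 + \<sigma> * te)" using p D te by (simp add: ispath_def)
  then have "0 \<le> e te" "e te < b te" using Pos_bar by (auto simp: b_def e_def)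
  moreover have "0 < area \<sigma> (dir \<tau>0) (dir (\<tau>0 + \<sigma> * te))"
    using \<sigma> sin_gt_zero[OF te'] by (auto simp: area_dir)
  ultimately show False using sided_end[OF ss(1)] r te(3) unfolding f_def by blast
qed

text \<open>
  The midpoint of a longer path would have more than a half turn on either side, one of which is its merging side.
\<close>

lemma path_length_le:
  assumes p: "ispath D \<gamma>" and ab: "a \<in> D" "b \<in> D"
  shows "b - a \<le> 2 * pi"
proof (rule ccontr)
  assume long: "\<not> b - a \<le> 2 * pi"
  define \<tau> where "\<tau> = (a + b) / 2"
  have "is_interval D" using p by (simp add: ispath_def is_interval_connected_1)
  then have D: "s \<in> D" if "a \<le> s" "s \<le> b" for s
    using ab that unfolding is_interval_1 by blast
  have ab': "a + 2 * pi < b" using long by simp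
  then have "a < b" using pi_gt_zero by linarith
  then have "\<tau> \<in> D" by (intro D) (auto simp: \<tau>_def)
  then have x: "\<gamma> \<tau> \<in> Pos \<tau>" using p by (simp add: ispath_def)
  obtain \<sigma> r where \<sigma>: "\<sigma> \<in> {1, -1}" and r: "sided \<sigma> (dir \<tau>) (birth_depth \<tau> (\<gamma> \<tau>)) (death_depth \<tau> (\<gamma> \<tau>)) r"
      "0 < r \<bullet> dir \<tau>"
    using sided_exists[OF Pos_bar(1)[OF x] norm_dir Pos_bar(2,3)[OF x]] by blast
  have "\<tau> + \<sigma> * t \<in> D" if "0 \<le> t" "t \<le> pi" for t
    using \<sigma> that ab' by (intro D) (auto simp: \<tau>_def field_simps)
  then show False using no_half_turn[OF \<sigma> p _ r] by blast
qed

text \<open>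
  Two angles of the same direction differ by at least a full turn, and an open interval that contains both is longer.
\<close>

lemma path_dir_inj:
  assumes p: "ispath D \<gamma>" and ab: "a \<in> D" "b \<in> D" "dir a = dir b"
  shows "a = b"
proof -
  have le: "a \<le> b" if ab: "a \<in> D" "b \<in> D" "dir a = dir b" for a b
  proof (rule ccontr)
    assume less: "\<not> a \<le> b"
    obtain k :: int where k: "a = b + 2 * pi * of_int k" using ab(3) dir_eq_iff by blast
    have "0 < k"
    proof (rule ccontr)
      assume "\<not> 0 < k"
      then have "2 * pi * of_int k \<le> 0" by (intro mult_nonneg_nonpos) auto
      then show False using k less by simp
    qed
    then have "2 * pi * 1 \<le> 2 * pi * of_int k" by (intro mult_left_mono) auto
    then have "2 * pi \<le> a - b" using k by simp
    moreover obtain d where d: "0 < d" "ball a d \<subseteq> D"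
      using p ab(1) open_contains_ball unfolding ispath_def by blast
    have "a + d / 2 \<in> D" using d by (auto simp: dist_real_def)
    then have "a + d / 2 - b \<le> 2 * pi" using path_length_le[OF p ab(2)] by blast
    ultimately show False using d(1) by simp
  qed
  show ?thesis using le[OF ab] le[OF ab(2,1) ab(3)[symmetric]] by simp
qed

text \<open>
  Maximality in a strong form: every path that agrees with \<open>\<gamma>\<close> at one angle is a restriction of \<open>\<gamma>\<close>.
\<close>

definition maximal_path :: "real set \<Rightarrow> (real \<Rightarrow> real \<times> real) \<Rightarrow> bool" where
  "maximal_path D \<gamma> \<longleftrightarrow> ispath D \<gamma> \<and> (\<forall>D' \<gamma>' \<tau>. ispath D' \<gamma>' \<longrightarrow> \<tau> \<in> D \<longrightarrow> \<tau> \<in> D' \<longrightarrow> \<gamma> \<tau> = \<gamma>' \<tau> \<longrightarrow>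
     D' \<subseteq> D \<and> (\<forall>s\<in>D'. \<gamma>' s = \<gamma> s))"

lemma maximal_pathD:
  assumes "maximal_path D \<gamma>"
  shows "ispath D \<gamma>" "ispath D' \<gamma>' \<Longrightarrow> \<tau> \<in> D \<Longrightarrow> \<tau> \<in> D' \<Longrightarrow> \<gamma> \<tau> = \<gamma>' \<tau> \<Longrightarrow> D' \<subseteq> D"
    "ispath D' \<gamma>' \<Longrightarrow> \<tau> \<in> D \<Longrightarrow> \<tau> \<in> D' \<Longrightarrow> \<gamma> \<tau> = \<gamma>' \<tau> \<Longrightarrow> s \<in> D' \<Longrightarrow> \<gamma>' s = \<gamma> s"
  using assms unfolding maximal_path_def by blast+

lemma paths_agree:
  assumes p: "ispath D \<gamma>" "ispath D' \<gamma>'" and \<tau>: "\<tau> \<in> D" "\<tau> \<in> D'" "\<gamma> \<tau> = \<gamma>' \<tau>" and s: "s \<in> D" "s \<in> D'"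
  shows "\<gamma> s = \<gamma>' s"
proof (rule path_unique[OF p, of "D \<inter> D'" \<tau>])
  show "connected (D \<inter> D')"
    using p by (simp add: ispath_def is_interval_Int flip: is_interval_connected_1)
  show "open (D \<inter> D')" using p by (auto simp: ispath_def)
qed (use \<tau> s in auto)

text \<open>
  The union of all paths through \<open>x0\<close>; they agree where they overlap.
\<close>

lemma maximal_path_exists:
  assumes x0: "x0 \<in> Pos \<tau>0"
  shows "\<exists>D \<gamma>. maximal_path D \<gamma> \<and> \<tau>0 \<in> D \<and> \<gamma> \<tau>0 = x0"
proof -
  define F where "F = {D. \<exists>\<gamma>. ispath D \<gamma> \<and> \<tau>0 \<in> D \<and> \<gamma> \<tau>0 = x0}"
  have "\<forall>D\<in>F. \<exists>\<gamma>. ispath D \<gamma> \<and> \<tau>0 \<in> D \<and> \<gamma> \<tau>0 = x0" by (simp add: F_def)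
  from bchoice[OF this] obtain g where g: "\<And>D. D \<in> F \<Longrightarrow> ispath D (g D) \<and> \<tau>0 \<in> D \<and> g D \<tau>0 = x0" by blast
  define \<gamma> where "\<gamma> s = g (SOME D. D \<in> F \<and> s \<in> D) s" for s
  have \<gamma>_eq: "\<gamma> s = \<gamma>' s" if D: "ispath D \<gamma>'" "\<tau>0 \<in> D" "\<gamma>' \<tau>0 = x0" "s \<in> D" for D \<gamma>' s
  proof -
    have "D \<in> F" using D by (auto simp: F_def)
    then have "\<exists>D. D \<in> F \<and> s \<in> D" using D(4) by blast
    from someI_ex[OF this] have D': "(SOME D. D \<in> F \<and> s \<in> D) \<in> F" "s \<in> (SOME D. D \<in> F \<and> s \<in> D)" by auto
    show ?thesis unfolding \<gamma>_def
      using g[OF D'(1)] D by (intro paths_agree[OF _ D(1) _ D(2) _ D'(2) D(4)]) auto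
  qed
  have \<gamma>_g: "\<gamma> s = g D s" if "D \<in> F" "s \<in> D" for D s
    using \<gamma>_eq[of D "g D" s] g[OF that(1)] that by blast
  have p: "ispath (\<Union>F) \<gamma>" unfolding ispath_def
  proof (intro conjI ballI)
    show "open (\<Union>F)" using g by (auto simp: ispath_def)
    show "connected (\<Union>F)" using g by (intro connected_Union) (auto simp: ispath_def)
    show "continuous_on (\<Union>F) \<gamma>"
    proof (rule continuous_on_open_Union)
      fix D assume D: "D \<in> F"
      then show "open D" using g by (auto simp: ispath_def)
      have "continuous_on D (g D)" using g[OF D] by (simp add: ispath_def)
      then show "continuous_on D \<gamma>" by (rule continuous_on_eq) (simp add: \<gamma>_g[OF D])
    qed
    fix \<tau> assume "\<tau> \<in> \<Union>F"
    then obtain D where "D \<in> F" "\<tau> \<in> D" by blast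
    then show "\<gamma> \<tau> \<in> Pos \<tau>" using g[of D] \<gamma>_g by (auto simp: ispath_def)
  qed
  have "0 < len x0" using x0 by (simp add: Pos_def pos_def)
  then obtain \<kappa> where k: "0 < \<kappa>" "\<And>\<tau> y. \<bar>\<tau> - \<tau>0\<bar> < \<kappa> \<Longrightarrow> y \<in> Pos \<tau> \<Longrightarrow> len x0 \<le> len y \<Longrightarrow>
    (\<exists>\<gamma>. ispath {\<tau>0 - \<kappa><..<\<tau>0 + \<kappa>} \<gamma> \<and> \<gamma> \<tau> = y)" using long_point_path[of "len x0" \<tau>0] by blast
  then have "{\<tau>0 - \<kappa><..<\<tau>0 + \<kappa>} \<in> F" using x0 k(2)[of \<tau>0 x0] by (auto simp: F_def)
  then have \<tau>0: "\<tau>0 \<in> \<Union>F" "\<gamma> \<tau>0 = x0" using k(1) \<gamma>_g g by auto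
  have "maximal_path (\<Union>F) \<gamma>" unfolding maximal_path_def
  proof (intro conjI allI impI p)
    fix D' \<gamma>' \<tau> assume p': "ispath D' \<gamma>'" and \<tau>: "\<tau> \<in> \<Union>F" "\<tau> \<in> D'" "\<gamma> \<tau> = \<gamma>' \<tau>"
    have agree: "\<gamma> s = \<gamma>' s" if "s \<in> \<Union>F" "s \<in> D'" for s by (rule paths_agree[OF p p' \<tau> that])
    define h where "h s = (if s \<in> \<Union>F then \<gamma> s else \<gamma>' s)" for s
    have h': "h s = \<gamma>' s" if "s \<in> D'" for s using agree that by (simp add: h_def)
    have h1: "h s = \<gamma> s" if "s \<in> \<Union>F" for s using that by (simp add: h_def)
    have "ispath (\<Union>F \<union> D') h" unfolding ispath_def
    proof (intro conjI ballI)
      show "open (\<Union>F \<union> D')" using p p' unfolding ispath_def by blast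
      show "connected (\<Union>F \<union> D')" using p p' \<tau> unfolding ispath_def by (intro connected_Un) auto
      show "continuous_on (\<Union>F \<union> D') h"
      proof (rule continuous_on_open_Un)
        show "continuous_on (\<Union>F) h"
          by (rule continuous_on_eq[of _ \<gamma>]) (use p h1 in \<open>auto simp: ispath_def\<close>)
        show "continuous_on D' h"
          by (rule continuous_on_eq[of _ \<gamma>']) (use p' h' in \<open>auto simp: ispath_def\<close>)
      qed (use p p' in \<open>auto simp: ispath_def\<close>)
      fix s assume "s \<in> \<Union>F \<union> D'"
      then show "h s \<in> Pos s" using p p' h1 h' unfolding ispath_def by (metis UnE)
    qed
    moreover have "h \<tau>0 = x0" using \<tau>0 h1 by simp
    ultimately have "\<Union>F \<union> D' \<in> F" using \<tau>0 unfolding F_def by blast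
    then show "D' \<subseteq> \<Union>F" by blast
    then show "\<forall>s\<in>D'. \<gamma>' s = \<gamma> s" using agree by (metis subsetD)
  qed
  then show ?thesis using \<tau>0 by blast
qed

end

section \<open>The family of sections\<close>

context plane_star
begin

lemma ispath_shift:
  assumes "ispath D \<gamma>"
  shows "ispath ((+) (2 * pi * of_int k) ` D) (\<lambda>s. \<gamma> (s - 2 * pi * of_int k))"
  unfolding ispath_def
proof (intro conjI ballI)
  show "open ((+) (2 * pi * of_int k) ` D)" using assms by (auto simp: ispath_def intro: open_translation)
  show "connected ((+) (2 * pi * of_int k) ` D)"
    using assms by (intro connected_continuous_image continuous_intros) (simp add: ispath_def)
  show "continuous_on ((+) (2 * pi * of_int k) ` D) (\<lambda>s. \<gamma> (s - 2 * pi * of_int k))"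
  proof (rule continuous_on_compose2[of D \<gamma>])
    show "continuous_on D \<gamma>" using assms by (simp add: ispath_def)
  qed (auto intro: continuous_on_diff continuous_on_id continuous_on_const)
  fix s assume "s \<in> (+) (2 * pi * of_int k) ` D"
  then obtain \<tau> where \<tau>: "\<tau> \<in> D" "s = \<tau> + 2 * pi * of_int k" by auto
  then show "\<gamma> (s - 2 * pi * of_int k) \<in> Pos s" using assms by (simp add: ispath_def Pos_shift)
qed

lemma maximal_path_shift:
  assumes m: "maximal_path D \<gamma>"
  shows "maximal_path ((+) (2 * pi * of_int k) ` D) (\<lambda>s. \<gamma> (s - 2 * pi * of_int k))"
  unfolding maximal_path_def
proof (intro conjI allI impI ispath_shift maximal_pathD(1)[OF m])
  fix D' \<gamma>' \<tau>
  assume p: "ispath D' \<gamma>'" and \<tau>: "\<tau> \<in> (+) (2 * pi * of_int k) ` D" "\<tau> \<in> D'"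
    and eq: "\<gamma> (\<tau> - 2 * pi * of_int k) = \<gamma>' \<tau>"
  let ?D = "(+) (2 * pi * of_int (- k)) ` D'" and ?\<gamma> = "\<lambda>s. \<gamma>' (s - 2 * pi * of_int (- k))"
  have p': "ispath ?D ?\<gamma>" by (rule ispath_shift[OF p])
  have in_D: "s - 2 * pi * of_int k \<in> ?D" if "s \<in> D'" for s
    using that by (intro image_eqI[of _ _ s]) auto
  have \<tau>D: "\<tau> - 2 * pi * of_int k \<in> D" using \<tau>(1) by auto
  have e: "\<gamma> (\<tau> - 2 * pi * of_int k) = ?\<gamma> (\<tau> - 2 * pi * of_int k)" using eq by simp
  have "s - 2 * pi * of_int k \<in> D" if "s \<in> D'" for s
    using maximal_pathD(2)[OF m p' \<tau>D in_D[OF \<tau>(2)] e] in_D[OF that] by blast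
  then show "D' \<subseteq> (+) (2 * pi * of_int k) ` D" by (force intro!: image_eqI)
  show "\<forall>s\<in>D'. \<gamma>' s = \<gamma> (s - 2 * pi * of_int k)"
    using maximal_pathD(3)[OF m p' \<tau>D in_D[OF \<tau>(2)] e in_D] by simp
qed

text \<open>
  A long point near \<open>\<tau>1\<close> would extend the path to \<open>\<tau>1\<close>. It matters that \<open>\<kappa>\<close> does not depend on the path, because
  different lifts of one direction are handled at the same time.
\<close>

lemma maximal_path_end:
  assumes "0 < \<epsilon>"
  shows "\<exists>\<kappa>>0. \<forall>D \<gamma> \<tau>. maximal_path D \<gamma> \<longrightarrow> \<tau>1 \<notin> D \<longrightarrow> \<tau> \<in> D \<longrightarrow> \<bar>\<tau> - \<tau>1\<bar> < \<kappa> \<longrightarrow> len (\<gamma> \<tau>) < \<epsilon>"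
proof -
  obtain \<kappa> where \<kappa>: "0 < \<kappa>" "\<And>\<tau> y. \<bar>\<tau> - \<tau>1\<bar> < \<kappa> \<Longrightarrow> y \<in> Pos \<tau> \<Longrightarrow> \<epsilon> \<le> len y \<Longrightarrow>
      \<exists>\<gamma>. ispath {\<tau>1 - \<kappa><..<\<tau>1 + \<kappa>} \<gamma> \<and> \<gamma> \<tau> = y"
    using long_point_path[OF assms, of \<tau>1] by blast
  have "len (\<gamma> \<tau>) < \<epsilon>" if m: "maximal_path D \<gamma>" and out: "\<tau>1 \<notin> D" and \<tau>: "\<tau> \<in> D" "\<bar>\<tau> - \<tau>1\<bar> < \<kappa>" for D \<gamma> \<tau>
  proof (rule ccontr)
    assume "\<not> len (\<gamma> \<tau>) < \<epsilon>"
    then have "\<epsilon> \<le> len (\<gamma> \<tau>)" by simp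
    moreover have "\<gamma> \<tau> \<in> Pos \<tau>" using maximal_pathD(1)[OF m] \<tau> by (simp add: ispath_def)
    ultimately obtain \<gamma>' where p: "ispath {\<tau>1 - \<kappa><..<\<tau>1 + \<kappa>} \<gamma>'" "\<gamma>' \<tau> = \<gamma> \<tau>"
      using \<kappa>(2)[OF \<tau>(2)] by blast
    have "\<tau> \<in> {\<tau>1 - \<kappa><..<\<tau>1 + \<kappa>}" using \<tau>(2) by auto
    then have "{\<tau>1 - \<kappa><..<\<tau>1 + \<kappa>} \<subseteq> D" using maximal_pathD(2)[OF m p(1) \<tau>(1)] p(2) by simp
    moreover have "\<tau>1 \<in> {\<tau>1 - \<kappa><..<\<tau>1 + \<kappa>}" using \<kappa>(1) by simp
    ultimately show False using out by blast
  qed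
  then show ?thesis using \<kappa>(1) by blast
qed

text \<open>
  A path, seen as a function on directions. It does not depend on the angle chosen, by \<open>path_dir_inj\<close>.
\<close>

definition vine :: "real set \<Rightarrow> (real \<Rightarrow> real \<times> real) \<Rightarrow> real^2 \<Rightarrow> pd_elem" where
  "vine D \<gamma> v = (if \<exists>\<tau>\<in>D. v = - dir \<tau> then of_pair (\<gamma> (SOME \<tau>. \<tau> \<in> D \<and> v = - dir \<tau>)) else Diagonal)"

lemma vine_at:
  assumes p: "ispath D \<gamma>" and \<tau>: "\<tau> \<in> D"
  shows "vine D \<gamma> (- dir \<tau>) = of_pair (\<gamma> \<tau>)"
proof -
  have ex: "\<exists>s. s \<in> D \<and> - dir \<tau> = - dir s" using \<tau> by blast
  define s where "s = (SOME s. s \<in> D \<and> - dir \<tau> = - dir s)"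
  have "s \<in> D" "- dir \<tau> = - dir s" using someI_ex[OF ex] unfolding s_def by blast+
  then have "s = \<tau>" using path_dir_inj[OF p, of s \<tau>] \<tau> by simp
  then show ?thesis unfolding vine_def s_def using ex by auto
qed

lemma vine_off: "\<not> (\<exists>\<tau>\<in>D. v = - dir \<tau>) \<Longrightarrow> vine D \<gamma> v = Diagonal"
  by (simp add: vine_def)

lemma vine_cases:
  assumes "ispath D \<gamma>"
  obtains (on) \<tau> where "\<tau> \<in> D" "v = - dir \<tau>" "vine D \<gamma> v = of_pair (\<gamma> \<tau>)"
    | (off) "\<And>\<tau>. \<tau> \<in> D \<Longrightarrow> v \<noteq> - dir \<tau>" "vine D \<gamma> v = Diagonal"
proof (cases "\<exists>\<tau>\<in>D. v = - dir \<tau>")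
  case True
  then obtain \<tau> where "\<tau> \<in> D" "v = - dir \<tau>" by blast
  then show thesis using on vine_at[OF assms] by blast
next
  case False
  then show thesis using off vine_off by blast
qed

lemma vine_eqI:
  assumes p: "ispath D \<gamma>" "ispath D' \<gamma>'"
    and sub: "\<And>\<tau>. \<tau> \<in> D \<Longrightarrow> \<exists>\<tau>'\<in>D'. dir \<tau>' = dir \<tau> \<and> \<gamma>' \<tau>' = \<gamma> \<tau>"
      "\<And>\<tau>. \<tau> \<in> D' \<Longrightarrow> \<exists>\<tau>'\<in>D. dir \<tau>' = dir \<tau>"
  shows "vine D \<gamma> = vine D' \<gamma>'"
proof
  fix v
  show "vine D \<gamma> v = vine D' \<gamma>' v"
  using p(1)
  proof (cases rule: vine_cases[where v = v])
    case (on \<tau>)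
    then obtain \<tau>' where "\<tau>' \<in> D'" "dir \<tau>' = dir \<tau>" "\<gamma>' \<tau>' = \<gamma> \<tau>" using sub(1) by blast
    then show ?thesis using vine_at[OF p(2), of \<tau>'] on by simp
  next
    case off
    then have "\<not> (\<exists>\<tau>\<in>D'. v = - dir \<tau>)" using sub(2) by metis
    then show ?thesis using off(2) vine_off by simp
  qed
qed

text \<open>
  Shifted by full turns, one of the maximal paths meets the other, and then they are equal.
\<close>

lemma vine_eq:
  assumes m: "maximal_path D \<gamma>" "maximal_path D' \<gamma>'" and eq: "vine D \<gamma> v = of_pair x" "vine D' \<gamma>' v = of_pair x"
  shows "vine D \<gamma> = vine D' \<gamma>'"
proof -
  note p = maximal_pathD(1)[OF m(1)] maximal_pathD(1)[OF m(2)]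
  obtain \<tau> where \<tau>: "\<tau> \<in> D" "v = - dir \<tau>" "\<gamma> \<tau> = x"
    using p(1) eq(1) by (cases rule: vine_cases[where v = v]) auto
  obtain \<tau>' where \<tau>': "\<tau>' \<in> D'" "v = - dir \<tau>'" "\<gamma>' \<tau>' = x"
    using p(2) eq(2) by (cases rule: vine_cases[where v = v]) auto
  have "dir \<tau>' = dir \<tau>" using \<tau>(2) \<tau>'(2) by simp
  then obtain k :: int where k: "\<tau>' = \<tau> + 2 * pi * of_int k" using dir_eq_iff by blast
  define D1 \<gamma>1 where "D1 = (+) (2 * pi * of_int k) ` D" and "\<gamma>1 = (\<lambda>s. \<gamma> (s - 2 * pi * of_int k))"
  have m1: "maximal_path D1 \<gamma>1" unfolding D1_def \<gamma>1_def by (rule maximal_path_shift[OF m(1)])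
  note p1 = maximal_pathD(1)[OF m1]
  have \<tau>1: "\<tau>' \<in> D1" "\<gamma>1 \<tau>' = x" using \<tau> k by (auto simp: D1_def \<gamma>1_def)
  have e: "\<gamma>1 \<tau>' = \<gamma>' \<tau>'" "\<gamma>' \<tau>' = \<gamma>1 \<tau>'" using \<tau>1 \<tau>' by simp_all
  have D1: "D' \<subseteq> D1" "D1 \<subseteq> D'"
    using maximal_pathD(2)[OF m1 p(2) \<tau>1(1) \<tau>'(1) e(1)] maximal_pathD(2)[OF m(2) p1 \<tau>'(1) \<tau>1(1) e(2)] by blast+
  have val: "\<gamma>1 s = \<gamma>' s" if "s \<in> D1" for s by (rule maximal_pathD(3)[OF m(2) p1 \<tau>'(1) \<tau>1(1) e(2) that])
  show ?thesis
  proof (rule vine_eqI[OF p])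
    fix s assume "s \<in> D"
    then have s: "s + 2 * pi * of_int k \<in> D1" by (auto simp: D1_def add.commute)
    moreover have "\<gamma>' (s + 2 * pi * of_int k) = \<gamma> s" using val[OF s] by (simp add: \<gamma>1_def)
    ultimately show "\<exists>\<tau>'\<in>D'. dir \<tau>' = dir s \<and> \<gamma>' \<tau>' = \<gamma> s" using D1 dir_shift by blast
  next
    fix s assume "s \<in> D'"
    then have "s \<in> D1" using D1 by blast
    then obtain t where "t \<in> D" "s = t + 2 * pi * of_int k" by (auto simp: D1_def)
    then show "\<exists>\<tau>'\<in>D. dir \<tau>' = dir s" using dir_shift by metis
  qed
qed

text \<open>
  Where the vine ends, its points become short and thus converge to \<open>Diagonal\<close>. A nearby direction on the vine may
  be given by an angle that is far from the end point; the shifted path has an angle close to it.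
\<close>

lemma continuous_wrt_vine:
  assumes m: "maximal_path D \<gamma>"
  shows "continuous_wrt circle pd_dist (vine D \<gamma>)"
  unfolding continuous_wrt_def
proof (intro ballI allI impI)
  fix p :: "real^2" and \<epsilon> :: real assume "p \<in> topspace circle" and \<epsilon>: "0 < \<epsilon>"
  then have p: "p \<in> sphere 0 1" by simp
  note path = maximal_pathD(1)[OF m]
  have nhd: "openin circle (sphere 0 1 \<inter> ball p \<delta>)" "p \<in> sphere 0 1 \<inter> ball p \<delta>" if "0 < \<delta>" for \<delta>
    using that p by (auto intro: openin_open_Int)
  show "\<exists>U. openin circle U \<and> p \<in> U \<and> (\<forall>q\<in>U. pd_dist (vine D \<gamma> p) (vine D \<gamma> q) < ennreal \<epsilon>)"
  using path
  proof (cases rule: vine_cases[where v = p])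
    case (on \<tau>)
    have "open D" "continuous_on D \<gamma>" using path by (auto simp: ispath_def)
    obtain \<kappa>1 where \<kappa>1: "0 < \<kappa>1" "ball \<tau> \<kappa>1 \<subseteq> D" using \<open>open D\<close> on(1) open_contains_ball by blast
    obtain \<kappa>2 where \<kappa>2: "0 < \<kappa>2" "\<And>s. s \<in> D \<Longrightarrow> dist s \<tau> < \<kappa>2 \<Longrightarrow> dist (\<gamma> s) (\<gamma> \<tau>) < \<epsilon>"
      using \<open>continuous_on D \<gamma>\<close>[unfolded continuous_on_iff, rule_format, OF on(1) \<epsilon>] by blast
    have "0 < min \<kappa>1 \<kappa>2" using \<kappa>1 \<kappa>2 by simp
    then obtain \<delta> where \<delta>: "0 < \<delta>"
        "\<And>q. q \<in> sphere 0 1 \<Longrightarrow> dist q p < \<delta> \<Longrightarrow> \<exists>s. \<bar>s - \<tau>\<bar> < min \<kappa>1 \<kappa>2 \<and> q = - dir s"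
      using dir_open[of "min \<kappa>1 \<kappa>2" \<tau>] unfolding on(2) by blast
    have "pd_dist (vine D \<gamma> p) (vine D \<gamma> q) < ennreal \<epsilon>" if q: "q \<in> sphere 0 1 \<inter> ball p \<delta>" for q
    proof -
      have "dist q p < \<delta>" using q by (simp add: dist_commute)
      then obtain s where s: "\<bar>s - \<tau>\<bar> < min \<kappa>1 \<kappa>2" "q = - dir s" using \<delta>(2)[of q] q by blast
      have "s \<in> ball \<tau> \<kappa>1" using s(1) by (simp add: dist_real_def abs_minus_commute)
      then have sD: "s \<in> D" using \<kappa>1 by blast
      have d: "dist (\<gamma> \<tau>) (\<gamma> s) < \<epsilon>"
        using \<kappa>2(2)[OF sD] s(1) by (simp add: dist_real_def dist_commute)
      have "\<bar>fst (\<gamma> \<tau>) - fst (\<gamma> s)\<bar> < \<epsilon>" "\<bar>snd (\<gamma> \<tau>) - snd (\<gamma> s)\<bar> < \<epsilon>"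
        using dist_fst_le[of "\<gamma> \<tau>" "\<gamma> s"] dist_snd_le[of "\<gamma> \<tau>" "\<gamma> s"] d by (simp_all add: dist_real_def)
      then have "ennreal (max \<bar>fst (\<gamma> \<tau>) - fst (\<gamma> s)\<bar> \<bar>snd (\<gamma> \<tau>) - snd (\<gamma> s)\<bar>) < ennreal \<epsilon>"
        using \<epsilon> by (intro ennreal_lessI) auto
      then show ?thesis unfolding on(3) s(2) vine_at[OF path sD] pd_dist_of_pair .
    qed
    then show ?thesis using nhd[OF \<delta>(1)] by blast
  next
    case off
    obtain \<tau>1 where \<tau>1: "p = - dir \<tau>1" using dir_surj[OF p] by blast
    obtain \<kappa> where \<kappa>: "0 < \<kappa>"
        "\<And>D \<gamma> \<tau>. maximal_path D \<gamma> \<Longrightarrow> \<tau>1 \<notin> D \<Longrightarrow> \<tau> \<in> D \<Longrightarrow> \<bar>\<tau> - \<tau>1\<bar> < \<kappa> \<Longrightarrow> len (\<gamma> \<tau>) < \<epsilon>"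
      using maximal_path_end[OF \<epsilon>, of \<tau>1] by blast
    obtain \<delta> where \<delta>: "0 < \<delta>" "\<And>q. q \<in> sphere 0 1 \<Longrightarrow> dist q p < \<delta> \<Longrightarrow> \<exists>s. \<bar>s - \<tau>1\<bar> < \<kappa> \<and> q = - dir s"
      using dir_open[OF \<kappa>(1), of \<tau>1] unfolding \<tau>1 by blast
    have "pd_dist (vine D \<gamma> p) (vine D \<gamma> q) < ennreal \<epsilon>" if q: "q \<in> sphere 0 1 \<inter> ball p \<delta>" for q
    using path
    proof (cases rule: vine_cases[where v = q])
      case (on \<tau>)
      have "dist q p < \<delta>" using q by (simp add: dist_commute)
      then obtain s where s: "\<bar>s - \<tau>1\<bar> < \<kappa>" "q = - dir s" using \<delta>(2)[of q] q by blast
      have "dir s = dir \<tau>" using s(2) on(2) by simp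
      then obtain k :: int where k: "s = \<tau> + 2 * pi * of_int k" using dir_eq_iff by blast
      have "len (\<gamma> (s - 2 * pi * of_int k)) < \<epsilon>"
      proof (rule \<kappa>(2)[OF maximal_path_shift[OF m] _ _ s(1)])
        show "s \<in> (+) (2 * pi * of_int k) ` D" using k on(1) by auto
        show "\<tau>1 \<notin> (+) (2 * pi * of_int k) ` D"
        proof
          assume "\<tau>1 \<in> (+) (2 * pi * of_int k) ` D"
          then obtain t where "t \<in> D" "\<tau>1 = t + 2 * pi * of_int k" by auto
          then show False using off(1)[of t] \<tau>1 dir_shift by simp
        qed
      qed
      moreover have "\<gamma> \<tau> \<in> Pos \<tau>" using path on(1) by (simp add: ispath_def)
      then have "0 < len (\<gamma> \<tau>)" by (simp add: Pos_def pos_def)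
      ultimately have "len (\<gamma> \<tau>) / 2 < \<epsilon>" using k by simp
      then have "ennreal (len (\<gamma> \<tau>) / 2) < ennreal \<epsilon>" using \<epsilon> by (rule ennreal_lessI[rotated])
      then show ?thesis unfolding on(3) off(2) pd_dist_of_pair .
    qed (use off \<epsilon> in simp)
    then show ?thesis using nhd[OF \<delta>(1)] by blast
  qed
qed

lemma pd_section_vine:
  assumes m: "maximal_path D \<gamma>"
  shows "pd_section circle (PD0 TYPE('f) M) (vine D \<gamma>)"
  unfolding pd_section_def
proof (intro conjI ballI)
  note path = maximal_pathD(1)[OF m]
  show "continuous_wrt circle pd_dist (vine D \<gamma>)" by (rule continuous_wrt_vine[OF m])
  fix p :: "real^2" assume "p \<in> topspace circle"
  then have p: "p \<in> sphere 0 1" by simp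
  show "0 < PD0 TYPE('f) M p (vine D \<gamma> p)"
  using path
  proof (cases rule: vine_cases[where v = p])
    case (on \<tau>)
    then have "\<gamma> \<tau> \<in> pts p" using path by (simp add: ispath_def Pos_def pos_def)
    then show ?thesis unfolding PD0_pos_iff(1)[OF p] using on(3) by blast
  next
    case off
    then show ?thesis unfolding PD0_pos_iff(1)[OF p] by blast
  qed
next
  note path = maximal_pathD(1)[OF m]
  have "p \<in> (\<lambda>\<tau>. - dir \<tau>) ` D" if "vine D \<gamma> p \<noteq> Diagonal" for p
    using that vine_off by blast
  moreover have "vine D \<gamma> (- dir \<tau>) \<noteq> Diagonal" if "\<tau> \<in> D" for \<tau>
    unfolding vine_at[OF path that] of_pair_eqs by simp
  ultimately have "{p \<in> topspace circle. vine D \<gamma> p \<noteq> Diagonal} = (\<lambda>\<tau>. - dir \<tau>) ` D"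
    using dir_in_sphere by auto
  moreover have "connected ((\<lambda>\<tau>. - dir \<tau>) ` D)"
    using path by (intro connected_continuous_image continuous_on_minus continuous_on_dir) (simp add: ispath_def)
  ultimately show "connectedin circle {p \<in> topspace circle. vine D \<gamma> p \<noteq> Diagonal}"
    by (auto simp: connectedin_subtopology)
qed

definition essential_section :: "real^2 \<Rightarrow> pd_elem" where
  "essential_section v = Pt (ereal (lowest v)) \<infinity>"

lemma pd_section_essential: "pd_section circle (PD0 TYPE('f) M) essential_section"
  unfolding pd_section_def continuous_wrt_def
proof (intro conjI ballI allI impI)
  fix p :: "real^2" and \<epsilon> :: real assume "p \<in> topspace circle" and \<epsilon>: "0 < \<epsilon>"
  then have p: "p \<in> sphere 0 1" by simp
  obtain U where U: "openin circle U" "p \<in> U" "\<And>q. q \<in> U \<Longrightarrow> q \<in> sphere 0 1 \<and> height_close (\<epsilon> / 2) p q"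
    using circle_nhd[OF p, of "\<epsilon> / 2"] \<epsilon> by auto
  have "pd_dist (essential_section p) (essential_section q) < ennreal \<epsilon>" if "q \<in> U" for q
  proof -
    have "\<bar>lowest p - lowest q\<bar> \<le> \<epsilon> / 2" using lowest_close[OF p] U(3)[OF that] by blast
    also have "\<dots> < \<epsilon>" using \<epsilon> by simp
    finally have "\<bar>lowest p - lowest q\<bar> < \<epsilon>" .
    then have "ennreal \<bar>lowest p - lowest q\<bar> < ennreal \<epsilon>" using \<epsilon> by (rule ennreal_lessI[rotated])
    then show ?thesis unfolding essential_section_def pd_dist_essential .
  qed
  then show "\<exists>U. openin circle U \<and> p \<in> U \<and>
      (\<forall>q\<in>U. pd_dist (essential_section p) (essential_section q) < ennreal \<epsilon>)" using U by blast
next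
  fix p :: "real^2" assume "p \<in> topspace circle"
  then have p: "p \<in> sphere 0 1" by simp
  show "0 < PD0 TYPE('f) M p (essential_section p)"
    unfolding PD0_pos_iff(1)[OF p] essential_section_def by blast
next
  have "{p \<in> topspace circle. essential_section p \<noteq> Diagonal} = range (\<lambda>\<tau>. - dir \<tau>)"
    using dir_surj by (auto simp: essential_section_def)
  moreover have "connected (range (\<lambda>\<tau>. - dir \<tau>))"
    by (intro connected_continuous_image continuous_on_minus continuous_on_dir connected_UNIV)
  ultimately show "connectedin circle {p \<in> topspace circle. essential_section p \<noteq> Diagonal}"
    by (auto simp: connectedin_subtopology)
qed

text \<open>
  For a bar of length \<open>0\<close>. Its point has distance \<open>0\<close> from \<open>Diagonal\<close>, so that this function is continuous.
\<close>

definition spike :: "real^2 \<Rightarrow> real \<times> real \<Rightarrow> real^2 \<Rightarrow> pd_elem" where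
  "spike p x v = (if v = p then of_pair x else Diagonal)"

lemma pd_section_spike:
  assumes p: "p \<in> sphere 0 1" and x: "x \<in> pts p - pos p"
  shows "pd_section circle (PD0 TYPE('f) M) (spike p x)"
  unfolding pd_section_def continuous_wrt_def
proof (intro conjI ballI allI impI)
  fix q :: "real^2" and \<epsilon> :: real assume q: "q \<in> topspace circle" and \<epsilon>: "0 < \<epsilon>"
  have "fst x \<le> snd x" using pts_bounds(1)[OF p, of "fst x" "snd x"] x by simp
  then have "len x = 0" using x by (simp add: pos_def)
  then have "pd_dist (spike p x v) (spike p x w) = 0" for v w
    by (auto simp: spike_def pd_dist_of_pair)
  then show "\<exists>U. openin circle U \<and> q \<in> U \<and> (\<forall>w\<in>U. pd_dist (spike p x q) (spike p x w) < ennreal \<epsilon>)"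
    using q \<epsilon> by (intro exI[of _ "topspace circle"] conjI openin_topspace) auto
next
  fix q :: "real^2" assume "q \<in> topspace circle"
  then have q: "q \<in> sphere 0 1" by simp
  show "0 < PD0 TYPE('f) M q (spike p x q)"
    unfolding PD0_pos_iff(1)[OF q] spike_def using x by auto
next
  have "{q \<in> topspace circle. spike p x q \<noteq> Diagonal} = {p}" using p by (auto simp: spike_def)
  then show "connectedin circle {q \<in> topspace circle. spike p x q \<noteq> Diagonal}"
    using p by (auto simp: connectedin_subtopology)
qed

definition canonical_sections :: "(real^2 \<Rightarrow> pd_elem) set" where
  "canonical_sections = {essential_section} \<union> {vine D \<gamma> | D \<gamma>. maximal_path D \<gamma>} \<union>
     {spike p x | p x. p \<in> sphere 0 1 \<and> x \<in> pts p - pos p}"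

lemma canonical_sectionE:
  assumes "g \<in> canonical_sections"
  obtains (essential) "g = essential_section" | (vine) D \<gamma> where "maximal_path D \<gamma>" "g = vine D \<gamma>"
    | (spike) p x where "p \<in> sphere 0 1" "x \<in> pts p - pos p" "g = spike p x"
  using assms unfolding canonical_sections_def by blast

lemma pd_section_canonical:
  assumes "g \<in> canonical_sections" shows "pd_section circle (PD0 TYPE('f) M) g"
  using assms
proof (cases rule: canonical_sectionE)
  case essential
  then show ?thesis using pd_section_essential by simp
next
  case (vine D \<gamma>)
  then show ?thesis using pd_section_vine by simp
next
  case (spike p x)
  then show ?thesis using pd_section_spike by blast
qed

lemma vine_in_pos:
  assumes "maximal_path D \<gamma>" "vine D \<gamma> v = of_pair x"
  shows "x \<in> pos v"
proof -
  have p: "ispath D \<gamma>" by (rule maximal_pathD(1)[OF assms(1)])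
  show ?thesis
  using p
  proof (cases rule: vine_cases[where v = v])
    case (on \<tau>)
    then have "\<gamma> \<tau> = x" using assms(2) by simp
    then show ?thesis using p on by (auto simp: ispath_def Pos_def)
  qed (use assms(2) in simp)
qed

text \<open>
  The three kinds of sections take values in disjoint sets: the infinite point, points of positive length, and points of
  length \<open>0\<close>.
\<close>

lemma canonical_section_through:
  assumes v: "v \<in> sphere 0 1" and u: "0 < PD0 TYPE('f) M v u" "u \<noteq> Diagonal"
  shows "\<exists>!g. g \<in> canonical_sections \<and> g v = u"
proof -
  have no_ess: "essential_section v \<noteq> of_pair x" for x unfolding essential_section_def of_pair_eqs by simp
  consider (ess) "u = essential_section v" | (long) x where "x \<in> pos v" "u = of_pair x"
    | (short) x where "x \<in> pts v - pos v" "u = of_pair x"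
    using u PD0_pos_iff(1)[OF v, of u] unfolding essential_section_def by blast
  then show ?thesis
  proof cases
    case ess
    have "vine D \<gamma> v \<noteq> u" for D \<gamma>
      unfolding vine_def ess essential_section_def by (simp add: of_pair_eqs)
    moreover have "spike p x v \<noteq> u" for p x
      unfolding spike_def ess essential_section_def by (simp add: of_pair_eqs)
    ultimately have "g = essential_section" if "g \<in> canonical_sections" "g v = u" for g
      using that by (metis canonical_sectionE)
    moreover have "essential_section \<in> canonical_sections" by (simp add: canonical_sections_def)
    ultimately show ?thesis using ess by blast
  next
    case (long x)
    obtain \<tau> where \<tau>: "v = - dir \<tau>" using dir_surj[OF v] by blast
    have "x \<in> Pos \<tau>" using long \<tau> by (simp add: Pos_def)
    then obtain D \<gamma> where m: "maximal_path D \<gamma>" "\<tau> \<in> D" "\<gamma> \<tau> = x" using maximal_path_exists by blast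
    have g: "vine D \<gamma> v = of_pair x" unfolding \<tau> using vine_at[OF maximal_pathD(1)[OF m(1)] m(2)] m(3) by simp
    have "spike p y v \<noteq> u" if "y \<in> pts p - pos p" for p y
      using that long unfolding spike_def by auto
    then have short: "spike p y v \<noteq> of_pair x" if "y \<in> pts p - pos p" for p y using that long(2) by blast
    show ?thesis unfolding long(2)
    proof (rule ex1I[of _ "vine D \<gamma>"])
      show "vine D \<gamma> \<in> canonical_sections \<and> vine D \<gamma> v = of_pair x"
        using m(1) g by (auto simp: canonical_sections_def)
      fix h assume h: "h \<in> canonical_sections \<and> h v = of_pair x"
      then obtain D' \<gamma>' where "h = vine D' \<gamma>'" "maximal_path D' \<gamma>'"
        using no_ess short by (metis canonical_sectionE)
      then show "h = vine D \<gamma>" using vine_eq[OF _ m(1) _ g] h by blast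
    qed
  next
    case (short x)
    have "vine D \<gamma> v \<noteq> u" if "maximal_path D \<gamma>" for D \<gamma> using vine_in_pos[OF that, of v x] short by blast
    moreover have "spike p y = spike v x" if "spike p y v = u" for p y
      using that short unfolding spike_def by (auto split: if_splits)
    moreover have "spike v x v = u" using short by (simp add: spike_def)
    ultimately have "g = spike v x" if "g \<in> canonical_sections" "g v = u" for g
      using that no_ess short(2) by (metis canonical_sectionE)
    moreover have "spike v x \<in> canonical_sections"
      unfolding canonical_sections_def using v short(1) by blast
    ultimately show ?thesis using \<open>spike v x v = u\<close> by blast
  qed
qed

theorem trivial_geometric_monodromy_PD0: "trivial_geometric_monodromy circle (PD0 TYPE('f) M)"
  unfolding trivial_geometric_monodromy_def
proof (intro exI conjI ballI allI impI)
  \<comment> \<open>No section is repeated, so the second component of the index is always \<open>0\<close>.\<close>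
  let ?I = "(\<lambda>g. (g, 0::nat)) ` canonical_sections"
  show "pd_section circle (PD0 TYPE('f) M) (fst i)" if "i \<in> ?I" for i
    using that pd_section_canonical by auto
  fix p :: "real^2" and u assume "p \<in> topspace circle" and u: "u \<noteq> Diagonal"
  then have p: "p \<in> sphere 0 1" by simp
  have eq: "{i \<in> ?I. fst i p = u} = (\<lambda>g. (g, 0)) ` {g \<in> canonical_sections. g p = u}" by auto
  have "finite {g \<in> canonical_sections. g p = u} \<and>
      PD0 TYPE('f) M p u = card {g \<in> canonical_sections. g p = u}"
  proof (cases "0 < PD0 TYPE('f) M p u")
    case True
    then have "PD0 TYPE('f) M p u = 1" using PD0_pos_iff(2)[OF p, of u] by simp
    moreover obtain g where "{g \<in> canonical_sections. g p = u} = {g}"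
      using canonical_section_through[OF p True u] by blast
    ultimately show ?thesis by simp
  next
    case False
    have "g p \<noteq> u" if "g \<in> canonical_sections" for g
    proof -
      have "0 < PD0 TYPE('f) M p (g p)"
        using pd_section_canonical[OF that] \<open>p \<in> topspace circle\<close> unfolding pd_section_def by blast
      then show ?thesis using False by blast
    qed
    then have none: "{g \<in> canonical_sections. g p = u} = {}" by blast
    show ?thesis unfolding none using False by simp
  qed
  then show "finite {i \<in> ?I. fst i p = u}" "PD0 TYPE('f) M p u = card {i \<in> ?I. fst i p = u}"
    unfolding eq by (auto simp: card_image inj_on_def)
qed

end

theorem proposition4p7:
  fixes M :: "(real^2) set"
  assumes "starlike M"
    and "polytope (convex hull M)"
    and "aff_dim (convex hull M) = 2"
    and "\<forall>v\<in>sphere 0 1.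
           pointwise_finite_dim (PH0 M v :: ('f::field, (real^2) set \<Rightarrow>\<^sub>0 'f) pers_module)"
    and "simple_PD0 TYPE('f) M"
  shows "pd_bundle circle (PD0 TYPE('f) M) \<and>
         trivial_geometric_monodromy circle (PD0 TYPE('f) M)"
proof -
  obtain c where c: "c \<in> M" "\<And>x. x \<in> M \<Longrightarrow> closed_segment c x \<subseteq> M"
    using assms(1) by (auto simp: starlike_def)
  have "bounded M"
    using bounded_subset[OF polytope_imp_bounded[OF assms(2)] hull_subset] .
  then obtain R where R: "\<And>x. x \<in> M \<Longrightarrow> norm x \<le> R" by (auto simp: bounded_iff)
  have fin: "finite (components (sublevel M v t))" if v: "v \<in> sphere 0 1" for v t
  proof (rule finite_dim_imp_finite_components)
    show "pointwise_finite_dim (H0_module (sublevel M v) :: ('f, (real^2) set \<Rightarrow>\<^sub>0 'f) pers_module)"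
      using bspec[OF assms(4) v] unfolding PH0_eq_H0_module .
  qed
  interpret plane_star M c R "TYPE('f)"
    by unfold_locales (use c R fin assms(5) in auto)
  show ?thesis using pd_bundle_PD0 trivial_geometric_monodromy_PD0 by blast
qed

end
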